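(* There exists a universal constant $C > 4$ such that the following holds. Let $d \ge 1$ and $n \le d^2/C$, and let $G_1, \ldots, G_n$ be i.i.d. samples from the Gaussian distribution $\mathcal{N}(0, \frac{1}{d} I_d)$ on $\mathbb{R}^d$. Then, with probability $1 - o_d(1)$ (i.e. with probability tending to $1$ as $d \to \infty$, uniformly over such $n$), there exists a positive semidefinite matrix $Q \in \mathbb{R}^{d\times d}$, $Q \succeq 0$, such that $\langle G_i, Q G_i\rangle = 1$ for all $i \in [n]$.
   Context: $\langle\cdot,\cdot\rangle$ is the standard Euclidean inner product on $\mathbb{R}^d$. Equivalently, the conclusion says that there is an origin-symmetric ellipsoid $\{x : \langle x, Qx\rangle = 1\}$ passing through all the points $G_1,\dots,G_n$. *)

theory Defs
  imports "HOL-Probability.Probability"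
begin

definition quad_form :: "nat \<Rightarrow> (nat \<Rightarrow> nat \<Rightarrow> real) \<Rightarrow> (nat \<Rightarrow> real) \<Rightarrow> real" where
  "quad_form d Q x = (\<Sum>j<d. \<Sum>k<d. x j * Q j k * x k)"

definition psd_mat :: "nat \<Rightarrow> (nat \<Rightarrow> nat \<Rightarrow> real) \<Rightarrow> bool" where
  "psd_mat d Q \<longleftrightarrow> (\<forall>j<d. \<forall>k<d. Q j k = Q k j) \<and> (\<forall>x. quad_form d Q x \<ge> 0)"

text \<open>Law of n i.i.d. samples G_1..G_n of N(0, I_d / d): the entries G(i,j),
  i<n, j<d, are i.i.d. real normal with mean 0 and standard deviation 1/sqrt d.\<close>
definition gauss_samples :: "nat \<Rightarrow> nat \<Rightarrow> (nat \<times> nat \<Rightarrow> real) measure" where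
  "gauss_samples d n = PiM ({..<n} \<times> {..<d})
      (\<lambda>_. density lborel (normal_density 0 (1 / sqrt (real d))))"

definition ellipsoid_fit :: "nat \<Rightarrow> nat \<Rightarrow> (nat \<times> nat \<Rightarrow> real) set" where
  "ellipsoid_fit d n = {G. \<exists>Q. psd_mat d Q \<and> (\<forall>i<n. quad_form d Q (\<lambda>j. G (i, j)) = 1)}"

end

theory Submission
  imports Defs "HOL-Real_Asymp.Real_Asymp"
begin

text \<open>
  Look for \<open>Q = I + R\<close>, where \<open>R\<close> consists of two off-diagonal blocks acting on four disjoint groups of
  \<open>m = d div 4\<close> coordinates. Write \<open>a\<^sub>i, b\<^sub>i\<close> for the rescaled restrictions of \<open>G\<^sub>i\<close> to the two groups
  of one block. The block \<open>B\<close>, a combination \<open>\<Sum> \<delta>\<^sub>i a\<^sub>i b\<^sub>i\<^sup>T\<close>, has to satisfy \<open>M \<delta> = t\<close>,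
  where \<open>M i j = \<langle>a\<^sub>i, a\<^sub>j\<rangle> \<langle>b\<^sub>i, b\<^sub>j\<rangle> / m\<^sup>2\<close>. The deviation \<open>1 - |G\<^sub>i|\<^sup>2\<close> is split so that each block only
  corrects the part coming from coordinates outside it; hence \<open>t\<close> is independent of \<open>a\<close> and \<open>b\<close>.

  With high probability \<open>M\<close> is within \<open>1/2\<close> of the identity in operator norm. To avoid losing a
  logarithm, the coordinates of a test vector are grouped dyadically by size after decoupling, and each
  sparse/flat cross term is controlled by an exponential moment conditionally on the sparse part, with
  a union bound over lattice points. The errors sum to \<open>O(sqrt n / m)\<close>.

  Given \<open>a\<close> and \<open>b\<close>, \<open>u\<^sup>T B v = \<langle>t, M\<^sup>-\<^sup>1 w\<rangle>\<close> with \<open>w\<^sub>i = \<langle>a\<^sub>i, u\<rangle> \<langle>b\<^sub>i, v\<rangle> / m\<close> is a combination of independent centred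
  chi-squares. The entries of \<open>w\<close> below a constant have small Euclidean norm even uniformly over a net, so their
  contribution beats the union bound over \<open>(u, v)\<close>; the few large entries are harmless because \<open>\<delta>\<close> is small in
  sup norm. So \<open>B\<close> has small operator norm and \<open>Q\<close> is positive semidefinite.
\<close>

section \<open>Gaussian exponential moments\<close>

text \<open>The two groups of a block are disjoint so that off-diagonal entries of \<open>M\<close>
  have mean zero. With \<open>a = b\<close> they would have mean \<open>1 / m\<close>, a rank-one
  part of norm about \<open>n / m\<close>, and \<open>M\<close> would be far from the identity. A
  coordinate used by a block must not enter its target, which is why there are two blocks: every
  coordinate lies outside at least one.

  The constants are fixed backwards. Since \<open>d <= 5 m\<close>, positivity of \<open>Q\<close>
  needs each block form to be at most \<open>(|u|^2 + |v|^2) / 10\<close>, hence at most 1/20 on the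
  net: 1/40 for the small entries of \<open>w\<close> and 1/40 for the large ones. For the small
  entries a Chernoff bound must beat \<open>exp (10 d)\<close> net points, which fixes their squared
  norm \<open>e = 1/16000000\<close>. A bound \<open>e\<close> that is uniform over
  \<open>exp (40 m)\<close> net points is bought with the exponential parameter
  \<open>K = 1600000000\<close>, where \<open>K m e = 100 m\<close>; integrability at this parameter
  forces the truncation level \<open>r = 1 / (8 K)\<close>, and the large entries then force the sup
  norm \<open>r / 60\<close> of the coefficients. Finally \<open>n <= d^2 / 10^13\<close> keeps both
  the error of \<open>M\<close> and the moment factor \<open>exp (400 K n / m)\<close> within these
  budgets.\<close>

definition gm :: "nat \<Rightarrow> real measure" where
  "gm d = density lborel (normal_density 0 (1 / sqrt (real d)))"

lemma sets_gm [measurable_cong, simp]: "sets (gm d) = sets borel"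
  by (simp add: gm_def)

lemma prob_space_gm: "d > 0 \<Longrightarrow> prob_space (gm d)"
  unfolding gm_def by (rule prob_space_normal_density) simp

lemma nn_integral_normal_density:
  assumes "s > 0"
  shows "(\<integral>\<^sup>+x. ennreal (normal_density \<mu> s x) \<partial>lborel) = 1"
  using prob_space.emeasure_space_1[OF prob_space_normal_density[OF assms, of \<mu>]]
  by (simp add: emeasure_density)

text \<open>Exponential tilting: once the square is completed, the tilted density is a multiple of
  another normal density, whose mass is one. Under \<open>gm d\<close> the variable
  \<open>sqrt d * x\<close> is standard normal, which explains this scaling throughout.\<close>

lemma nn_integral_gm_eq:
  assumes s: "s > 0" and c: "c \<ge> 0"
    and f[measurable]: "f \<in> borel_measurable borel" and f0: "\<And>x. f x \<ge> 0"
    and eq: "\<And>x. normal_density 0 (1 / sqrt (real d)) x * f x = c * normal_density \<mu> s x"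
  shows "(\<integral>\<^sup>+x. ennreal (f x) \<partial>gm d) = ennreal c" (is "?lhs = _")
proof -
  have "?lhs
      = (\<integral>\<^sup>+x. ennreal (normal_density 0 (1 / sqrt (real d)) x) * ennreal (f x) \<partial>lborel)"
    unfolding gm_def by (subst nn_integral_density) auto
  also have "\<dots> = (\<integral>\<^sup>+x. ennreal c * ennreal (normal_density \<mu> s x) \<partial>lborel)"
    by (intro nn_integral_cong) (simp add: ennreal_mult'[symmetric] f0 eq c)
  also have "\<dots> = ennreal c"
    by (subst nn_integral_cmult) (auto simp: nn_integral_normal_density[OF s])
  finally show ?thesis .
qed

lemma gm_exp_linear:
  assumes "d > 0"
  shows "(\<integral>\<^sup>+x. ennreal (exp (c * (sqrt d * x))) \<partial>gm d) = ennreal (exp (c\<^sup>2 / 2))"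
proof (rule nn_integral_gm_eq)
  show "1 / sqrt (real d) > 0" using assms by simp
  fix x :: real
  have d: "sqrt (real d) * sqrt (real d) = d" "sqrt (real d) > 0" using assms by simp_all
  have "exp (- x\<^sup>2 * d / 2) * exp (c * (sqrt d * x)) =
     exp (c\<^sup>2 / 2) * exp (- (x - c / sqrt d)\<^sup>2 * d / 2)"
    unfolding exp_add[symmetric] using d
    by (simp add: power2_eq_square field_simps)
  then show "normal_density 0 (1 / sqrt (real d)) x * exp (c * (sqrt d * x)) =
      exp (c\<^sup>2 / 2) * normal_density (c / sqrt d) (1 / sqrt d) x"
    unfolding normal_density_def by (simp add: power_divide)
qed auto

lemma gm_exp_square:
  assumes "d > 0" and s: "s < 1 / 2"
  shows "(\<integral>\<^sup>+x. ennreal (exp (s * (sqrt d * x)\<^sup>2)) \<partial>gm d) = ennreal (1 / sqrt (1 - 2 * s))"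
proof (rule nn_integral_gm_eq)
  let ?t = "sqrt (1 - 2 * s)"
  have t: "?t > 0" "?t\<^sup>2 = 1 - 2 * s" using s by simp_all
  show "1 / (sqrt (real d) * ?t) > 0" using assms t by simp
  fix x :: real
  have "exp (- x\<^sup>2 * d / 2) * exp (s * (d * x\<^sup>2)) = exp (- x\<^sup>2 * (d * ?t\<^sup>2) / 2)"
    unfolding exp_add[symmetric] t by (simp add: algebra_simps add_divide_distrib)
  moreover have "1 / sqrt (2 * pi / d) = 1 / ?t * (1 / sqrt (2 * pi / (d * ?t\<^sup>2)))"
    using t assms by (simp add: real_sqrt_divide real_sqrt_mult)
  ultimately show "normal_density 0 (1 / sqrt (real d)) x * exp (s * (sqrt d * x)\<^sup>2) =
     1 / ?t * normal_density 0 (1 / (sqrt d * ?t)) x"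
    unfolding normal_density_def using assms t
    by (simp add: power_divide power_mult_distrib)
qed (use s in auto)

text \<open>Turns the exact chi-square transform into a sub-exponential bound: the linear term is
  cancelled by the centring, and only the quadratic remainder survives.\<close>

lemma inverse_sqrt_le_exp:
  assumes "\<bar>y\<bar> \<le> 1 / 4"
  shows "1 / sqrt (1 - 2 * y) \<le> exp (y + 4 * y\<^sup>2)"
proof -
  have "\<bar>ln (1 + (- 2 * y)) - (- 2 * y)\<bar> \<le> 2 * (- 2 * y)\<^sup>2"
    by (rule abs_ln_one_plus_x_minus_x_bound) (use assms in auto)
  then have "- ln (1 - 2 * y) / 2 \<le> y + 4 * y\<^sup>2" by (simp add: power2_eq_square)
  moreover have "1 / sqrt (1 - 2 * y) = exp (- ln (1 - 2 * y) / 2)"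
    using assms by (simp add: exp_minus ln_sqrt[symmetric] inverse_eq_divide)
  ultimately show ?thesis by simp
qed

lemma gm_exp_centered_square:
  assumes "d > 0" and y: "\<bar>y\<bar> \<le> 1 / 4"
  shows "(\<integral>\<^sup>+x. ennreal (exp (y * ((sqrt d * x)\<^sup>2 - 1))) \<partial>gm d) \<le> ennreal (exp (4 * y\<^sup>2))" (is "?lhs \<le> _")
proof -
  have "?lhs
     = (\<integral>\<^sup>+x. ennreal (exp (- y)) * ennreal (exp (y * (sqrt d * x)\<^sup>2)) \<partial>gm d)"
    by (intro nn_integral_cong) (simp add: ennreal_mult'[symmetric] exp_add[symmetric] algebra_simps)
  also have "\<dots> = ennreal (exp (- y)) * ennreal (1 / sqrt (1 - 2 * y))"
    using gm_exp_square[OF \<open>d > 0\<close>, of y] y by (subst nn_integral_cmult) auto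
  also have "\<dots> \<le> ennreal (exp (- y) * exp (y + 4 * y\<^sup>2))"
    unfolding ennreal_mult'[OF exp_ge_zero, symmetric]
    by (intro ennreal_leI mult_left_mono inverse_sqrt_le_exp y) simp
  also have "exp (- y) * exp (y + 4 * y\<^sup>2) = exp (4 * y\<^sup>2)"
    by (simp add: exp_add[symmetric])
  finally show ?thesis .
qed

section \<open>Integration over rows and slices of a product measure\<close>

lemma nn_integral_rows:
  fixes \<mu> :: "'a measure" and f :: "'i \<Rightarrow> ('j \<Rightarrow> 'a) \<Rightarrow> ennreal"
  assumes \<mu>: "prob_space \<mu>" and T: "finite T" and D: "finite D"
    and f: "\<And>i. i \<in> T \<Longrightarrow> f i \<in> borel_measurable (PiM D (\<lambda>_. \<mu>))"
  shows "(\<integral>\<^sup>+G. (\<Prod>i\<in>T. f i (\<lambda>j\<in>D. G (i, j))) \<partial>PiM (T \<times> D) (\<lambda>_. \<mu>))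
       = (\<Prod>i\<in>T. \<integral>\<^sup>+r. f i r \<partial>PiM D (\<lambda>_. \<mu>))"
  using T f
proof (induction T rule: finite_induct)
  case empty
  interpret prob_space \<mu> by fact
  have "prob_space (PiM ({} :: ('i \<times> 'j) set) (\<lambda>_. \<mu>))" by (rule prob_space_PiM) (rule \<mu>)
  then show ?case by (simp add: prob_space.emeasure_space_1)
next
  case (insert i T)
  interpret prob_space \<mu> by fact
  interpret S: product_sigma_finite "\<lambda>_. \<mu>" ..
  have rowm: "(\<lambda>G. \<lambda>j\<in>D. G (k, j)) \<in> measurable (PiM (U \<times> D) (\<lambda>_. \<mu>)) (PiM D (\<lambda>_. \<mu>))" if "k \<in> U" for k and U :: "'i set"
    by (rule measurable_restrict) (use that in auto)
  have [measurable]: "(\<lambda>G. f k (\<lambda>j\<in>D. G (k, j))) \<in> borel_measurable (PiM (U \<times> D) (\<lambda>_. \<mu>))"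
    if "k \<in> U" "k \<in> insert i T" for k U
    using measurable_compose[OF rowm[OF that(1)] insert.prems[OF that(2)]] .
  have split: "insert i T \<times> D = T \<times> D \<union> {i} \<times> D" by auto
  have disj: "T \<times> D \<inter> {i} \<times> D = {}" using insert.hyps by auto
  have meas: "(\<lambda>G. \<Prod>k\<in>insert i T. f k (\<lambda>j\<in>D. G (k, j))) \<in> borel_measurable (PiM (T \<times> D \<union> {i} \<times> D) (\<lambda>_. \<mu>))"
    unfolding split[symmetric] by (intro borel_measurable_prod_ennreal) auto
  have row: "(\<integral>\<^sup>+y. f i (\<lambda>j\<in>D. y (i, j)) \<partial>PiM ({i} \<times> D) (\<lambda>_. \<mu>)) = (\<integral>\<^sup>+r. f i r \<partial>PiM D (\<lambda>_. \<mu>))"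
  proof -
    have "distr (PiM ({i} \<times> D) (\<lambda>_. \<mu>)) (PiM D (\<lambda>_. \<mu>)) (\<lambda>\<omega>. \<lambda>j\<in>D. \<omega> (i, j)) = PiM D (\<lambda>_. \<mu>)"
      using distr_PiM_reindex[of "{i} \<times> D" "\<lambda>_. \<mu>" "\<lambda>j. (i, j)" D] \<mu> by (auto simp: inj_on_def)
    then have "(\<integral>\<^sup>+r. f i r \<partial>PiM D (\<lambda>_. \<mu>)) = (\<integral>\<^sup>+r. f i r \<partial>distr (PiM ({i} \<times> D) (\<lambda>_. \<mu>)) (PiM D (\<lambda>_. \<mu>)) (\<lambda>\<omega>. \<lambda>j\<in>D. \<omega> (i, j)))"
      by simp
    also have "\<dots> = (\<integral>\<^sup>+y. f i (\<lambda>j\<in>D. y (i, j)) \<partial>PiM ({i} \<times> D) (\<lambda>_. \<mu>))"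
      by (rule nn_integral_distr) (use rowm[of i "{i}"] insert.prems[of i] in simp_all)
    finally show ?thesis ..
  qed
  have inner: "(\<Prod>k\<in>insert i T. f k (\<lambda>j\<in>D. merge (T \<times> D) ({i} \<times> D) (x, y) (k, j)))
     = (\<Prod>k\<in>T. f k (\<lambda>j\<in>D. x (k, j))) * f i (\<lambda>j\<in>D. y (i, j))" for x y
  proof -
    have a: "(\<lambda>j\<in>D. merge (T \<times> D) ({i} \<times> D) (x, y) (k, j)) = (\<lambda>j\<in>D. x (k, j))" if "k \<in> T" for k
      using that by (auto simp: merge_def restrict_def)
    have b: "(\<lambda>j\<in>D. merge (T \<times> D) ({i} \<times> D) (x, y) (i, j)) = (\<lambda>j\<in>D. y (i, j))"
      using insert.hyps by (auto simp: merge_def restrict_def)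
    have c: "(\<Prod>k\<in>T. f k (\<lambda>j\<in>D. merge (T \<times> D) ({i} \<times> D) (x, y) (k, j))) = (\<Prod>k\<in>T. f k (\<lambda>j\<in>D. x (k, j)))"
      by (intro prod.cong refl arg_cong[where f = "f _"] a)
    show ?thesis using insert.hyps by (simp add: b c mult.commute)
  qed
  have "(\<integral>\<^sup>+G. (\<Prod>k\<in>insert i T. f k (\<lambda>j\<in>D. G (k, j))) \<partial>PiM (insert i T \<times> D) (\<lambda>_. \<mu>))
      = (\<integral>\<^sup>+x. \<integral>\<^sup>+y. (\<Prod>k\<in>T. f k (\<lambda>j\<in>D. x (k, j))) * f i (\<lambda>j\<in>D. y (i, j)) \<partial>PiM ({i} \<times> D) (\<lambda>_. \<mu>) \<partial>PiM (T \<times> D) (\<lambda>_. \<mu>))"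
    unfolding split by (subst S.product_nn_integral_fold[OF disj _ _ meas]) (use insert.hyps D in \<open>auto simp only: inner finite_cartesian_product finite.intros\<close>)
  also have "\<dots> = (\<integral>\<^sup>+x. (\<Prod>k\<in>T. f k (\<lambda>j\<in>D. x (k, j))) \<partial>PiM (T \<times> D) (\<lambda>_. \<mu>)) * (\<integral>\<^sup>+r. f i r \<partial>PiM D (\<lambda>_. \<mu>))"
    by (subst nn_integral_cmult) (auto simp: row intro!: nn_integral_multc borel_measurable_prod_ennreal)
  also have "\<dots> = (\<Prod>k\<in>T. \<integral>\<^sup>+r. f k r \<partial>PiM D (\<lambda>_. \<mu>)) * (\<integral>\<^sup>+r. f i r \<partial>PiM D (\<lambda>_. \<mu>))"
    by (subst insert.IH) (auto intro: insert.prems)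
  also have "\<dots> = (\<Prod>k\<in>insert i T. \<integral>\<^sup>+r. f k r \<partial>PiM D (\<lambda>_. \<mu>))"
    using insert.hyps by (simp add: mult.commute)
  finally show ?case .
qed

text \<open>Serves as conditioning: the coordinates outside \<open>J\<close> are frozen at an
  arbitrary \<open>x\<close>, and a bound uniform in \<open>x\<close> bounds the full integral. The
  estimates for cross terms of \<open>M\<close> and for the targets rest on it.\<close>

lemma nn_integral_slice_le:
  assumes \<mu>: "prob_space \<mu>" and I: "finite I" and J: "J \<subseteq> I"
    and f: "f \<in> borel_measurable (PiM I (\<lambda>_. \<mu>))"
    and le: "\<And>x. x \<in> space (PiM (I - J) (\<lambda>_. \<mu>)) \<Longrightarrow>
       (\<integral>\<^sup>+y. f (merge (I - J) J (x, y)) \<partial>PiM J (\<lambda>_. \<mu>)) \<le> c"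
  shows "(\<integral>\<^sup>+x. f x \<partial>PiM I (\<lambda>_. \<mu>)) \<le> c" (is "?lhs \<le> _")
proof -
  interpret prob_space \<mu> by fact
  interpret S: product_sigma_finite "\<lambda>_. \<mu>" ..
  interpret R: prob_space "PiM (I - J) (\<lambda>_. \<mu>)" by (rule prob_space_PiM) (rule \<mu>)
  have IJ: "I - J \<union> J = I" using J by auto
  have "?lhs = (\<integral>\<^sup>+x. f x \<partial>PiM (I - J \<union> J) (\<lambda>_. \<mu>))" by (simp only: IJ)
  also have "\<dots> = (\<integral>\<^sup>+x. \<integral>\<^sup>+y. f (merge (I - J) J (x, y)) \<partial>PiM J (\<lambda>_. \<mu>) \<partial>PiM (I - J) (\<lambda>_. \<mu>))"
    by (rule S.product_nn_integral_fold) (use I J f IJ in \<open>auto simp only: intro: finite_subset\<close>)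
  also have "\<dots> \<le> (\<integral>\<^sup>+x. c \<partial>PiM (I - J) (\<lambda>_. \<mu>))"
    by (intro nn_integral_mono le)
  also have "\<dots> = c"
    by (simp add: R.emeasure_space_1)
  finally show ?thesis .
qed

lemmas borel_arith = borel_measurable_le borel_measurable_abs borel_measurable_sum borel_measurable_diff borel_measurable_add
  borel_measurable_divide borel_measurable_power borel_measurable_times borel_measurable_const

lemmas meas_exp = measurable_compose[OF measurable_compose[OF _ borel_measurable_exp] measurable_ennreal]

type_synonym sample = "nat \<times> nat \<Rightarrow> real"

abbreviation PG :: "nat \<Rightarrow> 'i set \<Rightarrow> ('i \<Rightarrow> real) measure" where
  "PG d I \<equiv> PiM I (\<lambda>_. gm d)"

lemma prob_space_PG: "d > 0 \<Longrightarrow> prob_space (PG d I)"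
  by (intro prob_space_PiM prob_space_gm)

lemma meas_coord [measurable]: "i \<in> I \<Longrightarrow> (\<lambda>r. r i) \<in> borel_measurable (PG d I)"
  using measurable_component_singleton[of i I "\<lambda>_. gm d"] by (simp cong: measurable_cong_sets)

section \<open>Linear, quadratic and bilinear Gaussian forms\<close>

lemma PG_exp_sum:
  assumes d: "d > 0" and D: "finite D" and h: "\<And>j. j \<in> D \<Longrightarrow> h j \<in> borel_measurable borel"
  shows "(\<integral>\<^sup>+r. ennreal (exp (\<Sum>j\<in>D. h j (r j))) \<partial>PG d D)
       = (\<Prod>j\<in>D. \<integral>\<^sup>+x. ennreal (exp (h j x)) \<partial>gm d)" (is "?lhs = _")
proof -
  interpret prob_space "gm d" by (rule prob_space_gm[OF d])
  interpret product_sigma_finite "\<lambda>_. gm d" ..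
  have "?lhs
     = (\<integral>\<^sup>+r. (\<Prod>j\<in>D. ennreal (exp (h j (r j)))) \<partial>PG d D)"
    using D by (simp add: exp_sum prod_ennreal)
  also have "\<dots> = (\<Prod>j\<in>D. \<integral>\<^sup>+x. ennreal (exp (h j x)) \<partial>gm d)"
    by (rule product_nn_integral_prod[OF D], intro meas_exp)
      (simp add: h measurable_cong_sets[OF sets_gm refl])
  finally show ?thesis .
qed

lemma PG_exp_linear:
  assumes d: "d > 0" and D: "finite D"
  shows "(\<integral>\<^sup>+r. ennreal (exp (\<Sum>j\<in>D. c j * (sqrt d * r j))) \<partial>PG d D)
       = ennreal (exp ((\<Sum>j\<in>D. (c j)\<^sup>2) / 2))"
  using D by (simp add: PG_exp_sum[OF d D, of "\<lambda>j x. c j * (sqrt d * x)"] gm_exp_linear[OF d]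
      prod_ennreal exp_sum[symmetric] sum_divide_distrib)

lemma PG_exp_centered_squares:
  assumes d: "d > 0" and D: "finite D" and y: "\<And>j. j \<in> D \<Longrightarrow> \<bar>y j\<bar> \<le> 1 / 4"
  shows "(\<integral>\<^sup>+r. ennreal (exp (\<Sum>j\<in>D. y j * ((sqrt d * r j)\<^sup>2 - 1))) \<partial>PG d D)
       \<le> ennreal (exp (4 * (\<Sum>j\<in>D. (y j)\<^sup>2)))" (is "?lhs \<le> _")
proof -
  have "?lhs
     = (\<Prod>j\<in>D. \<integral>\<^sup>+x. ennreal (exp (y j * ((sqrt d * x)\<^sup>2 - 1))) \<partial>gm d)"
    by (rule PG_exp_sum[OF d D, of "\<lambda>j x. y j * ((sqrt d * x)\<^sup>2 - 1)"]) simp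
  also have "\<dots> \<le> (\<Prod>j\<in>D. ennreal (exp (4 * (y j)\<^sup>2)))"
    by (intro prod_mono_ennreal gm_exp_centered_square d y)
  also have "\<dots> = ennreal (exp (4 * (\<Sum>j\<in>D. (y j)\<^sup>2)))"
    using D by (simp add: prod_ennreal exp_sum[symmetric] sum_distrib_left)
  finally show ?thesis .
qed

text \<open>The square in the exponent is linearized by an auxiliary Gaussian:
  \<open>exp (s y\<^sup>2)\<close> is the mean of \<open>exp (sqrt (2 s) y g)\<close>.\<close>

lemma PG_exp_linear_square:
  assumes d: "d > 0" and D: "finite D" and s: "s \<ge> 0" and q: "(\<Sum>j\<in>D. (c j)\<^sup>2) \<le> q" "2 * s * q < 1"
  shows "(\<integral>\<^sup>+r. ennreal (exp (s * (\<Sum>j\<in>D. c j * (sqrt d * r j))\<^sup>2)) \<partial>PG d D)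
       \<le> ennreal (1 / sqrt (1 - 2 * s * q))" (is "?lhs \<le> _")
proof -
  interpret A: prob_space "PG d D" by (rule prob_space_PG[OF d])
  interpret B: prob_space "gm 1" by (rule prob_space_gm) simp
  interpret P: pair_sigma_finite "gm 1" "PG d D" ..
  define F where "F = (\<lambda>g r. ennreal (exp (sqrt (2 * s) * (\<Sum>j\<in>D. c j * (sqrt d * r j)) * g)))"
  have meas: "case_prod F \<in> borel_measurable (gm 1 \<Otimes>\<^sub>M PG d D)"
    unfolding F_def by measurable
  have "?lhs
      = (\<integral>\<^sup>+r. \<integral>\<^sup>+g. F g r \<partial>gm 1 \<partial>PG d D)"
  proof (intro nn_integral_cong)
    fix r
    show "ennreal (exp (s * (\<Sum>j\<in>D. c j * (sqrt d * r j))\<^sup>2)) = (\<integral>\<^sup>+g. F g r \<partial>gm 1)"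
      using gm_exp_linear[of 1 "sqrt (2 * s) * (\<Sum>j\<in>D. c j * (sqrt d * r j))"] s
      by (simp add: F_def power_mult_distrib)
  qed
  also have "\<dots> = (\<integral>\<^sup>+g. \<integral>\<^sup>+r. F g r \<partial>PG d D \<partial>gm 1)"
    by (rule P.Fubini'[OF meas])
  also have "\<dots> = (\<integral>\<^sup>+g. ennreal (exp (s * (\<Sum>j\<in>D. (c j)\<^sup>2) * (sqrt 1 * g)\<^sup>2)) \<partial>gm 1)"
  proof (intro nn_integral_cong)
    fix g
    have "(\<integral>\<^sup>+r. F g r \<partial>PG d D) = (\<integral>\<^sup>+r. ennreal (exp (\<Sum>j\<in>D. (sqrt (2 * s) * g * c j) * (sqrt d * r j))) \<partial>PG d D)"
      by (simp add: F_def sum_distrib_left sum_distrib_right mult_ac)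
    also have "\<dots> = ennreal (exp ((\<Sum>j\<in>D. (sqrt (2 * s) * g * c j)\<^sup>2) / 2))"
      by (rule PG_exp_linear[OF d D])
    also have "(\<Sum>j\<in>D. (sqrt (2 * s) * g * c j)\<^sup>2) / 2 = s * (\<Sum>j\<in>D. (c j)\<^sup>2) * (sqrt 1 * g)\<^sup>2"
      using s by (simp add: power_mult_distrib sum_distrib_left sum_distrib_right sum_divide_distrib mult_ac)
    finally show "(\<integral>\<^sup>+r. F g r \<partial>PG d D) = ennreal (exp (s * (\<Sum>j\<in>D. (c j)\<^sup>2) * (sqrt 1 * g)\<^sup>2))" .
  qed
  also have "\<dots> \<le> (\<integral>\<^sup>+g. ennreal (exp (s * q * (sqrt (real 1) * g)\<^sup>2)) \<partial>gm 1)"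
    using s q by (intro nn_integral_mono ennreal_leI) (auto intro!: mult_right_mono mult_left_mono)
  also have "\<dots> = ennreal (1 / sqrt (1 - 2 * s * q))"
    using gm_exp_square[of 1 "s * q"] q by (simp add: mult.assoc)
  finally show ?thesis .
qed

lemma exp_sum_convex:
  fixes \<rho> t :: "'a \<Rightarrow> real"
  assumes "finite S" "(\<Sum>q\<in>S. \<rho> q) = 1" "\<And>q. q \<in> S \<Longrightarrow> \<rho> q \<ge> 0"
  shows "exp (\<Sum>q\<in>S. \<rho> q * t q) \<le> (\<Sum>q\<in>S. \<rho> q * exp (t q))"
proof -
  have "S \<noteq> {}" using assms(2) by auto
  from convex_on_sum[OF assms(1) this exp_convex assms(2,3)] show ?thesis by simp
qed

text \<open>Integrating out the coordinates in \<open>B\<close> leaves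
  \<open>exp (l^2 / 2 * |y|^2)\<close> with each \<open>y q\<close> linear in the coordinates of
  \<open>A\<close>. Instead of diagonalizing this quadratic form, \<open>|y|^2\<close> is read as a
  convex combination, with the squared column norms \<rho> of \<open>Z\<close> as weights, of
  squares of normalized linear forms; Jensen's inequality reduces the claim to a single
  square.\<close>

lemma PG_exp_bilinear:
  fixes Z :: "'i \<Rightarrow> 'i \<Rightarrow> real"
  assumes d: "d > 0" and D: "finite D" and AB: "A \<subseteq> D" "B \<subseteq> D" "A \<inter> B = {}"
    and Z: "(\<Sum>p\<in>A. \<Sum>q\<in>B. (Z p q)\<^sup>2) = 1" and l: "l\<^sup>2 \<le> 1 / 2"
  shows "(\<integral>\<^sup>+r. ennreal (exp (l * (\<Sum>p\<in>A. \<Sum>q\<in>B. Z p q * (sqrt d * r p) * (sqrt d * r q)))) \<partial>PG d D)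
     \<le> ennreal (exp (l\<^sup>2))" (is "?lhs \<le> _")
proof -
  interpret prob_space "gm d" by (rule prob_space_gm[OF d])
  interpret S: product_sigma_finite "\<lambda>_. gm d" ..
  have fin: "finite A" "finite B" using AB D by (auto intro: finite_subset)
  have IJ: "D - B \<union> B = D" using AB by auto
  define s where "s = l\<^sup>2 / 2"
  define y where "y = (\<lambda>x q. \<Sum>p\<in>A. Z p q * (sqrt d * x p))"
  define \<rho> where "\<rho> = (\<lambda>q. \<Sum>p\<in>A. (Z p q)\<^sup>2)"
  define c where "c = (\<lambda>q p. if p \<in> A then Z p q / sqrt (\<rho> q) else 0)"
  have \<rho>0: "\<rho> q \<ge> 0" for q by (simp add: \<rho>_def sum_nonneg)
  have \<rho>1: "(\<Sum>q\<in>B. \<rho> q) = 1" unfolding \<rho>_def using Z by (subst sum.swap) simp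
  have lin: "(\<Sum>p\<in>D - B. c q p * (sqrt d * x p)) = y x q / sqrt (\<rho> q)" for x q
  proof -
    have "(\<Sum>p\<in>D - B. c q p * (sqrt d * x p)) = (\<Sum>p\<in>A. c q p * (sqrt d * x p))"
      by (rule sum.mono_neutral_right) (use AB D in \<open>auto simp: c_def\<close>)
    then show ?thesis by (simp add: c_def y_def sum_divide_distrib)
  qed
  have csq: "(\<Sum>p\<in>D - B. (c q p)\<^sup>2) \<le> 1" for q
  proof -
    have "(\<Sum>p\<in>D - B. (c q p)\<^sup>2) = (\<Sum>p\<in>A. (c q p)\<^sup>2)"
      by (rule sum.mono_neutral_right) (use AB D in \<open>auto simp: c_def\<close>)
    \<comment> \<open>A zero column needs no separate case here: by the convention
      \<open>x / 0 = 0\<close> the quotient is then 0.\<close>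
    also have "\<dots> = \<rho> q / \<rho> q"
      using \<rho>0[of q] by (simp add: c_def power_divide sum_divide_distrib[symmetric]) (simp add: \<rho>_def)
    finally show ?thesis by simp
  qed
  have inner: "(\<integral>\<^sup>+z. ennreal (exp (l * (\<Sum>p\<in>A. \<Sum>q\<in>B. Z p q * (sqrt d * merge (D - B) B (x, z) p) * (sqrt d * merge (D - B) B (x, z) q)))) \<partial>PG d B)
     = ennreal (exp (s * (\<Sum>q\<in>B. (y x q)\<^sup>2)))" for x
  proof -
    have a: "merge (D - B) B (x, z) p = x p" if "p \<in> A" for z p
      using that AB by (auto simp: merge_def)
    have b: "merge (D - B) B (x, z) q = z q" if "q \<in> B" for z q
      using that AB by (auto simp: merge_def)
    have eq: "l * (\<Sum>p\<in>A. \<Sum>q\<in>B. Z p q * (sqrt d * merge (D - B) B (x, z) p) * (sqrt d * merge (D - B) B (x, z) q))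
       = (\<Sum>q\<in>B. l * y x q * (sqrt d * z q))" for z
      by (subst sum.swap) (simp add: a b y_def sum_distrib_left sum_distrib_right mult_ac)
    show ?thesis unfolding eq PG_exp_linear[OF d fin(2)] s_def
      by (simp add: power_mult_distrib sum_distrib_left sum_divide_distrib)
  qed
  have [measurable]: "(\<lambda>x. y x q) \<in> borel_measurable (PG d (D - B))" for q
    unfolding y_def
  proof (rule borel_measurable_sum)
    fix p assume "p \<in> A"
    then have "p \<in> D - B" using AB by auto
    from meas_coord[OF this, of d]
    show "(\<lambda>x. Z p q * (sqrt (real d) * x p)) \<in> borel_measurable (PG d (D - B))"
      by (intro borel_arith)
  qed
  have conv: "exp (s * (\<Sum>q\<in>B. (y x q)\<^sup>2)) \<le> (\<Sum>q\<in>B. \<rho> q * exp (s * (y x q / sqrt (\<rho> q))\<^sup>2))" for x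
  proof -
    have "s * (y x q)\<^sup>2 = \<rho> q * (s * (y x q / sqrt (\<rho> q))\<^sup>2)" for q
    proof (cases "\<rho> q = 0")
      case True
      then have "\<forall>p\<in>A. Z p q = 0" unfolding \<rho>_def using fin by (subst (asm) sum_nonneg_eq_0_iff) auto
      then show ?thesis using True by (simp add: y_def)
    next
      case False
      then show ?thesis using \<rho>0[of q] by (simp add: power_divide)
    qed
    note eq = this
    have "s * (\<Sum>q\<in>B. (y x q)\<^sup>2) = (\<Sum>q\<in>B. \<rho> q * (s * (y x q / sqrt (\<rho> q))\<^sup>2))"
      unfolding sum_distrib_left by (intro sum.cong refl eq)
    then show ?thesis using exp_sum_convex[OF fin(2) \<rho>1 \<rho>0] by simp
  qed
  have s: "s \<ge> 0" "2 * s * 1 < 1" "\<bar>s\<bar> \<le> 1 / 4" using l by (auto simp: s_def)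
  have "?lhs
     = (\<integral>\<^sup>+r. ennreal (exp (l * (\<Sum>p\<in>A. \<Sum>q\<in>B. Z p q * (sqrt d * r p) * (sqrt d * r q)))) \<partial>PG d (D - B \<union> B))"
    by (simp only: IJ)
  also have "\<dots> = (\<integral>\<^sup>+x. \<integral>\<^sup>+z. ennreal (exp (l * (\<Sum>p\<in>A. \<Sum>q\<in>B. Z p q * (sqrt d * merge (D - B) B (x, z) p) * (sqrt d * merge (D - B) B (x, z) q)))) \<partial>PG d B \<partial>PG d (D - B))"
  proof (rule S.product_nn_integral_fold)
    show "(\<lambda>r. ennreal (exp (l * (\<Sum>p\<in>A. \<Sum>q\<in>B. Z p q * (sqrt d * r p) * (sqrt d * r q))))) \<in> borel_measurable (PG d (D - B \<union> B))"
      unfolding IJ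
    proof (intro meas_exp borel_arith)
      fix p q assume "p \<in> A" "q \<in> B"
      then have "p \<in> D" "q \<in> D" using AB by auto
      then show "(\<lambda>r. r p) \<in> borel_measurable (PG d D)" "(\<lambda>r. r q) \<in> borel_measurable (PG d D)"
        by (auto intro: meas_coord)
    qed
  qed (use fin D in auto)
  also have "\<dots> = (\<integral>\<^sup>+x. ennreal (exp (s * (\<Sum>q\<in>B. (y x q)\<^sup>2))) \<partial>PG d (D - B))"
    unfolding inner ..
  also have "\<dots> \<le> (\<integral>\<^sup>+x. ennreal (\<Sum>q\<in>B. \<rho> q * exp (s * (y x q / sqrt (\<rho> q))\<^sup>2)) \<partial>PG d (D - B))"
    by (intro nn_integral_mono ennreal_leI conv)
  also have "\<dots> = (\<integral>\<^sup>+x. (\<Sum>q\<in>B. ennreal (\<rho> q) * ennreal (exp (s * (y x q / sqrt (\<rho> q))\<^sup>2))) \<partial>PG d (D - B))"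
    by (simp add: sum_ennreal[symmetric] \<rho>0 ennreal_mult' sum_nonneg)
  also have "\<dots> = (\<Sum>q\<in>B. ennreal (\<rho> q) * (\<integral>\<^sup>+x. ennreal (exp (s * (y x q / sqrt (\<rho> q))\<^sup>2)) \<partial>PG d (D - B)))"
    by (subst nn_integral_sum) (auto simp: nn_integral_cmult)
  also have "\<dots> \<le> (\<Sum>q\<in>B. ennreal (\<rho> q) * ennreal (exp (l\<^sup>2)))"
  proof (intro sum_mono mult_left_mono)
    fix q
    have "(\<integral>\<^sup>+x. ennreal (exp (s * (y x q / sqrt (\<rho> q))\<^sup>2)) \<partial>PG d (D - B)) \<le> ennreal (1 / sqrt (1 - 2 * s * 1))"
      using PG_exp_linear_square[OF d _ s(1) csq s(2), of q] D by (simp only: lin finite_Diff)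
    also have "\<dots> \<le> ennreal (exp (s + 4 * s\<^sup>2))"
      using inverse_sqrt_le_exp[OF s(3)] by (intro ennreal_leI) simp
    \<comment> \<open>From \<open>s <= 1/4\<close> follows \<open>4 s^2 <= s\<close>, so the
      exponent is at most \<open>2 s\<close>, which is \<open>l^2\<close>.\<close>
    also have "\<dots> \<le> ennreal (exp (l\<^sup>2))"
      using mult_right_mono[of s "1/4" s] s by (intro ennreal_leI) (simp add: s_def[symmetric] power2_eq_square, simp add: s_def power2_eq_square)
    finally show "(\<integral>\<^sup>+x. ennreal (exp (s * (y x q / sqrt (\<rho> q))\<^sup>2)) \<partial>PG d (D - B)) \<le> ennreal (exp (l\<^sup>2))" .
  qed simp
  also have "\<dots> = ennreal (exp (l\<^sup>2))"
    by (simp add: sum_distrib_right[symmetric] sum_ennreal \<rho>0 \<rho>1)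
  finally show ?thesis .
qed

lemma exp_le_1_plus: "exp (x::real) \<le> 1 + x * exp x"
  using exp_ge_add_one_self[of "- x"] by (simp add: exp_minus field_simps)

lemma ennreal_one_plus_mult:
  assumes "a \<ge> 0" "p \<ge> 0" "q \<ge> 0"
  shows "ennreal (1 + a * (p + q)) = 1 + ennreal a * (ennreal p + ennreal q)"
proof -
  have "ennreal (1 + a * (p + q)) = ennreal 1 + ennreal (a * (p + q))"
    using assms by (intro ennreal_plus) auto
  also have "ennreal (a * (p + q)) = ennreal a * ennreal (p + q)"
    using assms by (intro ennreal_mult) auto
  finally show ?thesis using assms by (simp only: ennreal_plus ennreal_1)
qed

text \<open>The truncation bounds one of the two factors \<open>|w|\<close> in the exponent
  \<open>X = L m w^2\<close> by \<open>R\<close>, so that \<open>X\<close> is at most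
  \<open>|g h| / 8\<close> and its exponential is integrable. The inequality
  \<open>exp X <= 1 + X exp X\<close> retains the prefactor \<open>X = L g^2 h^2 / m\<close>; hence
  the moment exceeds 1 only by order \<open>L / m\<close>, which is small enough to be multiplied
  over all rows.\<close>

lemma PG_exp_truncated_product:
  fixes c c' :: "'i \<Rightarrow> real"
  assumes d: "d > 0" and D: "finite D" and c: "(\<Sum>j\<in>D. (c j)\<^sup>2) \<le> 1" "(\<Sum>j\<in>D. (c' j)\<^sup>2) \<le> 1"
    and m: "m > 0" and L: "L \<ge> 0" and R: "8 * L * R \<le> 1"
  defines "w \<equiv> \<lambda>r. (\<Sum>j\<in>D. c j * (sqrt d * r j)) * (\<Sum>j\<in>D. c' j * (sqrt d * r j)) / m"
  shows "(\<integral>\<^sup>+r. ennreal (exp (L * m * (if \<bar>w r\<bar> \<le> R then (w r)\<^sup>2 else 0))) \<partial>PG d D) \<le> ennreal (exp (400 * L / m))" (is "?lhs \<le> _")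
proof -
  interpret prob_space "PG d D" by (rule prob_space_PG[OF d])
  define g where "g = (\<lambda>r. \<Sum>j\<in>D. c j * (sqrt d * r j))"
  define h where "h = (\<lambda>r. \<Sum>j\<in>D. c' j * (sqrt d * r j))"
  have w: "w r = g r * h r / m" for r by (simp add: w_def g_def h_def)
  have gh_meas: "g \<in> borel_measurable (PG d D)" "h \<in> borel_measurable (PG d D)"
    unfolding g_def h_def by measurable
  have Lm: "0 \<le> 128 * L / m" using L m by simp
  define Eg where "Eg = (\<lambda>r. ennreal (exp ((1/4) * (g r)\<^sup>2)))"
  define Eh where "Eh = (\<lambda>r. ennreal (exp ((1/4) * (h r)\<^sup>2)))"
  have Egh: "Eg \<in> borel_measurable (PG d D)" "Eh \<in> borel_measurable (PG d D)"
    unfolding Eg_def Eh_def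
    by (intro meas_exp gh_meas borel_arith)+
  have sq16: "x\<^sup>2 \<le> 16 * exp (x\<^sup>2 / 16)" for x :: real
  proof -
    have "x\<^sup>2 / 16 \<le> exp (x\<^sup>2 / 16)"
      by (rule order_trans[OF _ exp_ge_add_one_self]) simp
    from mult_left_mono[OF this, of 16] show ?thesis by simp
  qed
  have pt: "exp (L * m * (if \<bar>w r\<bar> \<le> R then (w r)\<^sup>2 else 0))
     \<le> 1 + 128 * L / m * (exp ((1/4) * (g r)\<^sup>2) + exp ((1/4) * (h r)\<^sup>2))" for r
  proof (cases "\<bar>w r\<bar> \<le> R")
    case False
    have "0 \<le> 128 * L / m * (exp ((1/4) * (g r)\<^sup>2) + exp ((1/4) * (h r)\<^sup>2))"
      using L m by (intro mult_nonneg_nonneg divide_nonneg_pos add_nonneg_nonneg exp_ge_zero) auto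
    then show ?thesis using False by (simp only: if_False mult_zero_right exp_zero)
  next
    case True
    define X where "X = L * m * (w r)\<^sup>2"
    define u where "u = (g r)\<^sup>2" define v where "v = (h r)\<^sup>2"
    have gh: "\<bar>g r * h r\<bar> \<le> (u + v) / 2"
      using sum_squares_bound[of "\<bar>g r\<bar>" "\<bar>h r\<bar>"] by (simp add: u_def v_def abs_mult)
    have "X = L * \<bar>w r\<bar> * \<bar>g r * h r\<bar>"
      using m by (simp add: X_def w power2_eq_square abs_mult field_simps)
    also have "\<dots> \<le> L * R * \<bar>g r * h r\<bar>"
      using True L by (intro mult_right_mono mult_left_mono) auto
    also have "\<dots> \<le> 1/8 * \<bar>g r * h r\<bar>" using R by (intro mult_right_mono) auto
    also have "\<dots> \<le> (u + v) / 16" using gh by simp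
    finally have X: "X \<le> (u + v) / 16" .
    have X0: "X \<ge> 0" using L m by (simp add: X_def)
    have "exp X \<le> 1 + X * exp X" by (rule exp_le_1_plus)
    also have "X * exp X \<le> X * exp ((u + v) / 16)" using X X0 by (intro mult_left_mono) auto
    also have "X * exp ((u + v) / 16) = L / m * (u * v) * exp ((u + v) / 16)"
      using m by (simp add: X_def w u_def v_def power2_eq_square field_simps)
    also have "\<dots> \<le> L / m * ((16 * exp (u / 16)) * (16 * exp (v / 16))) * exp ((u + v) / 16)"
      unfolding u_def v_def using L m by (intro mult_right_mono mult_left_mono mult_mono sq16) auto
    also have "\<dots> = 128 * L / m * (2 * (exp (u / 8) * exp (v / 8)))"
      by (simp add: exp_add[symmetric] field_simps)
    \<comment> \<open>AM-GM separates the two linear forms, so that only moments of one form at a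
      time remain.\<close>
    also have "\<dots> \<le> 128 * L / m * ((exp (u / 8))\<^sup>2 + (exp (v / 8))\<^sup>2)"
      using L m sum_squares_bound[of "exp (u/8)" "exp (v/8)"] by (intro mult_left_mono) auto
    also have "(exp (u / 8))\<^sup>2 = exp ((1/4) * u)" by (simp add: power2_eq_square exp_add[symmetric])
    also have "(exp (v / 8))\<^sup>2 = exp ((1/4) * v)" by (simp add: power2_eq_square exp_add[symmetric])
    finally show ?thesis using True by (simp add: X_def u_def v_def)
  qed
  have sq: "(\<integral>\<^sup>+r. ennreal (exp ((1/4) * (f r)\<^sup>2)) \<partial>PG d D) \<le> ennreal (3 / 2)"
    if f: "f = (\<lambda>r. \<Sum>j\<in>D. e j * (sqrt d * r j))" and e: "(\<Sum>j\<in>D. (e j)\<^sup>2) \<le> 1" for f e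
  proof -
    have "(\<integral>\<^sup>+r. ennreal (exp ((1/4) * (f r)\<^sup>2)) \<partial>PG d D) \<le> ennreal (1 / sqrt (1 - 2 * (1/4) * 1))"
      unfolding f by (rule PG_exp_linear_square[OF d D _ e]) auto
    also have "1 / sqrt (1 - 2 * (1/4) * 1) = sqrt (2::real)" by (simp add: real_sqrt_divide)
    also have "\<dots> \<le> 3 / 2" by (rule real_le_lsqrt) (auto simp: power2_eq_square)
    finally show ?thesis by (simp add: ennreal_leI)
  qed
  have "?lhs
     \<le> (\<integral>\<^sup>+r. 1 + ennreal (128 * L / m) * (ennreal (exp ((1/4) * (g r)\<^sup>2)) + ennreal (exp ((1/4) * (h r)\<^sup>2))) \<partial>PG d D)"
  proof (rule nn_integral_mono)
    fix r
    have "ennreal (exp (L * m * (if \<bar>w r\<bar> \<le> R then (w r)\<^sup>2 else 0)))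
      \<le> ennreal (1 + 128 * L / m * (exp ((1/4) * (g r)\<^sup>2) + exp ((1/4) * (h r)\<^sup>2)))"
      by (rule ennreal_leI, rule pt)
    also have "\<dots> = 1 + ennreal (128 * L / m) * (ennreal (exp ((1/4) * (g r)\<^sup>2)) + ennreal (exp ((1/4) * (h r)\<^sup>2)))"
      by (rule ennreal_one_plus_mult[OF Lm exp_ge_zero exp_ge_zero])
    finally show "ennreal (exp (L * m * (if \<bar>w r\<bar> \<le> R then (w r)\<^sup>2 else 0)))
      \<le> 1 + ennreal (128 * L / m) * (ennreal (exp ((1/4) * (g r)\<^sup>2)) + ennreal (exp ((1/4) * (h r)\<^sup>2)))" .
  qed
  also have "\<dots> = (\<integral>\<^sup>+r. 1 + ennreal (128 * L / m) * (Eg r + Eh r) \<partial>PG d D)"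
    unfolding Eg_def Eh_def ..
  also have "\<dots> = (\<integral>\<^sup>+r. 1 \<partial>PG d D) + (\<integral>\<^sup>+r. ennreal (128 * L / m) * (Eg r + Eh r) \<partial>PG d D)"
    by (intro nn_integral_add borel_measurable_times_ennreal Egh borel_arith)
  also have "\<dots> = 1 + ennreal (128 * L / m) * (\<integral>\<^sup>+r. Eg r + Eh r \<partial>PG d D)"
    by (subst nn_integral_cmult, intro borel_measurable_add Egh, simp add: emeasure_space_1)
  also have "(\<integral>\<^sup>+r. Eg r + Eh r \<partial>PG d D) = (\<integral>\<^sup>+r. Eg r \<partial>PG d D) + (\<integral>\<^sup>+r. Eh r \<partial>PG d D)"
    by (intro nn_integral_add Egh)
  also have "1 + ennreal (128 * L / m) * ((\<integral>\<^sup>+r. Eg r \<partial>PG d D) + (\<integral>\<^sup>+r. Eh r \<partial>PG d D))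
      \<le> 1 + ennreal (128 * L / m) * (ennreal (3/2) + ennreal (3/2))"
    unfolding Eg_def Eh_def
    by (rule add_left_mono[OF mult_left_mono[OF add_mono[OF sq[OF g_def c(1)] sq[OF h_def c(2)]]]]) simp
  \<comment> \<open>Each of the two moments is at most 3/2, and \<open>128 * 3 = 384\<close>; it is
    rounded up to 400 below.\<close>
  also have "\<dots> = ennreal (1 + 384 * L / m)"
    using L m by (subst ennreal_one_plus_mult[symmetric]) auto
  also have "\<dots> \<le> ennreal (exp (400 * L / m))"
  proof (rule ennreal_leI)
    have "1 + 384 * L / m \<le> 1 + 400 * L / m" using L m by (intro add_left_mono divide_right_mono) auto
    also have "\<dots> \<le> exp (400 * L / m)" by (rule exp_ge_add_one_self)
    finally show "1 + 384 * L / m \<le> exp (400 * L / m)" .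
  qed
  finally show ?thesis .
qed

section \<open>Bilinear forms, nets and decoupling\<close>

definition bil :: "nat \<Rightarrow> (nat \<Rightarrow> nat \<Rightarrow> real) \<Rightarrow> (nat \<Rightarrow> real) \<Rightarrow> (nat \<Rightarrow> real) \<Rightarrow> real" where
  "bil n W x y = (\<Sum>i<n. \<Sum>j<n. x i * W i j * y j)"

definition sqn :: "nat \<Rightarrow> (nat \<Rightarrow> real) \<Rightarrow> real" where
  "sqn n x = (\<Sum>i<n. (x i)\<^sup>2)"

lemma sqn_nonneg [simp]: "0 \<le> sqn n x"
  by (simp add: sqn_def sum_nonneg)

lemma sqn_scale: "sqn n (\<lambda>i. c * x i) = c\<^sup>2 * sqn n x"
  by (simp add: sqn_def power_mult_distrib sum_distrib_left)

lemma sqn_eq_0_iff: "sqn n x = 0 \<longleftrightarrow> (\<forall>i<n. x i = 0)"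
  by (simp add: sqn_def sum_nonneg_eq_0_iff Ball_def)

lemma sqn_mono: "(\<And>i. i < n \<Longrightarrow> (x i)\<^sup>2 \<le> (y i)\<^sup>2) \<Longrightarrow> sqn n x \<le> sqn n y"
  unfolding sqn_def by (rule sum_mono) simp

lemma sqn_parallelogram:
  "sqn n (\<lambda>i. x i + y i) + sqn n (\<lambda>i. x i - y i) = 2 * sqn n x + 2 * sqn n y"
  by (simp add: sqn_def power2_sum power2_diff sum.distrib sum_subtractf sum_distrib_left)

lemma component_le_sqn: "i < n \<Longrightarrow> (x i)\<^sup>2 \<le> sqn n x"
  unfolding sqn_def by (rule member_le_sum) auto

lemma bil_cong:
  "(\<And>i. i < n \<Longrightarrow> x i = x' i) \<Longrightarrow> (\<And>i. i < n \<Longrightarrow> y i = y' i) \<Longrightarrow> bil n W x y = bil n W x' y'"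
  unfolding bil_def by (intro sum.cong) auto

lemma bil_add_left: "bil n W (\<lambda>i. x i + x' i) y = bil n W x y + bil n W x' y"
  by (simp add: bil_def algebra_simps sum.distrib)

lemma bil_add_right: "bil n W x (\<lambda>i. y i + y' i) = bil n W x y + bil n W x y'"
  by (simp add: bil_def algebra_simps sum.distrib)

lemma bil_diff_left: "bil n W (\<lambda>i. x i - x' i) y = bil n W x y - bil n W x' y"
  by (simp add: bil_def algebra_simps sum_subtractf)

lemma bil_diff_right: "bil n W x (\<lambda>i. y i - y' i) = bil n W x y - bil n W x y'"
  by (simp add: bil_def algebra_simps sum_subtractf)

lemma bil_scale: "bil n W (\<lambda>i. c * x i) (\<lambda>i. e * y i) = c * e * bil n W x y"
  by (simp add: bil_def sum_distrib_left mult_ac)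

lemma bil_sym:
  assumes "\<And>i j. i < n \<Longrightarrow> j < n \<Longrightarrow> W i j = W j i"
  shows "bil n W x y = bil n W y x"
  unfolding bil_def by (subst sum.swap) (intro sum.cong refl, simp add: assms mult_ac)

lemma bil_zero_left: "(\<And>i. i < n \<Longrightarrow> x i = 0) \<Longrightarrow> bil n W x y = 0"
  by (simp add: bil_def)

lemma bil_zero_right: "(\<And>i. i < n \<Longrightarrow> y i = 0) \<Longrightarrow> bil n W x y = 0"
  by (simp add: bil_def)

text \<open>Polarization gives the mean of the two squared norms; normalizing both vectors turns it
  into the product of the norms.\<close>

lemma bil_le_of_quad:
  assumes sym: "\<And>i j. i < n \<Longrightarrow> j < n \<Longrightarrow> W i j = W j i"
    and quad: "\<And>x. \<bar>bil n W x x\<bar> \<le> \<omega> * sqn n x"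
  shows "\<bar>bil n W x y\<bar> \<le> \<omega> * sqrt (sqn n x) * sqrt (sqn n y)"
proof -
  have main: "\<bar>bil n W x y\<bar> \<le> \<omega> / 2 * (sqn n x + sqn n y)" for x y
  proof -
    have "4 * bil n W x y = bil n W (\<lambda>i. x i + y i) (\<lambda>i. x i + y i) - bil n W (\<lambda>i. x i - y i) (\<lambda>i. x i - y i)"
      unfolding bil_add_left bil_add_right bil_diff_left bil_diff_right
      using bil_sym[OF sym, where x = x and y = y] by simp
    also have "\<bar>\<dots>\<bar> \<le> \<omega> * sqn n (\<lambda>i. x i + y i) + \<omega> * sqn n (\<lambda>i. x i - y i)"
      using quad[of "\<lambda>i. x i + y i"] quad[of "\<lambda>i. x i - y i"] by linarith
    also have "\<dots> = \<omega> * (2 * sqn n x + 2 * sqn n y)"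
      unfolding distrib_left[symmetric] sqn_parallelogram ..
    finally show ?thesis by (simp add: algebra_simps)
  qed
  show ?thesis
  proof (cases "sqn n x = 0 \<or> sqn n y = 0")
    case True
    then have "bil n W x y = 0"
      by (auto simp: sqn_eq_0_iff intro: bil_zero_left bil_zero_right)
    then show ?thesis using True by auto
  next
    case False
    define a where "a = sqrt (sqn n x)"
    define b where "b = sqrt (sqn n y)"
    have a: "a > 0" "sqn n x = a\<^sup>2" and b: "b > 0" "sqn n y = b\<^sup>2"
      using False by (auto simp: a_def b_def less_le)
    have "\<bar>bil n W (\<lambda>i. 1 / a * x i) (\<lambda>i. 1 / b * y i)\<bar> \<le> \<omega> / 2 * (1 + 1)"
      using main[of "\<lambda>i. 1 / a * x i" "\<lambda>i. 1 / b * y i"] a b by (simp only: sqn_scale) (simp add: power_divide)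
    then have "\<bar>bil n W x y\<bar> / (a * b) \<le> \<omega>"
      unfolding bil_scale using a b by (simp add: abs_mult)
    then show ?thesis using a b by (simp add: field_simps a_def[symmetric] b_def[symmetric])
  qed
qed

text \<open>By symmetry, \<open>B(x, x) - B(z, z) = B(x - z, x + z)\<close>. With
  \<open>|x - z| <= 1/4\<close> and \<open>|x + z| <= 2\<close> the error is at most half the norm,
  so the norm is at most twice the maximum over the net.\<close>

lemma net_norm:
  assumes sym: "\<And>i j. i < n \<Longrightarrow> j < n \<Longrightarrow> W i j = W j i"
    and fin: "finite Z"
    and net: "\<And>x. sqn n x \<le> 1 \<Longrightarrow> \<exists>z\<in>Z. sqn n z \<le> 1 \<and> sqn n (\<lambda>i. x i - z i) \<le> 1 / 16"
  shows "\<exists>\<omega>\<ge>0. (\<forall>x. \<bar>bil n W x x\<bar> \<le> \<omega> * sqn n x) \<and>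
    (\<exists>z\<in>Z. sqn n z \<le> 1 \<and> \<omega> \<le> 2 * \<bar>bil n W z z\<bar>)"
proof -
  define S where "S = {\<bar>bil n W x x\<bar> | x. sqn n x \<le> 1}"
  define \<omega> where "\<omega> = Sup S"
  have zero: "sqn n (\<lambda>_. 0) \<le> 1" by (simp add: sqn_def)
  have ne: "S \<noteq> {}" using zero by (auto simp: S_def)
  \<comment> \<open>The supremum must be known to be finite before half of it can be absorbed on the
    left; a crude entrywise bound suffices.\<close>
  have bdd: "bdd_above S"
  proof (rule bdd_aboveI)
    fix s assume "s \<in> S"
    then obtain x where x: "s = \<bar>bil n W x x\<bar>" "sqn n x \<le> 1" by (auto simp: S_def)
    have x1: "\<bar>x i\<bar> \<le> 1" if "i < n" for i
      using component_le_sqn[OF that, of x] x(2) by (simp add: abs_square_le_1[symmetric])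
    have "s \<le> (\<Sum>i<n. \<Sum>j<n. \<bar>x i * W i j * x j\<bar>)"
      unfolding x bil_def by (rule order_trans[OF sum_abs sum_mono[OF sum_abs]])
    also have "\<dots> \<le> (\<Sum>i<n. \<Sum>j<n. \<bar>W i j\<bar>)"
    proof (intro sum_mono)
      fix i j assume "i \<in> {..<n}" "j \<in> {..<n}"
      then have "\<bar>x i\<bar> * \<bar>W i j\<bar> * \<bar>x j\<bar> \<le> 1 * \<bar>W i j\<bar> * 1"
        by (intro mult_mono x1) auto
      then show "\<bar>x i * W i j * x j\<bar> \<le> \<bar>W i j\<bar>" by (simp add: abs_mult)
    qed
    finally show "s \<le> (\<Sum>i<n. \<Sum>j<n. \<bar>W i j\<bar>)" .
  qed
  have up: "\<bar>bil n W x x\<bar> \<le> \<omega>" if "sqn n x \<le> 1" for x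
    unfolding \<omega>_def by (rule cSup_upper[OF _ bdd]) (use that in \<open>auto simp: S_def\<close>)
  have \<omega>0: "\<omega> \<ge> 0" using up[OF zero] by (meson abs_ge_zero order_trans)
  have quad: "\<bar>bil n W x x\<bar> \<le> \<omega> * sqn n x" for x
  proof (cases "sqn n x = 0")
    case True
    then have "bil n W x x = 0" by (auto simp: sqn_eq_0_iff intro: bil_zero_left)
    then show ?thesis using True by simp
  next
    case False
    define a where "a = sqrt (sqn n x)"
    have a: "a > 0" "sqn n x = a\<^sup>2" using False by (auto simp: a_def less_le)
    have "\<bar>bil n W (\<lambda>i. 1 / a * x i) (\<lambda>i. 1 / a * x i)\<bar> \<le> \<omega>"
      by (rule up) (use a in \<open>simp only: sqn_scale\<close>, simp add: power_divide)
    then show ?thesis using a unfolding bil_scale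
      by (simp add: abs_mult field_simps power2_eq_square)
  qed
  define Z' where "Z' = {z\<in>Z. sqn n z \<le> 1}"
  define m where "m = Max ((\<lambda>z. \<bar>bil n W z z\<bar>) ` Z')"
  have Z': "finite Z'" "Z' \<noteq> {}" using fin net[OF zero] by (auto simp: Z'_def)
  have le: "s \<le> m + \<omega> / 2" if "s \<in> S" for s
  proof -
    obtain x where x: "s = \<bar>bil n W x x\<bar>" "sqn n x \<le> 1" using \<open>s \<in> S\<close> by (auto simp: S_def)
    obtain z where z: "z \<in> Z" "sqn n z \<le> 1" "sqn n (\<lambda>i. x i - z i) \<le> 1 / 16" using net[OF x(2)] by blast
    have "sqn n (\<lambda>i. x i + z i) \<le> 4"
      using sqn_parallelogram[of n x z] x(2) z(2) sqn_nonneg[of n "\<lambda>i. x i - z i"] by linarith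
    then have s2: "sqrt (sqn n (\<lambda>i. x i + z i)) \<le> 2" by (simp add: real_le_lsqrt)
    have s1: "sqrt (sqn n (\<lambda>i. x i - z i)) \<le> 1 / 4" using z(3) by (intro real_le_lsqrt) (auto simp: power2_eq_square)
    have "bil n W x x = bil n W z z + bil n W (\<lambda>i. x i - z i) (\<lambda>i. x i + z i)"
      unfolding bil_add_right bil_diff_left using bil_sym[OF sym, where x = x and y = z] by simp
    moreover have "\<bar>bil n W z z\<bar> \<le> m"
      unfolding m_def using Z' z by (intro Max_ge) (auto simp: Z'_def)
    moreover have "\<bar>bil n W (\<lambda>i. x i - z i) (\<lambda>i. x i + z i)\<bar> \<le> \<omega> * sqrt (sqn n (\<lambda>i. x i - z i)) * sqrt (sqn n (\<lambda>i. x i + z i))"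
      by (rule bil_le_of_quad[OF sym quad])
    moreover have "\<omega> * sqrt (sqn n (\<lambda>i. x i - z i)) * sqrt (sqn n (\<lambda>i. x i + z i)) \<le> \<omega> * (1/4) * 2"
      using s1 s2 \<omega>0 by (intro mult_mono) auto
    ultimately show ?thesis using x by linarith
  qed
  have "\<omega> \<le> m + \<omega> / 2" unfolding \<omega>_def by (rule cSup_least[OF ne]) (use le \<omega>_def in auto)
  then have "\<omega> \<le> 2 * m" by simp
  moreover have "m \<in> (\<lambda>z. \<bar>bil n W z z\<bar>) ` Z'" unfolding m_def using Z' by (intro Max_in) auto
  ultimately have "\<exists>z\<in>Z. sqn n z \<le> 1 \<and> \<omega> \<le> 2 * \<bar>bil n W z z\<bar>" by (auto simp: Z'_def)
  with \<omega>0 quad show ?thesis by blast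
qed

section \<open>Decoupling and telescoping\<close>

lemma card_Pow_separating:
  assumes A: "finite A" and ij: "i \<in> A" "j \<in> A" "i \<noteq> j"
  shows "4 * card {I \<in> Pow A. i \<in> I \<and> j \<notin> I} = 2 ^ card A"
proof -
  have "{I \<in> Pow A. i \<in> I \<and> j \<notin> I} = insert i ` Pow (A - {i, j})"
  proof (intro equalityI subsetI)
    fix I assume I: "I \<in> {I \<in> Pow A. i \<in> I \<and> j \<notin> I}"
    then have "I = insert i (I - {i})" "I - {i} \<in> Pow (A - {i, j})" by auto
    then show "I \<in> insert i ` Pow (A - {i, j})" by blast
  qed (use ij in auto)
  moreover have "inj_on (insert i) (Pow (A - {i, j}))"
    by (rule inj_onI) (auto dest: equalityD1 equalityD2)
  moreover have "card A = Suc (Suc (card (A - {i, j})))"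
    using A ij by (metis Diff_insert2 Diff_iff card.remove finite_Diff insert_Diff_single insertE singletonD)
  ultimately show ?thesis using A by (simp add: card_image card_Pow)
qed

text \<open>A uniformly random subset \<open>I\<close> separates any two distinct points with probability \<open>1/4\<close>
  in each order.\<close>

lemma decoupling:
  fixes c :: "'a \<Rightarrow> 'a \<Rightarrow> real"
  assumes A: "finite A"
  shows "\<exists>I\<subseteq>A. \<bar>\<Sum>i\<in>A. \<Sum>j\<in>A - {i}. c i j\<bar> \<le> 4 * \<bar>\<Sum>i\<in>I. \<Sum>j\<in>A - I. c i j\<bar>"
proof (rule ccontr)
  define f where "f = (\<lambda>I. \<Sum>i\<in>I. \<Sum>j\<in>A - I. c i j)"
  define T where "T = (\<Sum>i\<in>A. \<Sum>j\<in>A - {i}. c i j)"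
  assume "\<not> ?thesis"
  then have "\<not> (\<exists>I\<subseteq>A. \<bar>T\<bar> \<le> 4 * \<bar>f I\<bar>)" unfolding f_def T_def .
  then have less: "4 * \<bar>f I\<bar> < \<bar>T\<bar>" if "I \<in> Pow A" for I
    using that by (meson PowD not_le)
  have f: "f I = (\<Sum>i\<in>A. \<Sum>j\<in>A - {i}. if i \<in> I \<and> j \<notin> I then c i j else 0)" if "I \<in> Pow A" for I
  proof -
    have "f I = (\<Sum>i\<in>I. \<Sum>j\<in>A - {i}. if i \<in> I \<and> j \<notin> I then c i j else 0)"
      unfolding f_def using A by (intro sum.cong refl sum.mono_neutral_cong_left) auto
    also have "\<dots> = (\<Sum>i\<in>A. \<Sum>j\<in>A - {i}. if i \<in> I \<and> j \<notin> I then c i j else 0)"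
      using that A by (intro sum.mono_neutral_left) auto
    finally show ?thesis .
  qed
  \<comment> \<open>Averaging argument: over all subsets the values \<open>4 * f I\<close> have mean
    \<open>T\<close>, so they cannot all be smaller than \<open>T\<close> in absolute value.\<close>
  have "(\<Sum>I\<in>Pow A. 4 * f I) = (\<Sum>I\<in>Pow A. \<Sum>i\<in>A. \<Sum>j\<in>A - {i}. 4 * (if i \<in> I \<and> j \<notin> I then c i j else 0))"
    by (intro sum.cong refl) (simp only: f sum_distrib_left)
  also have "\<dots> = (\<Sum>i\<in>A. \<Sum>I\<in>Pow A. \<Sum>j\<in>A - {i}. 4 * (if i \<in> I \<and> j \<notin> I then c i j else 0))"
    by (rule sum.swap)
  also have "\<dots> = (\<Sum>i\<in>A. \<Sum>j\<in>A - {i}. \<Sum>I\<in>Pow A. 4 * (if i \<in> I \<and> j \<notin> I then c i j else 0))"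
    by (intro sum.cong[OF refl] sum.swap)
  also have "\<dots> = (\<Sum>i\<in>A. \<Sum>j\<in>A - {i}. 2 ^ card A * c i j)"
  proof (intro sum.cong refl)
    fix i j assume ij: "i \<in> A" "j \<in> A - {i}"
    have "(\<Sum>I\<in>Pow A. 4 * (if i \<in> I \<and> j \<notin> I then c i j else 0)) = (\<Sum>I\<in>{I \<in> Pow A. i \<in> I \<and> j \<notin> I}. 4 * c i j)"
      using A by (intro sum.mono_neutral_cong_right) auto
    also have "\<dots> = real (4 * card {I \<in> Pow A. i \<in> I \<and> j \<notin> I}) * c i j" by simp
    also have "\<dots> = 2 ^ card A * c i j" using ij A by (subst card_Pow_separating) auto
    finally show "(\<Sum>I\<in>Pow A. 4 * (if i \<in> I \<and> j \<notin> I then c i j else 0)) = 2 ^ card A * c i j" .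
  qed
  also have "\<dots> = 2 ^ card A * T" by (simp add: T_def sum_distrib_left)
  finally have "2 ^ card A * \<bar>T\<bar> = \<bar>\<Sum>I\<in>Pow A. 4 * f I\<bar>" by (simp add: abs_mult)
  also have "\<dots> \<le> (\<Sum>I\<in>Pow A. 4 * \<bar>f I\<bar>)"
    by (rule order_trans[OF sum_abs]) (simp add: abs_mult)
  also have "\<dots> < (\<Sum>I\<in>Pow A. \<bar>T\<bar>)"
    using A less by (intro sum_strict_mono) auto
  also have "\<dots> = 2 ^ card A * \<bar>T\<bar>" using A by (simp add: card_Pow)
  finally show False by simp
qed

definition cutoff :: "nat set \<Rightarrow> (nat \<Rightarrow> 'a) \<Rightarrow> nat \<Rightarrow> 'a::zero" where
  "cutoff S x i = (if i \<in> S then x i else 0)"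

text \<open>Going from one index set to the next changes one argument at a time. For increasing sets
  the difference vector in each increment lives on the newly added coordinates only.\<close>

lemma bil_telescope:
  "\<bar>bil n M (cutoff (S (Suc L)) x) (cutoff (S (Suc L)) y)\<bar>
    \<le> \<bar>bil n M (cutoff (S 0) x) (cutoff (S 0) y)\<bar> +
      (\<Sum>l\<le>L. \<bar>bil n M (cutoff (S (Suc l)) x) (\<lambda>i. cutoff (S (Suc l)) y i - cutoff (S l) y i)\<bar> +
              \<bar>bil n M (\<lambda>i. cutoff (S (Suc l)) x i - cutoff (S l) x i) (cutoff (S l) y)\<bar>)"
proof (induction L)
  case 0
  show ?case by (simp add: bil_diff_left bil_diff_right)
next
  case (Suc L)
  then show ?case by (simp add: bil_diff_left bil_diff_right)
qed

section \<open>Inversion of a matrix close to the identity\<close>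

fun neumann :: "nat \<Rightarrow> (nat \<Rightarrow> nat \<Rightarrow> real) \<Rightarrow> (nat \<Rightarrow> real) \<Rightarrow> nat \<Rightarrow> nat \<Rightarrow> real" where
  "neumann n M t 0 i = 0"
| "neumann n M t (Suc N) i = t i + neumann n M t N i - (\<Sum>j<n. M i j * neumann n M t N j)"

text \<open>The inverse is encoded as a limit of explicit iterates: this is total, and its
  measurability in the sample follows from that of the iterates, which are polynomials in
  \<open>M\<close> and \<open>t\<close>.\<close>

definition solve :: "nat \<Rightarrow> (nat \<Rightarrow> nat \<Rightarrow> real) \<Rightarrow> (nat \<Rightarrow> real) \<Rightarrow> nat \<Rightarrow> real" where
  "solve n M t i = lim (\<lambda>N. neumann n M t N i)"

text \<open>The form is tested against its own image \<open>y = E x\<close>, and one factor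
  \<open>|y|\<close> is cancelled.\<close>

lemma sqn_le_of_bil:
  assumes E: "\<And>x y. \<bar>bil n E x y\<bar> \<le> c * sqrt (sqn n x) * sqrt (sqn n y)"
  shows "sqrt (sqn n (\<lambda>i. \<Sum>j<n. E i j * x j)) \<le> c * sqrt (sqn n x)"
proof -
  define y where "y = (\<lambda>i. \<Sum>j<n. E i j * x j)"
  have "bil n E y x = sqn n y"
    by (simp add: bil_def sqn_def y_def power2_eq_square sum_distrib_left mult_ac)
  then have le: "sqn n y \<le> c * sqrt (sqn n y) * sqrt (sqn n x)" using E[of y x] by simp
  show ?thesis
  proof (cases "sqn n y = 0")
    case True
    have "0 \<le> c * sqrt (sqn n x)"
    proof (cases "sqn n x = 0")
      case False
      have "0 \<le> c * sqrt (sqn n x) * sqrt (sqn n x)" using E[of x x] by linarith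
      moreover have "sqrt (sqn n x) > 0" using False by (simp add: less_le)
      ultimately show ?thesis by (meson linorder_not_le mult_neg_pos)
    qed simp
    then show ?thesis using True by (simp add: y_def)
  next
    case False
    then have "sqrt (sqn n y) > 0" by (simp add: less_le)
    moreover have "sqrt (sqn n y) * sqrt (sqn n y) \<le> sqrt (sqn n y) * (c * sqrt (sqn n x))"
      using le by (simp add: mult_ac)
    ultimately show ?thesis unfolding y_def[symmetric] by (meson mult_left_le_imp_le)
  qed
qed

lemma solve_correct:
  assumes E: "\<And>x y. \<bar>bil n (\<lambda>i j. (if i = j then 1 else 0) - M i j) x y\<bar> \<le> 1 / 2 * sqrt (sqn n x) * sqrt (sqn n y)"
  shows "i < n \<Longrightarrow> (\<Sum>j<n. M i j * solve n M t j) = t i"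
    and "sqn n (solve n M t) \<le> 4 * sqn n t"
proof -
  let ?E = "\<lambda>i j. (if i = j then 1 else 0) - M i j"
  let ?v = "neumann n M t"
  have E_sum: "(\<Sum>j<n. ?E i j * x j) = x i - (\<Sum>j<n. M i j * x j)" if "i < n" for i x
    using that by (simp add: left_diff_distrib sum_subtractf if_distrib[of "\<lambda>a. a * _"] sum.delta cong: if_cong)
  \<comment> \<open>The recursion iterates the map \<open>v -> t + (I - M) v\<close>, a contraction
    with factor 1/2.\<close>
  have step: "?v (Suc N) i = t i + (\<Sum>j<n. ?E i j * ?v N j)" if "i < n" for N i
    using E_sum[OF that, of "?v N"] by simp
  define D where "D = (\<lambda>N i. ?v (Suc N) i - ?v N i)"
  have D_Suc: "D (Suc N) i = (\<Sum>j<n. ?E i j * D N j)" if "i < n" for N i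
    unfolding D_def step[OF that, of "Suc N"] step[OF that, of N]
    by (simp only: right_diff_distrib sum_subtractf)
  have D_norm: "sqrt (sqn n (D N)) \<le> (1 / 2) ^ N * sqrt (sqn n t)" for N
  proof (induction N)
    case 0
    have "sqn n (D 0) = sqn n t" by (simp add: D_def sqn_def)
    then show ?case by simp
  next
    case (Suc N)
    have "sqn n (D (Suc N)) = sqn n (\<lambda>i. \<Sum>j<n. ?E i j * D N j)"
      unfolding sqn_def by (intro sum.cong refl) (simp only: D_Suc lessThan_iff)
    then have "sqrt (sqn n (D (Suc N))) \<le> 1 / 2 * sqrt (sqn n (D N))"
      using sqn_le_of_bil[OF E, of "D N"] by simp
    then show ?case using Suc by simp
  qed
  have conv: "(\<lambda>N. ?v N i) \<longlonglongrightarrow> solve n M t i" if "i < n" for i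
  proof -
    have le: "norm (D N i) \<le> sqrt (sqn n t) * (1 / 2) ^ N" for N
    proof -
      have "\<bar>D N i\<bar> = sqrt ((D N i)\<^sup>2)" by simp
      also have "\<dots> \<le> sqrt (sqn n (D N))" by (rule real_sqrt_le_mono[OF component_le_sqn[OF that]])
      finally show ?thesis using D_norm[of N] by (simp add: mult.commute)
    qed
    have "summable (\<lambda>N. sqrt (sqn n t) * (1 / 2) ^ N)"
      by (intro summable_mult summable_geometric) simp
    then have "summable (\<lambda>N. D N i)"
      by (rule summable_comparison_test') (rule le)
    then have "convergent (\<lambda>N. \<Sum>k<N. D k i)" by (simp add: summable_iff_convergent)
    moreover have "(\<Sum>k<N. D k i) = ?v N i" for N
      unfolding D_def by (subst sum_lessThan_telescope) simp
    ultimately show ?thesis by (simp add: solve_def convergent_LIMSEQ_iff)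
  qed
  have fix_eq: "solve n M t i = t i + solve n M t i - (\<Sum>j<n. M i j * solve n M t j)" if "i < n" for i
  proof -
    have "(\<lambda>N. ?v (Suc N) i) \<longlonglongrightarrow> t i + solve n M t i - (\<Sum>j<n. M i j * solve n M t j)"
      unfolding neumann.simps by (intro tendsto_intros conv that) auto
    then show ?thesis using LIMSEQ_unique LIMSEQ_Suc[OF conv[OF that]] by blast
  qed
  then show "i < n \<Longrightarrow> (\<Sum>j<n. M i j * solve n M t j) = t i" by simp
  \<comment> \<open>The constant 2 is the fixed point of \<open>b -> 1 + b / 2\<close>.\<close>
  have bound: "sqrt (sqn n (?v N)) \<le> 2 * sqrt (sqn n t)" for N
  proof (induction N)
    case (Suc N)
    have "sqrt (sqn n (?v (Suc N))) = sqrt (sqn n (\<lambda>i. t i + (\<Sum>j<n. ?E i j * ?v N j)))"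
      unfolding sqn_def by (intro arg_cong[where f = sqrt] sum.cong refl) (simp only: step lessThan_iff)
    also have "\<dots> = L2_set (\<lambda>i. t i + (\<Sum>j<n. ?E i j * ?v N j)) {..<n}" by (simp add: sqn_def L2_set_def)
    also have "\<dots> \<le> L2_set t {..<n} + L2_set (\<lambda>i. \<Sum>j<n. ?E i j * ?v N j) {..<n}" by (rule L2_set_triangle_ineq)
    also have "\<dots> \<le> sqrt (sqn n t) + 1 / 2 * sqrt (sqn n (?v N))"
      using sqn_le_of_bil[OF E, of "?v N"] by (simp add: sqn_def L2_set_def)
    also have "\<dots> \<le> 2 * sqrt (sqn n t)" using Suc by simp
    finally show ?case .
  qed (simp add: sqn_def sum_nonneg)
  have "sqn n (?v N) \<le> 4 * sqn n t" for N
  proof -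
    have "(sqrt (sqn n (?v N)))\<^sup>2 \<le> (2 * sqrt (sqn n t))\<^sup>2" by (intro power_mono bound) simp
    then show ?thesis by (simp add: power_mult_distrib)
  qed
  moreover have "(\<lambda>N. sqn n (?v N)) \<longlonglongrightarrow> sqn n (solve n M t)"
    unfolding sqn_def by (intro tendsto_intros conv) auto
  ultimately show "sqn n (solve n M t) \<le> 4 * sqn n t"
    by (intro LIMSEQ_le_const2) auto
qed

section \<open>Lattice nets\<close>

text \<open>The integer points that \<open>lvec N\<close>, with mesh
  \<open>1 / (4 * sqrt N)\<close>, maps into the unit ball. Net points are kept as integer vectors
  since their supports and number are then easy to control; extensionality makes the set
  finite.\<close>

definition lball :: "nat \<Rightarrow> real \<Rightarrow> (nat \<Rightarrow> int) set" where
  "lball n N = {\<zeta> \<in> extensional {..<n}. (\<Sum>i<n. (real_of_int (\<zeta> i))\<^sup>2) \<le> 16 * N}"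

definition lvec :: "real \<Rightarrow> (nat \<Rightarrow> int) \<Rightarrow> nat \<Rightarrow> real" where
  "lvec N \<zeta> i = 1 / (4 * sqrt N) * real_of_int (\<zeta> i)"

definition lsparse :: "nat \<Rightarrow> real \<Rightarrow> nat \<Rightarrow> (nat \<Rightarrow> int) set" where
  "lsparse n N k = {\<zeta> \<in> lball n N. card {i. i < n \<and> \<zeta> i \<noteq> 0} \<le> k}"

lemma sqn_lvec:
  assumes "N > 0"
  shows "sqn n (lvec N \<zeta>) = (\<Sum>i<n. (real_of_int (\<zeta> i))\<^sup>2) / (16 * N)"
  using assms unfolding lvec_def sqn_scale
  by (simp add: sqn_def power_divide power_mult_distrib)

lemma sqn_lvec_le_1:
  assumes "N > 0" "\<zeta> \<in> lball n N"
  shows "sqn n (lvec N \<zeta>) \<le> 1"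
  using assms by (simp add: sqn_lvec lball_def divide_simps)

text \<open>Rounding is towards zero: no coordinate grows in absolute value, so the point stays in
  the ball, and each of the \<open>n\<close> coordinates moves by at most the mesh, for a squared
  error of at most \<open>n / (16 N)\<close>.\<close>

lemma lattice_round:
  assumes N: "N > 0" "real n \<le> N" and x: "sqn n x \<le> 1"
  obtains \<zeta> where "\<zeta> \<in> lball n N" "sqn n (\<lambda>i. x i - lvec N \<zeta> i) \<le> 1 / 16"
proof -
  define h where "h = 1 / (4 * sqrt N)"
  have h: "h > 0" "h\<^sup>2 = 1 / (16 * N)" using N by (auto simp: h_def power_divide power_mult_distrib)
  define \<zeta> where "\<zeta> = (\<lambda>i\<in>{..<n}. if x i \<ge> 0 then \<lfloor>x i / h\<rfloor> else - \<lfloor>- x i / h\<rfloor>)"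
  have fl: "\<bar>y - h * real_of_int \<lfloor>y / h\<rfloor>\<bar> \<le> h" "0 \<le> h * real_of_int \<lfloor>y / h\<rfloor>" "h * real_of_int \<lfloor>y / h\<rfloor> \<le> y"
    if "y \<ge> 0" for y
  proof -
    have a: "real_of_int \<lfloor>y / h\<rfloor> \<le> y / h" "y / h < real_of_int \<lfloor>y / h\<rfloor> + 1" by linarith+
    have b: "h * real_of_int \<lfloor>y / h\<rfloor> \<le> y" "y < h * real_of_int \<lfloor>y / h\<rfloor> + h"
      using mult_left_mono[OF a(1), of h] mult_strict_left_mono[OF a(2), of h] h by (simp_all add: distrib_left)
    then show "\<bar>y - h * real_of_int \<lfloor>y / h\<rfloor>\<bar> \<le> h" "h * real_of_int \<lfloor>y / h\<rfloor> \<le> y" by auto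
    show "0 \<le> h * real_of_int \<lfloor>y / h\<rfloor>" using that h by simp
  qed
  have sq: "A\<^sup>2 \<le> h\<^sup>2" if "\<bar>A\<bar> \<le> h" for A
    using that abs_le_square_iff[of A h] h(1) by simp
  have pw: "(x i - lvec N \<zeta> i)\<^sup>2 \<le> h\<^sup>2 \<and> (lvec N \<zeta> i)\<^sup>2 \<le> (x i)\<^sup>2" if "i < n" for i
  proof (cases "x i \<ge> 0")
    case True
    then have "lvec N \<zeta> i = h * real_of_int \<lfloor>x i / h\<rfloor>" using that by (simp add: lvec_def \<zeta>_def h_def)
    then show ?thesis using fl[OF True] by (auto intro!: sq power_mono)
  next
    case False
    then have "lvec N \<zeta> i = - (h * real_of_int \<lfloor>- x i / h\<rfloor>)" using that by (simp add: lvec_def \<zeta>_def h_def)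
    moreover have "(h * real_of_int \<lfloor>- x i / h\<rfloor>)\<^sup>2 \<le> (- x i)\<^sup>2"
      using fl[of "- x i"] False by (intro power_mono) auto
    moreover have "(x i + h * real_of_int \<lfloor>- x i / h\<rfloor>)\<^sup>2 \<le> h\<^sup>2"
      using fl(1)[of "- x i"] False by (intro sq) auto
    ultimately show ?thesis by simp
  qed
  have "sqn n (lvec N \<zeta>) \<le> 1" using sqn_mono[of n "lvec N \<zeta>" x] pw x by force
  then have mem: "\<zeta> \<in> lball n N"
    using N by (simp add: lball_def sqn_lvec divide_simps \<zeta>_def)
  have "sqn n (\<lambda>i. x i - lvec N \<zeta> i) \<le> (\<Sum>i<n. h\<^sup>2)"
    unfolding sqn_def by (rule sum_mono) (use pw in auto)
  moreover have "real n * h\<^sup>2 \<le> N * h\<^sup>2" using N by (intro mult_right_mono) auto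
  then have "real n * h\<^sup>2 \<le> 1 / 16" using N h by simp
  ultimately have "sqn n (\<lambda>i. x i - lvec N \<zeta> i) \<le> 1 / 16" by simp
  with mem show ?thesis by (rule that)
qed

text \<open>Keeps truncated test vectors inside the finite family over which the union bound
  runs.\<close>

lemma lattice_cutoff:
  assumes \<zeta>: "\<zeta> \<in> lball n N" and S: "card (S \<inter> {i. i < n \<and> \<zeta> i \<noteq> 0}) \<le> k"
  defines "\<zeta>' \<equiv> restrict (cutoff S \<zeta>) {..<n}"
  shows "\<zeta>' \<in> lsparse n N k"
    and "i < n \<Longrightarrow> lvec N \<zeta>' i = cutoff S (lvec N \<zeta>) i"
proof -
  have "(\<Sum>i<n. (real_of_int (\<zeta>' i))\<^sup>2) \<le> (\<Sum>i<n. (real_of_int (\<zeta> i))\<^sup>2)"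
    by (intro sum_mono) (auto simp: \<zeta>'_def cutoff_def)
  moreover have "{i. i < n \<and> \<zeta>' i \<noteq> 0} = S \<inter> {i. i < n \<and> \<zeta> i \<noteq> 0}"
    by (auto simp: \<zeta>'_def cutoff_def)
  ultimately show "\<zeta>' \<in> lsparse n N k"
    using \<zeta> S by (auto simp: lsparse_def lball_def \<zeta>'_def)
  show "i < n \<Longrightarrow> lvec N \<zeta>' i = cutoff S (lvec N \<zeta>) i"
    by (simp add: \<zeta>'_def lvec_def cutoff_def)
qed

lemma lball_box:
  assumes "N \<ge> 0"
  shows "lball n N \<subseteq> PiE {..<n} (\<lambda>_. {- \<lceil>16 * N\<rceil>..\<lceil>16 * N\<rceil>})"
proof
  fix \<zeta> assume \<zeta>: "\<zeta> \<in> lball n N"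
  have "\<bar>\<zeta> i\<bar> \<le> \<lceil>16 * N\<rceil>" if "i < n" for i
  proof -
    have "(real_of_int (\<zeta> i))\<^sup>2 \<le> (\<Sum>i<n. (real_of_int (\<zeta> i))\<^sup>2)"
      using that by (intro member_le_sum) auto
    then have "(real_of_int (\<zeta> i))\<^sup>2 \<le> 16 * N" using \<zeta> by (simp add: lball_def)
    moreover have "\<bar>\<zeta> i\<bar> \<le> (\<zeta> i)\<^sup>2"
      using self_le_power[of "\<bar>\<zeta> i\<bar>" 2] by (cases "\<zeta> i = 0") auto
    then have "real_of_int \<bar>\<zeta> i\<bar> \<le> (real_of_int (\<zeta> i))\<^sup>2" by (metis of_int_le_iff of_int_power)
    ultimately show ?thesis by linarith
  qed
  then show "\<zeta> \<in> PiE {..<n} (\<lambda>_. {- \<lceil>16 * N\<rceil>..\<lceil>16 * N\<rceil>})"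
    using \<zeta> by (force simp: lball_def PiE_def Pi_def abs_le_iff)
qed

lemma finite_lball: "N \<ge> 0 \<Longrightarrow> finite (lball n N)"
  by (rule finite_subset[OF lball_box]) (auto intro: finite_PiE)

lemma finite_lsparse: "N \<ge> 0 \<Longrightarrow> finite (lsparse n N k)"
  unfolding lsparse_def using finite_lball by simp

lemma sum_inverse_squares_le: "(\<Sum>j=1..r. 1 / (real j)\<^sup>2) \<le> 2"
proof -
  have "(\<Sum>j=1..Suc r. 1 / (real j)\<^sup>2) \<le> 2 - 1 / real (Suc r)" for r
  proof (induction r)
    case (Suc r)
    have "(\<Sum>j=1..Suc (Suc r). 1 / (real j)\<^sup>2) \<le> 2 - 1 / real (Suc r) + 1 / (real (Suc (Suc r)))\<^sup>2"
      using Suc by simp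
    also have "\<dots> \<le> 2 - 1 / real (Suc (Suc r))"
      by (simp add: divide_simps power2_eq_square) (simp add: algebra_simps)
    finally show ?case .
  qed simp
  note a = this
  show ?thesis
  proof (cases r)
    case (Suc s)
    have "2 - 1 / real (Suc s) \<le> 2" by simp
    then show ?thesis unfolding Suc by (rule order_trans[OF a])
  qed simp
qed

lemma sum_inverse_squares_int_le:
  "(\<Sum>j\<in>{- R..R} - {0}. 1 / (real_of_int j)\<^sup>2) \<le> 4"
proof -
  have "{- R..R} - {0} = (\<lambda>j. int j) ` {1..nat R} \<union> (\<lambda>j. - int j) ` {1..nat R}" (is "_ = ?A \<union> ?B")
  proof (intro equalityI subsetI)
    fix j assume j: "j \<in> {- R..R} - {0}"
    show "j \<in> ?A \<union> ?B"
    proof (cases "j > 0")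
      case True
      then have "j = int (nat j)" "nat j \<in> {1..nat R}" using j by auto
      then show ?thesis by blast
    next
      case False
      then have "j = - int (nat (- j))" "nat (- j) \<in> {1..nat R}" using j by auto
      then show ?thesis by blast
    qed
  qed auto
  moreover have "?A \<inter> ?B = {}" by auto
  ultimately have "(\<Sum>j\<in>{- R..R} - {0}. 1 / (real_of_int j)\<^sup>2)
     = (\<Sum>j\<in>?A. 1 / (real_of_int j)\<^sup>2) + (\<Sum>j\<in>?B. 1 / (real_of_int j)\<^sup>2)"
    by (simp add: sum.union_disjoint)
  also have "\<dots> = 2 * (\<Sum>j=1..nat R. 1 / (real j)\<^sup>2)"
    by (subst (1 2) sum.reindex) (auto simp: inj_on_def)
  finally show ?thesis using sum_inverse_squares_le[of "nat R"] by simp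
qed

text \<open>Weighted counting: every lattice point in question has weight at least \<open>t\<^sup>2\<^sup>k exp (- 16 k)\<close>
  under the product weight \<open>f\<close>, whose total mass is at most \<open>exp (4 k)\<close>.\<close>

lemma card_lsparse:
  assumes k: "1 \<le> k" "real k \<le> N" and n: "real n \<le> N"
  shows "real (card (lsparse n N (2 * k))) \<le> exp (20 * k + 4 * k * ln (N / k))"
proof -
  \<comment> \<open>This \<open>s\<close> balances two demands: the ball constraint costs
    \<open>s * 16 N = 16 k\<close>, and the total mass \<open>(1 + 4 s)^n\<close> is at most
    \<open>exp (4 k)\<close>. Taking \<open>t = s^2\<close> gives \<open>f j <= s / j^2\<close> away
    from 0.\<close>
  define s where "s = k / N"
  define t where "t = s\<^sup>2"
  have N: "N > 0" using k by simp
  have s: "0 < s" "s \<le> 1" and t: "0 < t" "t \<le> 1"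
    using k N by (auto simp: s_def t_def divide_simps power_le_one)
  \<comment> \<open>A rational majorant of the weight \<open>t exp (- s j^2)\<close>, summable by
    comparison with inverse squares.\<close>
  define f where "f = (\<lambda>j::int. if j = 0 then 1 else t / (1 + s * (real_of_int j)\<^sup>2))"
  define R where "R = \<lceil>16 * N\<rceil>"
  define Z where "Z = lsparse n N (2 * k)"
  have pos: "1 + s * (real_of_int j)\<^sup>2 > 0" for j using s by (simp add: add_pos_nonneg)
  have f0: "f j \<ge> 0" for j using t pos[of j] by (simp add: f_def less_imp_le)
  have weight: "t ^ (2 * k) * exp (- 16 * k) \<le> (\<Prod>i<n. f (\<zeta> i))" if "\<zeta> \<in> Z" for \<zeta>
  proof -
    have \<zeta>: "(\<Sum>i<n. (real_of_int (\<zeta> i))\<^sup>2) \<le> 16 * N" "card {i. i < n \<and> \<zeta> i \<noteq> 0} \<le> 2 * k"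
      using that by (auto simp: Z_def lsparse_def lball_def)
    have "t ^ (2 * k) \<le> t ^ card {i. i < n \<and> \<zeta> i \<noteq> 0}" using t \<zeta>(2) by (intro power_decreasing) auto
    also have "\<dots> = (\<Prod>i<n. if \<zeta> i \<noteq> 0 then t else 1)"
      by (simp add: prod.If_cases Int_def)
    finally have 1: "t ^ (2 * k) \<le> (\<Prod>i<n. if \<zeta> i \<noteq> 0 then t else 1)" .
    have "s * (\<Sum>i<n. (real_of_int (\<zeta> i))\<^sup>2) \<le> s * (16 * N)" using s \<zeta> by (intro mult_left_mono) auto
    then have 2: "exp (- 16 * k) \<le> exp (\<Sum>i<n. - (s * (real_of_int (\<zeta> i))\<^sup>2))"
      using N by (simp add: s_def sum_negf sum_distrib_left)
    have "t ^ (2 * k) * exp (- 16 * k) \<le> (\<Prod>i<n. if \<zeta> i \<noteq> 0 then t else 1) * exp (\<Sum>i<n. - (s * (real_of_int (\<zeta> i))\<^sup>2))"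
      using t by (intro mult_mono 1 2 prod_nonneg) auto
    also have "\<dots> = (\<Prod>i<n. (if \<zeta> i \<noteq> 0 then t else 1) * exp (- (s * (real_of_int (\<zeta> i))\<^sup>2)))"
      by (simp add: exp_sum prod.distrib)
    also have "\<dots> \<le> (\<Prod>i<n. f (\<zeta> i))"
    proof (intro prod_mono conjI)
      fix i
      show "0 \<le> (if \<zeta> i \<noteq> 0 then t else 1) * exp (- (s * (real_of_int (\<zeta> i))\<^sup>2))" using t by auto
      have "exp (- (s * (real_of_int (\<zeta> i))\<^sup>2)) \<le> 1 / (1 + s * (real_of_int (\<zeta> i))\<^sup>2)"
        using exp_ge_add_one_self[of "s * (real_of_int (\<zeta> i))\<^sup>2"] pos[of "\<zeta> i"]
        by (simp add: exp_minus inverse_eq_divide frac_le)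
      from mult_left_mono[OF this, of t]
      show "(if \<zeta> i \<noteq> 0 then t else 1) * exp (- (s * (real_of_int (\<zeta> i))\<^sup>2)) \<le> f (\<zeta> i)"
        using t by (auto simp: f_def)
    qed
    finally show ?thesis .
  qed
  have fB: "(\<Sum>j\<in>{- R..R}. f j) \<le> 1 + 4 * s"
  proof -
    have "R \<ge> 0" using N by (simp add: R_def)
    then have "(\<Sum>j\<in>{- R..R}. f j) = f 0 + (\<Sum>j\<in>{- R..R} - {0}. f j)"
      by (intro sum.remove) auto
    also have "(\<Sum>j\<in>{- R..R} - {0}. f j) \<le> (\<Sum>j\<in>{- R..R} - {0}. s * (1 / (real_of_int j)\<^sup>2))"
    proof (rule sum_mono)
      fix j assume "j \<in> {- R..R} - {0}"
      then have j: "j \<noteq> 0" by auto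
      have "f j = t / (1 + s * (real_of_int j)\<^sup>2)" using j by (simp add: f_def)
      also have "\<dots> \<le> t / (s * (real_of_int j)\<^sup>2)" using j s t pos[of j] by (intro divide_left_mono) auto
      also have "\<dots> = s * (1 / (real_of_int j)\<^sup>2)" using s by (simp add: t_def power2_eq_square)
      finally show "f j \<le> s * (1 / (real_of_int j)\<^sup>2)" .
    qed
    also have "\<dots> \<le> s * 4"
      unfolding sum_distrib_left[symmetric] using s by (intro mult_left_mono sum_inverse_squares_int_le) auto
    finally show ?thesis by (simp add: f_def)
  qed
  have "real (card Z) * (t ^ (2 * k) * exp (- 16 * k)) = (\<Sum>\<zeta>\<in>Z. t ^ (2 * k) * exp (- 16 * k))" by simp
  also have "\<dots> \<le> (\<Sum>\<zeta>\<in>Z. \<Prod>i<n. f (\<zeta> i))" by (intro sum_mono weight)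
  also have "\<dots> \<le> (\<Sum>\<zeta>\<in>PiE {..<n} (\<lambda>_. {- R..R}). \<Prod>i<n. f (\<zeta> i))"
    using lball_box[of N n] N
    by (intro sum_mono2 prod_nonneg f0 finite_PiE) (auto simp: Z_def lsparse_def R_def)
  also have "\<dots> = (\<Prod>i<n. \<Sum>j\<in>{- R..R}. f j)" by (rule prod_sum_PiE[symmetric]) auto
  also have "\<dots> = (\<Sum>j\<in>{- R..R}. f j) ^ n" by simp
  also have "\<dots> \<le> (exp (4 * s)) ^ n"
    by (intro power_mono order_trans[OF fB] exp_ge_add_one_self sum_nonneg f0)
  also have "\<dots> = exp (4 * s * n)" by (simp add: exp_of_nat_mult[symmetric] mult.commute)
  also have "\<dots> \<le> exp (4 * k)"
    using mult_left_mono[OF n, of "real k"] N by (simp add: s_def field_simps)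
  finally have main: "real (card Z) * (t ^ (2 * k) * exp (- 16 * k)) \<le> exp (4 * k)" .
  have "t ^ (2 * k) = exp (real (2 * k) * ln t)" using t by (simp only: exp_of_nat_mult exp_ln)
  also have "ln t = - (2 * ln (N / k))"
    using s k N by (simp add: t_def s_def ln_realpow ln_div)
  finally have "t ^ (2 * k) * exp (- 16 * k) = exp (- (16 * k + 4 * k * ln (N / k)))"
    by (simp add: exp_add[symmetric] algebra_simps)
  then have "real (card Z) \<le> exp (4 * k) / exp (- (16 * k + 4 * k * ln (N / k)))"
    using main by (simp add: pos_le_divide_eq)
  also have "\<dots> = exp (20 * k + 4 * k * ln (N / k))"
    by (simp add: exp_diff[symmetric])
  finally show ?thesis by (simp add: Z_def)
qed

section \<open>Gram matrices of rank-one tensors\<close>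

text \<open>Markov's inequality for the counting measure.\<close>

lemma card_large_entries:
  assumes "sqn n z \<le> 1" "c > 0"
  shows "real (card {i. i < n \<and> 1 / c < (z i)\<^sup>2}) \<le> c"
proof -
  let ?S = "{i. i < n \<and> 1 / c < (z i)\<^sup>2}"
  have "real (card ?S) * (1 / c) = (\<Sum>i\<in>?S. 1 / c)" by simp
  also have "\<dots> \<le> (\<Sum>i\<in>?S. (z i)\<^sup>2)" by (rule sum_mono) auto
  also have "\<dots> \<le> sqn n z" unfolding sqn_def by (rule sum_mono2) auto
  also have "\<dots> \<le> 1" by fact
  finally show ?thesis using assms(2) by (simp add: pos_divide_le_eq)
qed

text \<open>Coordinates are grouped dyadically by magnitude, \<open>S l\<close> collecting those with square
  above \<open>2\<^sup>-\<^sup>l\<close>; each cross term of the telescoped form then pairs a sparse vector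
  with a flat one.\<close>

lemma decoupled_form_bound:
  fixes M :: "nat \<Rightarrow> nat \<Rightarrow> real"
  assumes sym: "\<And>i j. M i j = M j i"
    and N: "real n \<le> N" "2 ^ L \<le> N" "N < 2 ^ Suc L"
    and hyp: "\<And>l \<xi> \<eta>. l \<le> L \<Longrightarrow> \<xi> \<in> lsparse n N (2 * 2 ^ l) \<Longrightarrow> \<eta> \<in> lsparse n N (2 * 2 ^ l) \<Longrightarrow>
       (\<And>i. i < n \<Longrightarrow> \<xi> i = 0 \<or> \<eta> i = 0) \<Longrightarrow> (\<And>i. i < n \<Longrightarrow> (lvec N \<eta> i)\<^sup>2 \<le> 1 / 2 ^ l) \<Longrightarrow>
       \<bar>bil n M (lvec N \<xi>) (lvec N \<eta>)\<bar> \<le> \<epsilon> l * sqrt (bil n M (lvec N \<xi>) (lvec N \<xi>))"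
    and \<epsilon>: "\<And>l. \<epsilon> l \<ge> 0"
    and up: "\<And>x. sqn n x \<le> 1 \<Longrightarrow> bil n M x x \<le> A"
    and \<zeta>: "\<zeta> \<in> lball n N"
  defines "z \<equiv> lvec N \<zeta>"
  shows "\<bar>bil n M (cutoff I z) (cutoff (- I) z)\<bar> \<le> 2 * (\<Sum>l\<le>L. \<epsilon> l) * sqrt A"
proof -
  have Npos: "N > 0" using N(2) zero_less_power[of "2::real" L] by linarith
  have z1: "sqn n z \<le> 1" unfolding z_def by (rule sqn_lvec_le_1[OF Npos \<zeta>])
  \<comment> \<open>Beyond level \<open>L\<close> the set is everything. Because
    \<open>n <= N < 2 ^ Suc L\<close>, it still meets the sparsity bound of level \<open>L\<close>,
    so no finer levels are needed.\<close>
  define S where "S = (\<lambda>l. if l \<le> L then {i. i < n \<and> 1 / 2 ^ l < (z i)\<^sup>2} else {..<n})"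
  define x where "x = cutoff I z"
  define y where "y = cutoff (- I) z"
  have Smono: "S l \<subseteq> S (Suc l)" if "l \<le> L" for l
  proof (cases "Suc l \<le> L")
    case True
    have "1 / 2 ^ Suc l \<le> (1 / 2 ^ l :: real)" by (simp add: divide_simps)
    then show ?thesis using True by (auto simp: S_def simp del: power_Suc)
  qed (auto simp: S_def)
  have Scard: "card (S (Suc l)) \<le> 2 * 2 ^ l" if "l \<le> L" for l
  proof (cases "Suc l \<le> L")
    case True
    have "real (card (S (Suc l))) \<le> 2 ^ Suc l"
      using card_large_entries[OF z1, of "2 ^ Suc l"] True by (simp add: S_def del: power_Suc)
    then have "real (card (S (Suc l))) \<le> real (2 * 2 ^ l)" by simp
    then show ?thesis by (simp only: of_nat_le_iff)
  next
    case False
    then have "l = L" using that by simp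
    then have "S (Suc l) = {..<n}" by (simp add: S_def)
    moreover have "real n < real (2 * 2 ^ L)" using N by simp
    then have "n < 2 * 2 ^ L" by (simp only: of_nat_less_iff)
    ultimately show ?thesis using \<open>l = L\<close> by simp
  qed
  have Sn: "S l \<subseteq> {..<n}" for l by (auto simp: S_def)
  \<comment> \<open>The size of \<open>S (Suc l)\<close> makes both vectors sparse, and entries
    outside \<open>S l\<close> have square at most \<open>1 / 2 ^ l\<close>, which makes the second
    vector flat.\<close>
  have part: "\<bar>bil n M (cutoff P z) (cutoff Q z)\<bar> \<le> \<epsilon> l * sqrt A"
    if l: "l \<le> L" and P: "P \<subseteq> S (Suc l)" and Q: "Q \<subseteq> S (Suc l) - S l" and PQ: "P \<inter> Q = {}" for l P Q
  proof -
    have fin: "finite (S (Suc l))" using finite_subset[OF Sn] by auto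
    have cP: "card (P \<inter> {i. i < n \<and> \<zeta> i \<noteq> 0}) \<le> 2 * 2 ^ l"
      by (rule order_trans[OF card_mono[OF fin] Scard[OF l]]) (use P in auto)
    have cQ: "card (Q \<inter> {i. i < n \<and> \<zeta> i \<noteq> 0}) \<le> 2 * 2 ^ l"
      by (rule order_trans[OF card_mono[OF fin] Scard[OF l]]) (use Q in auto)
    define \<xi> where "\<xi> = restrict (cutoff P \<zeta>) {..<n}"
    define \<eta> where "\<eta> = restrict (cutoff Q \<zeta>) {..<n}"
    note \<xi> = lattice_cutoff[OF \<zeta> cP, folded \<xi>_def, folded z_def]
    note \<eta> = lattice_cutoff[OF \<zeta> cQ, folded \<eta>_def, folded z_def]
    have eq1: "bil n M (lvec N \<xi>) (lvec N \<eta>) = bil n M (cutoff P z) (cutoff Q z)"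
      by (rule bil_cong) (simp_all add: \<xi>(2) \<eta>(2))
    have "\<bar>bil n M (lvec N \<xi>) (lvec N \<eta>)\<bar> \<le> \<epsilon> l * sqrt (bil n M (lvec N \<xi>) (lvec N \<xi>))"
    proof (rule hyp[OF l \<xi>(1) \<eta>(1)])
      show "\<xi> i = 0 \<or> \<eta> i = 0" if "i < n" for i
        using PQ that by (auto simp: \<xi>_def \<eta>_def cutoff_def)
      show "(lvec N \<eta> i)\<^sup>2 \<le> 1 / 2 ^ l" if "i < n" for i
        unfolding \<eta>(2)[OF that] using Q l that by (auto simp: cutoff_def S_def not_less)
    qed
    also have "\<dots> \<le> \<epsilon> l * sqrt A"
    proof (intro mult_left_mono real_sqrt_le_mono up \<epsilon>)
      have "\<xi> \<in> lball n N" using \<xi>(1) by (simp add: lsparse_def)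
      then show "sqn n (lvec N \<xi>) \<le> 1" by (rule sqn_lvec_le_1[OF Npos])
    qed
    finally show ?thesis unfolding eq1 .
  qed
  have full: "bil n M x y = bil n M (cutoff (S (Suc L)) x) (cutoff (S (Suc L)) y)"
    by (rule bil_cong) (auto simp: cutoff_def S_def)
  have zero: "bil n M (cutoff (S 0) x) (cutoff (S 0) y) = 0"
  proof (rule bil_zero_left)
    fix i assume "i < n"
    then show "cutoff (S 0) x i = 0"
      using component_le_sqn[of i n z] z1 by (auto simp: S_def cutoff_def)
  qed
  have "\<bar>bil n M x y\<bar> \<le> (\<Sum>l\<le>L. \<bar>bil n M (cutoff (S (Suc l)) x) (\<lambda>i. cutoff (S (Suc l)) y i - cutoff (S l) y i)\<bar> +
              \<bar>bil n M (\<lambda>i. cutoff (S (Suc l)) x i - cutoff (S l) x i) (cutoff (S l) y)\<bar>)"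
    unfolding full using bil_telescope[of n M S L x y] by (simp add: zero)
  also have "\<dots> \<le> (\<Sum>l\<le>L. \<epsilon> l * sqrt A + \<epsilon> l * sqrt A)"
  proof (intro sum_mono add_mono)
    fix l assume "l \<in> {..L}"
    then have l: "l \<le> L" by simp
    note mono = Smono[OF l]
    have "bil n M (cutoff (S (Suc l)) x) (\<lambda>i. cutoff (S (Suc l)) y i - cutoff (S l) y i)
        = bil n M (cutoff (S (Suc l) \<inter> I) z) (cutoff ((S (Suc l) - S l) - I) z)"
      using mono by (intro bil_cong) (auto simp: cutoff_def x_def y_def)
    then show "\<bar>bil n M (cutoff (S (Suc l)) x) (\<lambda>i. cutoff (S (Suc l)) y i - cutoff (S l) y i)\<bar> \<le> \<epsilon> l * sqrt A"
      using part[OF l, of "S (Suc l) \<inter> I" "(S (Suc l) - S l) - I"] by auto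
    have "bil n M (\<lambda>i. cutoff (S (Suc l)) x i - cutoff (S l) x i) (cutoff (S l) y)
        = bil n M (cutoff ((S (Suc l) - S l) \<inter> I) z) (cutoff (S l - I) z)"
      using mono by (intro bil_cong) (auto simp: cutoff_def x_def y_def)
    \<comment> \<open>Symmetry moves the difference vector, which carries the flatness, into the
      second slot.\<close>
    also have "\<dots> = bil n M (cutoff (S l - I) z) (cutoff ((S (Suc l) - S l) \<inter> I) z)"
      by (rule bil_sym) (rule sym)
    finally show "\<bar>bil n M (\<lambda>i. cutoff (S (Suc l)) x i - cutoff (S l) x i) (cutoff (S l) y)\<bar> \<le> \<epsilon> l * sqrt A"
      using part[OF l, of "S l - I" "(S (Suc l) - S l) \<inter> I"] mono by auto
  qed
  also have "\<dots> = 2 * (\<Sum>l\<le>L. \<epsilon> l) * sqrt A"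
    by (simp add: sum_distrib_left sum_distrib_right algebra_simps)
  finally show ?thesis by (simp add: x_def y_def)
qed

text \<open>A self-bounding argument. The cross terms are controlled by the root of the form of
  \<open>M\<close> itself, hence by \<open>sqrt (5 / 4 + \<omega>)\<close> with \<omega> the
  off-diagonal norm being estimated; the resulting inequality for \<omega> is then solved.\<close>

lemma near_identity:
  fixes M :: "nat \<Rightarrow> nat \<Rightarrow> real"
  assumes sym: "\<And>i j. M i j = M j i"
    and N: "real n \<le> N" "2 ^ L \<le> N" "N < 2 ^ Suc L"
    and hyp: "\<And>l \<xi> \<eta>. l \<le> L \<Longrightarrow> \<xi> \<in> lsparse n N (2 * 2 ^ l) \<Longrightarrow> \<eta> \<in> lsparse n N (2 * 2 ^ l) \<Longrightarrow>
       (\<And>i. i < n \<Longrightarrow> \<xi> i = 0 \<or> \<eta> i = 0) \<Longrightarrow> (\<And>i. i < n \<Longrightarrow> (lvec N \<eta> i)\<^sup>2 \<le> 1 / 2 ^ l) \<Longrightarrow>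
       \<bar>bil n M (lvec N \<xi>) (lvec N \<eta>)\<bar> \<le> \<epsilon> l * sqrt (bil n M (lvec N \<xi>) (lvec N \<xi>))"
    and \<epsilon>: "\<And>l. \<epsilon> l \<ge> 0" "(\<Sum>l\<le>L. \<epsilon> l) \<le> 1 / 100"
    and diag: "\<And>i. i < n \<Longrightarrow> \<bar>M i i - 1\<bar> \<le> 1 / 4"
  shows "\<bar>bil n (\<lambda>i j. (if i = j then 1 else 0) - M i j) x y\<bar> \<le> 1 / 2 * sqrt (sqn n x) * sqrt (sqn n y)"
proof -
  have Npos: "N > 0" using N(2) zero_less_power[of "2::real" L] by linarith
  define W where "W = (\<lambda>i j. if i = j then 0 else M i j)"
  have Wsym: "W i j = W j i" for i j by (simp add: W_def sym)
  have fin: "finite (lvec N ` lball n N)" using Npos by (intro finite_imageI finite_lball) simp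
  have net: "\<exists>z\<in>lvec N ` lball n N. sqn n z \<le> 1 \<and> sqn n (\<lambda>i. x i - z i) \<le> 1 / 16" if x: "sqn n x \<le> 1" for x
  proof -
    obtain \<zeta> where "\<zeta> \<in> lball n N" "sqn n (\<lambda>i. x i - lvec N \<zeta> i) \<le> 1 / 16"
      by (rule lattice_round[OF Npos N(1) x])
    then show ?thesis using sqn_lvec_le_1[OF Npos] by blast
  qed
  from net_norm[where W = W and n = n, OF Wsym fin net]
  obtain \<omega> where \<omega>: "\<omega> \<ge> 0" "\<And>x. \<bar>bil n W x x\<bar> \<le> \<omega> * sqn n x"
    and ex: "\<exists>z\<in>lvec N ` lball n N. sqn n z \<le> 1 \<and> \<omega> \<le> 2 * \<bar>bil n W z z\<bar>"
    by auto
  from ex obtain \<zeta> where \<zeta>: "\<zeta> \<in> lball n N" and \<omega>z: "\<omega> \<le> 2 * \<bar>bil n W (lvec N \<zeta>) (lvec N \<zeta>)\<bar>"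
    by auto
  have dW: "bil n M x x = bil n W x x + (\<Sum>i<n. M i i * (x i)\<^sup>2)" for x
  proof -
    have "bil n M x x = (\<Sum>i<n. \<Sum>j<n. x i * W i j * x j + (if i = j then M i i * (x i)\<^sup>2 else 0))"
      unfolding bil_def by (intro sum.cong refl) (auto simp: W_def power2_eq_square)
    then show ?thesis by (simp add: bil_def sum.distrib)
  qed
  have up: "bil n M x x \<le> 5 / 4 + \<omega>" if "sqn n x \<le> 1" for x
  proof -
    have "(\<Sum>i<n. M i i * (x i)\<^sup>2) \<le> (\<Sum>i<n. 5 / 4 * (x i)\<^sup>2)"
    proof (intro sum_mono mult_right_mono)
      fix i assume "i \<in> {..<n}"
      then have "\<bar>M i i - 1\<bar> \<le> 1 / 4" using diag[of i] by simp
      then show "M i i \<le> 5 / 4" by linarith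
    qed simp
    also have "\<dots> = 5 / 4 * sqn n x" by (simp add: sqn_def sum_distrib_left)
    also have "\<dots> \<le> 5 / 4" using that by simp
    finally show ?thesis using dW[of x] \<omega>(2)[of x] mult_left_mono[OF that \<omega>(1)] by linarith
  qed
  define z where "z = lvec N \<zeta>"
  obtain I where I: "I \<subseteq> {..<n}" "\<bar>\<Sum>i<n. \<Sum>j\<in>{..<n} - {i}. z i * M i j * z j\<bar>
      \<le> 4 * \<bar>\<Sum>i\<in>I. \<Sum>j\<in>{..<n} - I. z i * M i j * z j\<bar>"
    using decoupling[of "{..<n}" "\<lambda>i j. z i * M i j * z j"] by blast
  have "bil n W z z = (\<Sum>i<n. \<Sum>j\<in>{..<n} - {i}. z i * M i j * z j)"
    unfolding bil_def by (intro sum.cong refl sum.mono_neutral_cong_right) (auto simp: W_def)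
  moreover have "(\<Sum>i\<in>I. \<Sum>j\<in>{..<n} - I. z i * M i j * z j) = bil n M (cutoff I z) (cutoff (- I) z)"
  proof -
    have "bil n M (cutoff I z) (cutoff (- I) z) = (\<Sum>i\<in>I. \<Sum>j<n. cutoff I z i * M i j * cutoff (- I) z j)"
      unfolding bil_def using I by (intro sum.mono_neutral_right) (auto simp: cutoff_def)
    also have "\<dots> = (\<Sum>i\<in>I. \<Sum>j\<in>{..<n} - I. z i * M i j * z j)"
      by (intro sum.cong refl sum.mono_neutral_cong_right) (auto simp: cutoff_def)
    finally show ?thesis ..
  qed
  moreover have "\<bar>bil n M (cutoff I z) (cutoff (- I) z)\<bar> \<le> 2 * (\<Sum>l\<le>L. \<epsilon> l) * sqrt (5 / 4 + \<omega>)"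
    unfolding z_def by (rule decoupled_form_bound[OF sym N hyp \<epsilon>(1) up \<zeta>])
  \<comment> \<open>The factor 16 is 2 from the net, 4 from decoupling and 2 for the two cross terms
    at each level.\<close>
  ultimately have "\<omega> \<le> 16 * (\<Sum>l\<le>L. \<epsilon> l) * sqrt (5 / 4 + \<omega>)"
    using \<omega>z I(2) by (simp add: z_def[symmetric])
  also have "\<dots> \<le> 16 * (1 / 100) * sqrt (5 / 4 + \<omega>)"
    using \<epsilon>(2) \<omega>(1) by (intro mult_right_mono mult_left_mono) auto
  finally have 1: "\<omega> \<le> 4 / 25 * sqrt (5 / 4 + \<omega>)" by simp
  \<comment> \<open>Replaces the square root by its tangent at 9/4, which makes the inequality
    linear in \<omega>.\<close>
  have "0 \<le> (sqrt (5 / 4 + \<omega>) - 3 / 2)\<^sup>2" by simp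
  also have "\<dots> = 5 / 4 + \<omega> - 3 * sqrt (5 / 4 + \<omega>) + 9 / 4"
    using \<omega>(1) by (simp add: power2_diff) (simp add: power2_eq_square)
  finally have \<omega>4: "\<omega> \<le> 1 / 4" using 1 by simp
  show ?thesis
  proof (rule bil_le_of_quad)
    show "(if i = j then 1 else 0) - M i j = (if j = i then 1 else 0) - M j i" for i j by (simp add: sym)
    fix x
    have "bil n (\<lambda>i j. (if i = j then 1 else 0) - M i j) x x = (\<Sum>i<n. (1 - M i i) * (x i)\<^sup>2) - bil n W x x"
    proof -
      have "bil n (\<lambda>i j. (if i = j then 1 else 0) - M i j) x x
          = (\<Sum>i<n. \<Sum>j<n. (if i = j then (1 - M i i) * (x i)\<^sup>2 else 0) - x i * W i j * x j)"
        unfolding bil_def by (intro sum.cong refl) (auto simp: W_def power2_eq_square algebra_simps)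
      then show ?thesis by (simp add: bil_def sum_subtractf)
    qed
    moreover have "\<bar>\<Sum>i<n. (1 - M i i) * (x i)\<^sup>2\<bar> \<le> 1 / 4 * sqn n x"
    proof -
      have "\<bar>\<Sum>i<n. (1 - M i i) * (x i)\<^sup>2\<bar> \<le> (\<Sum>i<n. \<bar>(1 - M i i) * (x i)\<^sup>2\<bar>)" by (rule sum_abs)
      also have "\<dots> \<le> (\<Sum>i<n. 1 / 4 * (x i)\<^sup>2)"
      proof (rule sum_mono)
        fix i assume "i \<in> {..<n}"
        then have "\<bar>1 - M i i\<bar> \<le> 1 / 4" using diag[of i] by (simp add: abs_minus_commute)
        from mult_right_mono[OF this, of "(x i)\<^sup>2"]
        show "\<bar>(1 - M i i) * (x i)\<^sup>2\<bar> \<le> 1 / 4 * (x i)\<^sup>2" by (simp add: abs_mult)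
      qed
      finally show ?thesis by (simp add: sqn_def sum_distrib_left)
    qed
    moreover have "\<bar>bil n W x x\<bar> \<le> 1 / 4 * sqn n x"
      using \<omega>(2)[of x] mult_right_mono[OF \<omega>4, of "sqn n x"] by simp
    ultimately show "\<bar>bil n (\<lambda>i j. (if i = j then 1 else 0) - M i j) x x\<bar> \<le> 1 / 2 * sqn n x"
      by linarith
  qed
qed

section \<open>The tensors \<open>a_i b_i^T / m\<close> under the Frobenius inner product\<close>

definition gram :: "nat \<Rightarrow> (nat \<Rightarrow> nat \<Rightarrow> real) \<Rightarrow> (nat \<Rightarrow> nat \<Rightarrow> real) \<Rightarrow> nat \<Rightarrow> nat \<Rightarrow> real" where
  "gram m a b i j = (\<Sum>p<m. a i p * a j p) * (\<Sum>q<m. b i q * b j q) / (real m)\<^sup>2"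

text \<open>With the coefficients \<delta> in place of \<open>x\<close> this is the correcting
  block. For a general \<open>x\<close> its squared Frobenius norm is the quadratic form of
  \<open>gram\<close> at \<open>x\<close>.\<close>

definition tensor :: "nat \<Rightarrow> nat \<Rightarrow> (nat \<Rightarrow> nat \<Rightarrow> real) \<Rightarrow> (nat \<Rightarrow> nat \<Rightarrow> real) \<Rightarrow> (nat \<Rightarrow> real) \<Rightarrow> nat \<Rightarrow> nat \<Rightarrow> real" where
  "tensor n m a b x p q = (\<Sum>i<n. x i * a i p * b i q) / real m"

definition pairing :: "nat \<Rightarrow> (nat \<Rightarrow> nat \<Rightarrow> real) \<Rightarrow> (nat \<Rightarrow> nat \<Rightarrow> real) \<Rightarrow> (nat \<Rightarrow> real) \<Rightarrow> (nat \<Rightarrow> real) \<Rightarrow> nat \<Rightarrow> real" where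
  "pairing m a b u v i = (\<Sum>p<m. u p * a i p) * (\<Sum>q<m. v q * b i q) / real m"

lemma gram_sym: "gram m a b i j = gram m a b j i"
  by (simp add: gram_def mult.commute)

lemma tensor_pairing:
  "(\<Sum>p<m. \<Sum>q<m. u p * tensor n m a b x p q * v q) = (\<Sum>i<n. x i * pairing m a b u v i)"
proof -
  have "(\<Sum>p<m. \<Sum>q<m. u p * tensor n m a b x p q * v q)
      = (\<Sum>p<m. \<Sum>q<m. \<Sum>i<n. x i * (u p * a i p * (v q * b i q)) / real m)"
    by (simp add: tensor_def sum_distrib_left sum_distrib_right sum_divide_distrib mult_ac)
  also have "\<dots> = (\<Sum>i<n. \<Sum>p<m. \<Sum>q<m. x i * (u p * a i p * (v q * b i q)) / real m)"
    by (simp only: sum.swap[where A = "{..<m}" and B = "{..<n}"])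
  also have "\<dots> = (\<Sum>i<n. x i * pairing m a b u v i)"
    unfolding pairing_def sum_product by (simp add: sum_distrib_left sum_divide_distrib mult_ac)
  finally show ?thesis .
qed

lemma pairing_gram: "pairing m a b (a j) (b j) i = real m * gram m a b j i"
  by (simp add: pairing_def gram_def power2_eq_square)

lemma bil_gram:
  "bil n (gram m a b) x y = (\<Sum>p<m. \<Sum>q<m. tensor n m a b x p q * tensor n m a b y p q)"
proof -
  have "bil n (gram m a b) x y = (\<Sum>i<n. x i * (\<Sum>j<n. y j * (pairing m a b (a i) (b i) j / real m)))"
    by (cases "m = 0") (simp_all add: bil_def pairing_gram sum_distrib_left mult_ac, simp add: gram_def)
  also have "\<dots> = (\<Sum>i<n. x i * ((\<Sum>j<n. y j * pairing m a b (a i) (b i) j) / real m))"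
    by (simp add: sum_divide_distrib)
  also have "\<dots> = (\<Sum>i<n. x i * ((\<Sum>p<m. \<Sum>q<m. a i p * tensor n m a b y p q * b i q) / real m))"
    by (simp only: tensor_pairing)
  also have "\<dots> = (\<Sum>i<n. \<Sum>p<m. \<Sum>q<m. (x i * a i p * b i q) / real m * tensor n m a b y p q)"
    by (simp add: sum_distrib_left sum_divide_distrib mult_ac)
  also have "\<dots> = (\<Sum>p<m. \<Sum>q<m. \<Sum>i<n. (x i * a i p * b i q) / real m * tensor n m a b y p q)"
    by (simp only: sum.swap[where A = "{..<n}" and B = "{..<m}"])
  also have "\<dots> = (\<Sum>p<m. \<Sum>q<m. tensor n m a b x p q * tensor n m a b y p q)"
    by (simp only: tensor_def[of n m a b x] sum_divide_distrib sum_distrib_right)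
  finally show ?thesis .
qed

text \<open>Cauchy-Schwarz in the Frobenius inner product between the tensor of \<open>x\<close> and
  \<open>u v^T\<close>.\<close>

lemma pairing_square_le:
  "(\<Sum>i<n. x i * pairing m a b u v i)\<^sup>2 \<le> bil n (gram m a b) x x * (sqn m u * sqn m v)"
proof -
  have "(\<Sum>i<n. x i * pairing m a b u v i) = (\<Sum>(p, q)\<in>{..<m} \<times> {..<m}. (u p * v q) * tensor n m a b x p q)"
    unfolding tensor_pairing[symmetric] sum.cartesian_product[symmetric] by (simp add: mult_ac)
  then have "(\<Sum>i<n. x i * pairing m a b u v i)\<^sup>2 \<le>
     (\<Sum>(p, q)\<in>{..<m} \<times> {..<m}. (u p * v q)\<^sup>2) * (\<Sum>(p, q)\<in>{..<m} \<times> {..<m}. (tensor n m a b x p q)\<^sup>2)"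
    using Cauchy_Schwarz_ineq_sum[of "\<lambda>(p, q). u p * v q" "\<lambda>(p, q). tensor n m a b x p q" "{..<m} \<times> {..<m}"]
    by (simp add: case_prod_unfold)
  also have "(\<Sum>(p, q)\<in>{..<m} \<times> {..<m}. (u p * v q)\<^sup>2) = sqn m u * sqn m v"
    unfolding sum.cartesian_product[symmetric] by (simp add: sqn_def sum_product power_mult_distrib)
  also have "(\<Sum>(p, q)\<in>{..<m} \<times> {..<m}. (tensor n m a b x p q)\<^sup>2) = bil n (gram m a b) x x"
    unfolding sum.cartesian_product[symmetric] by (simp add: bil_gram power2_eq_square)
  finally show ?thesis by (simp add: mult.commute)
qed

text \<open>The pairing is the adjoint of the tensor map applied to \<open>u v^T\<close>, so it
  inherits the norm bound: test with \<open>x\<close> equal to the pairing itself and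
  cancel.\<close>

lemma sqn_pairing_le:
  assumes up: "\<And>x. bil n (gram m a b) x x \<le> 3 / 2 * sqn n x" and uv: "sqn m u \<le> 1" "sqn m v \<le> 1"
  shows "sqn n (pairing m a b u v) \<le> 3 / 2"
proof -
  define w where "w = pairing m a b u v"
  have "(\<Sum>i<n. w i * pairing m a b u v i) = sqn n w" by (simp add: sqn_def w_def power2_eq_square)
  then have "(sqn n w)\<^sup>2 \<le> bil n (gram m a b) w w * (sqn m u * sqn m v)"
    using pairing_square_le[where n = n and x = w and m = m and a = a and b = b and u = u and v = v] by simp
  also have "\<dots> \<le> (3 / 2 * sqn n w) * 1"
    using uv by (intro mult_mono up mult_le_one) (auto intro: mult_nonneg_nonneg)
  finally have "sqn n w * sqn n w \<le> 3 / 2 * sqn n w" by (simp add: power2_eq_square)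
  then show ?thesis unfolding w_def[symmetric] by (cases "sqn n w = 0") (auto simp: less_le mult_le_cancel_right)
qed

text \<open>Entries of the pairing above the truncation level \<open>r\<close> are controlled by the sup norm of
  \<open>\<delta>\<close>, since they contribute at most \<open>3 / (2 r)\<close> in total.\<close>

lemma pairing_split_bound:
  assumes sq: "sqn n w \<le> 3 / 2" and r: "r > 0" and \<theta>: "\<And>i. i < n \<Longrightarrow> \<bar>\<delta> i\<bar> \<le> \<theta>" "\<theta> \<ge> 0"
    and small: "\<bar>\<Sum>i<n. \<delta> i * (if \<bar>w i\<bar> \<le> r then w i else 0)\<bar> \<le> c"
  shows "\<bar>\<Sum>i<n. \<delta> i * w i\<bar> \<le> c + \<theta> * 3 / (2 * r)"
proof -
  have "(\<Sum>i<n. \<delta> i * w i) = (\<Sum>i<n. \<delta> i * (if \<bar>w i\<bar> \<le> r then w i else 0)) + (\<Sum>i<n. \<delta> i * (if \<bar>w i\<bar> \<le> r then 0 else w i))"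
    unfolding sum.distrib[symmetric] by (intro sum.cong refl) auto
  moreover have "\<bar>\<Sum>i<n. \<delta> i * (if \<bar>w i\<bar> \<le> r then 0 else w i)\<bar> \<le> \<theta> * 3 / (2 * r)"
  proof -
    have "\<bar>\<Sum>i<n. \<delta> i * (if \<bar>w i\<bar> \<le> r then 0 else w i)\<bar> \<le> (\<Sum>i<n. \<bar>\<delta> i * (if \<bar>w i\<bar> \<le> r then 0 else w i)\<bar>)"
      by (rule sum_abs)
    also have "\<dots> \<le> (\<Sum>i<n. \<theta> / r * (w i)\<^sup>2)"
    proof (rule sum_mono)
      fix i assume "i \<in> {..<n}"
      then have i: "\<bar>\<delta> i\<bar> \<le> \<theta>" using \<theta> by auto
      show "\<bar>\<delta> i * (if \<bar>w i\<bar> \<le> r then 0 else w i)\<bar> \<le> \<theta> / r * (w i)\<^sup>2"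
      proof (cases "\<bar>w i\<bar> \<le> r")
        case False
        have "\<bar>\<delta> i\<bar> * \<bar>w i\<bar> \<le> \<theta> * (\<bar>w i\<bar> * (\<bar>w i\<bar> / r))"
        proof (intro mult_mono i)
          have "\<bar>w i\<bar> * 1 \<le> \<bar>w i\<bar> * (\<bar>w i\<bar> / r)"
            using False r by (intro mult_left_mono) (auto simp: divide_simps)
          then show "\<bar>w i\<bar> \<le> \<bar>w i\<bar> * (\<bar>w i\<bar> / r)" by simp
        qed (use \<theta> in auto)
        then show ?thesis using False by (simp add: abs_mult power2_eq_square)
      qed (use r \<theta> in auto)
    qed
    also have "\<dots> = \<theta> / r * sqn n w" by (simp add: sqn_def sum_distrib_left)
    also have "\<dots> \<le> \<theta> / r * (3 / 2)" using sq r \<theta> by (intro mult_left_mono) auto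
    finally show ?thesis by (simp add: field_simps)
  qed
  ultimately show ?thesis using small by linarith
qed

section \<open>Good events for the features\<close>

lemma chernoff_bound:
  fixes X :: "'a \<Rightarrow> real"
  assumes M: "prob_space M" and X: "X \<in> borel_measurable M" and K: "K \<ge> 0"
    and int: "(\<integral>\<^sup>+\<omega>. ennreal (exp (X \<omega>)) \<partial>M) \<le> ennreal K"
  shows "measure M {\<omega>\<in>space M. X \<omega> \<ge> c} \<le> K * exp (- c)"
proof -
  interpret prob_space M by fact
  have "emeasure M {\<omega>\<in>space M. X \<omega> \<ge> c} = (\<integral>\<^sup>+\<omega>. indicator {\<omega>\<in>space M. X \<omega> \<ge> c} \<omega> \<partial>M)"
    by (rule nn_integral_indicator[symmetric]) (intro X borel_arith)
  also have "\<dots> \<le> (\<integral>\<^sup>+\<omega>. ennreal (exp (- c)) * ennreal (exp (X \<omega>)) \<partial>M)"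
  proof (rule nn_integral_mono)
    fix \<omega>
    have "1 \<le> ennreal (exp (- c)) * ennreal (exp (X \<omega>))" if "X \<omega> \<ge> c"
    proof -
      have "(1::real) \<le> exp (- c) * exp (X \<omega>)" using that by (simp add: exp_add[symmetric])
      then have "ennreal 1 \<le> ennreal (exp (- c) * exp (X \<omega>))" by (rule ennreal_leI)
      then show ?thesis by (simp add: ennreal_mult')
    qed
    then show "indicator {\<omega>\<in>space M. X \<omega> \<ge> c} \<omega> \<le> ennreal (exp (- c)) * ennreal (exp (X \<omega>))"
      by (auto simp: indicator_def)
  qed
  also have "\<dots> = ennreal (exp (- c)) * (\<integral>\<^sup>+\<omega>. ennreal (exp (X \<omega>)) \<partial>M)"
    by (rule nn_integral_cmult) (intro meas_exp X)
  also have "\<dots> \<le> ennreal (exp (- c)) * ennreal K" by (intro mult_left_mono int) simp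
  also have "\<dots> = ennreal (K * exp (- c))" using K by (simp add: ennreal_mult mult.commute)
  finally show ?thesis using K by (simp add: emeasure_eq_measure ennreal_le_iff)
qed

lemma chernoff_two_sided:
  fixes X :: "'a \<Rightarrow> real"
  assumes M: "prob_space M" and X: "X \<in> borel_measurable M" and K: "K \<ge> 0"
    and int: "(\<integral>\<^sup>+\<omega>. ennreal (exp (X \<omega>)) \<partial>M) \<le> ennreal K" "(\<integral>\<^sup>+\<omega>. ennreal (exp (- X \<omega>)) \<partial>M) \<le> ennreal K"
  shows "measure M {\<omega>\<in>space M. \<bar>X \<omega>\<bar> \<ge> c} \<le> 2 * K * exp (- c)"
proof -
  interpret prob_space M by fact
  have "{\<omega>\<in>space M. \<bar>X \<omega>\<bar> \<ge> c} = {\<omega>\<in>space M. X \<omega> \<ge> c} \<union> {\<omega>\<in>space M. - X \<omega> \<ge> c}" by auto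
  also have "measure M \<dots> \<le> measure M {\<omega>\<in>space M. X \<omega> \<ge> c} + measure M {\<omega>\<in>space M. - X \<omega> \<ge> c}"
    by (rule measure_Un_le) (intro borel_measurable_uminus X borel_arith)+
  also have "\<dots> \<le> K * exp (- c) + K * exp (- c)"
    by (intro add_mono chernoff_bound M int K X borel_measurable_uminus)
  finally show ?thesis by simp
qed

lemma nn_integral_subset:
  assumes d: "d > 0" and I: "finite I" and J: "J \<subseteq> I" and f: "f \<in> borel_measurable (PG d J)"
    and cong: "\<And>G G'. (\<And>j. j \<in> J \<Longrightarrow> G j = G' j) \<Longrightarrow> f G = f G'"
    and le: "(\<integral>\<^sup>+y. f y \<partial>PG d J) \<le> c"
  shows "(\<integral>\<^sup>+G. f G \<partial>PG d I) \<le> c"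
proof (rule nn_integral_slice_le[OF prob_space_gm[OF d] I J])
  have "(\<lambda>G. f (restrict G J)) \<in> borel_measurable (PG d I)"
    by (rule measurable_compose[OF measurable_restrict_subset[OF J] f])
  moreover have "(\<lambda>G. f (restrict G J)) = f" by (intro ext cong) simp
  ultimately show "f \<in> borel_measurable (PG d I)" by simp
  fix x
  have "f (merge (I - J) J (x, y)) = f y" for y by (rule cong) (simp add: merge_def)
  then show "(\<integral>\<^sup>+y. f (merge (I - J) J (x, y)) \<partial>PG d J) \<le> c" using le by simp
qed

lemma sum_shift_interval: "(\<Sum>j\<in>{\<alpha>..<\<alpha> + m}. f j) = (\<Sum>p<m. f (\<alpha> + p :: nat))"
  by (rule sum.reindex_bij_witness[of _ "\<lambda>p. \<alpha> + p" "\<lambda>j. j - \<alpha>"]) auto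

lemma card_lball:
  assumes m: "0 < m"
  shows "real (card (lball (2 * m) (2 * m))) \<le> exp (40 * m)"
proof -
  have "card {i. i < 2 * m \<and> \<zeta> i \<noteq> 0} \<le> 2 * (2 * m)" for \<zeta> :: "nat \<Rightarrow> int"
    by (rule order_trans[OF card_mono[of "{..<2 * m}"]]) auto
  then have "lball (2 * m) (2 * m) = lsparse (2 * m) (2 * m) (2 * (2 * m))"
    by (auto simp: lsparse_def)
  then show ?thesis using card_lsparse[of "2 * m" "real (2 * m)" "2 * m"] m by simp
qed

locale feature_block =
  fixes d n m \<alpha> \<beta> :: nat
  assumes m0: "0 < m" and ab: "\<alpha> + m \<le> \<beta>" and bd: "\<beta> + m \<le> d"
begin

abbreviation P :: "sample measure" where
  "P \<equiv> PG d ({..<n} \<times> {..<d})"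

definition fa :: "sample \<Rightarrow> nat \<Rightarrow> nat \<Rightarrow> real" where
  "fa G i p = sqrt d * G (i, \<alpha> + p)"

definition fb :: "sample \<Rightarrow> nat \<Rightarrow> nat \<Rightarrow> real" where
  "fb G i p = sqrt d * G (i, \<beta> + p)"

definition Mx :: "sample \<Rightarrow> nat \<Rightarrow> nat \<Rightarrow> real" where
  "Mx G = gram m (fa G) (fb G)"

text \<open>A single lattice point in dimension \<open>2 * m\<close> encodes the pair
  \<open>(u, v)\<close> by its two halves, which matches the net used for the symmetrized
  block.\<close>

definition wx :: "sample \<Rightarrow> (nat \<Rightarrow> int) \<Rightarrow> nat \<Rightarrow> real" where
  "wx G z = pairing m (fa G) (fb G) (lvec (2 * m) z) (\<lambda>q. lvec (2 * m) z (m + q))"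

lemma d0: "0 < d" using m0 bd by simp

lemma prob_space_P: "prob_space P" by (rule prob_space_PG[OF d0])

lemma fa_measurable [measurable]: "i < n \<Longrightarrow> p < m \<Longrightarrow> (\<lambda>G. fa G i p) \<in> borel_measurable P"
  unfolding fa_def using ab bd by (intro meas_coord borel_arith) auto

lemma fb_measurable [measurable]: "i < n \<Longrightarrow> p < m \<Longrightarrow> (\<lambda>G. fb G i p) \<in> borel_measurable P"
  unfolding fb_def using ab bd by (intro meas_coord borel_arith) auto

lemma Mx_measurable: "i < n \<Longrightarrow> j < n \<Longrightarrow> (\<lambda>G. Mx G i j) \<in> borel_measurable P"
  unfolding Mx_def gram_def
  by (intro fa_measurable fb_measurable borel_arith) auto

lemma bil_Mx_measurable: "(\<lambda>G. bil n (Mx G) x y) \<in> borel_measurable P"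
  unfolding bil_def
  by (intro Mx_measurable borel_arith) auto

lemma wx_measurable: "i < n \<Longrightarrow> (\<lambda>G. wx G z i) \<in> borel_measurable P"
  unfolding wx_def pairing_def
  by (intro fa_measurable fb_measurable borel_arith) auto

definition E1 :: "sample set" where
  "E1 = {G \<in> space P. \<forall>i\<in>{..<n}. \<bar>sqn m (fa G i) / m - 1\<bar> \<le> 1 / 10 \<and> \<bar>sqn m (fb G i) / m - 1\<bar> \<le> 1 / 10}"

lemma column_block_tail:
  assumes i: "i < n" and \<gamma>: "\<gamma> + m \<le> d"
  defines "X \<equiv> \<lambda>G :: sample. \<Sum>p<m. (sqrt d * G (i, \<gamma> + p))\<^sup>2 - 1"
  shows "X \<in> borel_measurable P" "measure P {G \<in> space P. \<bar>X G\<bar> \<ge> m / 10} \<le> 2 * exp (- (m / 1600))"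
proof -
  have meas: "(\<lambda>G. G (i, \<gamma> + p)) \<in> borel_measurable P" if "p < m" for p
    using that i \<gamma> by (intro meas_coord) auto
  show X: "X \<in> borel_measurable P"
    unfolding X_def
    by (intro meas borel_arith) simp_all
  define J where "J = (\<lambda>p. (i, \<gamma> + p)) ` {..<m}"
  have inj: "inj_on (\<lambda>p. (i, \<gamma> + p)) {..<m}" by (auto simp: inj_on_def)
  have J: "J \<subseteq> {..<n} \<times> {..<d}" "finite J" "card J = m"
    using i \<gamma> by (auto simp: J_def card_image[OF inj])
  have XJ: "c * X G = (\<Sum>j\<in>J. c * ((sqrt d * G j)\<^sup>2 - 1))" for c :: real and G
    by (simp only: X_def J_def sum.reindex[OF inj] o_def sum_distrib_left)
  have int: "(\<integral>\<^sup>+G. ennreal (exp (c * X G)) \<partial>P) \<le> ennreal (exp (4 * m * c\<^sup>2))" if c: "\<bar>c\<bar> \<le> 1 / 4" for c :: real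
  proof (rule nn_integral_subset[OF d0 _ J(1)])
    show "(\<lambda>G. ennreal (exp (c * X G))) \<in> borel_measurable (PG d J)"
      unfolding XJ
      by (intro meas_exp meas_coord borel_arith)
    show "ennreal (exp (c * X G)) = ennreal (exp (c * X G'))" if "\<And>j. j \<in> J \<Longrightarrow> G j = G' j" for G G'
      unfolding XJ using that by simp
    show "(\<integral>\<^sup>+G. ennreal (exp (c * X G)) \<partial>PG d J) \<le> ennreal (exp (4 * m * c\<^sup>2))"
      unfolding XJ using PG_exp_centered_squares[OF d0 J(2), of "\<lambda>_. c"] c J(3) by (simp add: mult.assoc)
  qed simp
  \<comment> \<open>The parameter 1/80 minimizes \<open>4 * m * c^2 - c * m / 10\<close>; the
    minimum is \<open>- m / 1600\<close>.\<close>
  have "{G \<in> space P. \<bar>X G\<bar> \<ge> m / 10} = {G \<in> space P. \<bar>1 / 80 * X G\<bar> \<ge> 1 / 80 * (m / 10)}"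
    by (auto simp: abs_mult)
  also have "measure P \<dots> \<le> 2 * exp (4 * m * (1 / 80)\<^sup>2) * exp (- (1 / 80 * (m / 10)))"
    using int[of "1 / 80"] int[of "- 1 / 80"]
    by (intro chernoff_two_sided prob_space_P X borel_arith) simp_all
  also have "\<dots> = 2 * exp (- (m / 1600))"
    by (simp add: exp_add[symmetric] power2_eq_square)
  finally show "measure P {G \<in> space P. \<bar>X G\<bar> \<ge> m / 10} \<le> 2 * exp (- (m / 1600))" .
qed

lemma sqn_fa_eq: "sqn m (fa G i) / m - 1 = (\<Sum>p<m. (sqrt d * G (i, \<alpha> + p))\<^sup>2 - 1) / m"
  using m0 by (simp add: sqn_def fa_def sum_subtractf diff_divide_distrib)

lemma sqn_fb_eq: "sqn m (fb G i) / m - 1 = (\<Sum>p<m. (sqrt d * G (i, \<beta> + p))\<^sup>2 - 1) / m"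
  using m0 by (simp add: sqn_def fb_def sum_subtractf diff_divide_distrib)

lemma E1_sets: "E1 \<in> sets P"
  unfolding E1_def sqn_def
  by (intro sets.sets_Collect_finite_All sets.sets_Collect_conj fa_measurable fb_measurable borel_arith) auto

lemma E1_prob: "measure P (space P - E1) \<le> 4 * n * exp (- (m / 1600))"
proof -
  interpret prob_space P by (rule prob_space_P)
  define B where "B = (\<lambda>\<gamma> i. {G \<in> space P. \<bar>\<Sum>p<m. (sqrt d * G (i, \<gamma> + p))\<^sup>2 - 1\<bar> \<ge> m / 10})"
  have le: "\<alpha> + m \<le> d" "\<beta> + m \<le> d" using ab bd by auto
  have Bs: "B \<gamma> i \<in> sets P" if "i < n" "\<gamma> + m \<le> d" for \<gamma> i
    unfolding B_def
    by (intro column_block_tail(1)[OF that] borel_arith)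
  have aux: "real m / 10 \<le> \<bar>y\<bar>" if "\<not> \<bar>y / m\<bar> \<le> 1 / 10" for y :: real
    using that m0 by (simp add: abs_divide pos_divide_le_eq)
  have "space P - E1 \<subseteq> (\<Union>i\<in>{..<n}. B \<alpha> i \<union> B \<beta> i)"
  proof
    fix G assume G: "G \<in> space P - E1"
    then obtain i where i: "i < n" "\<not> \<bar>sqn m (fa G i) / m - 1\<bar> \<le> 1 / 10 \<or> \<not> \<bar>sqn m (fb G i) / m - 1\<bar> \<le> 1 / 10"
      unfolding E1_def by blast
    then have "G \<in> B \<alpha> i \<union> B \<beta> i"
      unfolding sqn_fa_eq sqn_fb_eq B_def using aux G by blast
    with i show "G \<in> (\<Union>i\<in>{..<n}. B \<alpha> i \<union> B \<beta> i)" by blast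
  qed
  then have "measure P (space P - E1) \<le> measure P (\<Union>i\<in>{..<n}. B \<alpha> i \<union> B \<beta> i)"
    using Bs le by (intro finite_measure_mono sets.finite_UN sets.Un) auto
  also have "\<dots> \<le> (\<Sum>i<n. measure P (B \<alpha> i \<union> B \<beta> i))"
    using Bs le by (intro measure_UNION_le sets.Un) auto
  also have "\<dots> \<le> (\<Sum>i<n. 4 * exp (- (m / 1600)))"
  proof (rule sum_mono)
    fix i assume "i \<in> {..<n}"
    then have i: "i < n" by simp
    have "measure P (B \<alpha> i \<union> B \<beta> i) \<le> measure P (B \<alpha> i) + measure P (B \<beta> i)"
      using Bs i le by (intro measure_Un_le) auto
    also have "\<dots> \<le> 4 * exp (- (m / 1600))"
      using column_block_tail(2)[OF i le(1)] column_block_tail(2)[OF i le(2)] by (simp add: B_def)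
    finally show "measure P (B \<alpha> i \<union> B \<beta> i) \<le> 4 * exp (- (m / 1600))" .
  qed
  finally show ?thesis by simp
qed

section \<open>Cross terms of \<open>M\<close> between sparse and flat vectors\<close>

lemma bilinear_row_mgf:
  assumes Z: "(\<Sum>p<m. \<Sum>q<m. (Z p q)\<^sup>2) = 1" and l: "l\<^sup>2 \<le> 1 / 2"
  shows "(\<integral>\<^sup>+r. ennreal (exp (l * (\<Sum>p<m. \<Sum>q<m. Z p q * (sqrt d * r (\<alpha> + p)) * (sqrt d * r (\<beta> + q))))) \<partial>PG d {..<d})
    \<le> ennreal (exp (l\<^sup>2))"
proof -
  have "(\<integral>\<^sup>+r. ennreal (exp (l * (\<Sum>p\<in>{\<alpha>..<\<alpha> + m}. \<Sum>q\<in>{\<beta>..<\<beta> + m}. Z (p - \<alpha>) (q - \<beta>) * (sqrt d * r p) * (sqrt d * r q)))) \<partial>PG d {..<d})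
    \<le> ennreal (exp (l\<^sup>2))"
  proof (rule PG_exp_bilinear[OF d0 _ _ _ _ _ l])
    show "{\<alpha>..<\<alpha> + m} \<inter> {\<beta>..<\<beta> + m} = {}" "{\<alpha>..<\<alpha> + m} \<subseteq> {..<d}" "{\<beta>..<\<beta> + m} \<subseteq> {..<d}"
      using ab bd by auto
    show "(\<Sum>p\<in>{\<alpha>..<\<alpha> + m}. \<Sum>q\<in>{\<beta>..<\<beta> + m}. (Z (p - \<alpha>) (q - \<beta>))\<^sup>2) = 1"
      using Z by (simp add: sum_shift_interval)
  qed simp
  then show ?thesis by (simp only: sum_shift_interval diff_add_inverse)
qed

lemma pair_mgf:
  assumes xy: "\<And>i. i < n \<Longrightarrow> x i = 0 \<or> y i = 0" and y: "\<And>i. i < n \<Longrightarrow> (y i)\<^sup>2 \<le> 1 / k" "sqn n y \<le> 1"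
    and k: "k > 0" and l: "l\<^sup>2 = (real m)\<^sup>2 * (k / 2)"
  shows "(\<integral>\<^sup>+G. ennreal (exp (l * (bil n (Mx G) x y / sqrt (bil n (Mx G) x x)))) \<partial>P) \<le> ennreal (exp (k / 2))"
proof -
  define T where "T = {i. i < n \<and> y i \<noteq> 0}"
  define I where "I = {..<n} \<times> {..<d}"
  define J where "J = T \<times> {..<d}"
  have T: "finite T" "T \<subseteq> {..<n}" by (auto simp: T_def)
  have J: "J \<subseteq> I" using T by (auto simp: I_def J_def)
  have col: "\<alpha> + p < d" "\<beta> + p < d" if "p < m" for p using that ab bd by auto
  have "(\<integral>\<^sup>+G. ennreal (exp (l * (bil n (Mx G) x y / sqrt (bil n (Mx G) x x)))) \<partial>PG d I) \<le> ennreal (exp (k / 2))"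
  proof (rule nn_integral_slice_le[OF prob_space_gm[OF d0] _ J])
    show "(\<lambda>G. ennreal (exp (l * (bil n (Mx G) x y / sqrt (bil n (Mx G) x x))))) \<in> borel_measurable (PG d I)"
      unfolding I_def
      by (intro meas_exp measurable_compose[OF _ borel_measurable_sqrt] bil_Mx_measurable borel_arith)
    fix \<omega> :: sample
    define g where "g = (\<lambda>\<tau>. merge (I - J) J (\<omega>, \<tau>))"
    have g: "merge (I - J) J (\<omega>, \<tau>) = g \<tau>" for \<tau> by (simp add: g_def)
    define B where "B = tensor n m (fa \<omega>) (fb \<omega>) x"
    define F where "F = (\<Sum>p<m. \<Sum>q<m. (B p q)\<^sup>2)"
    have tens: "tensor n m (fa (g \<tau>)) (fb (g \<tau>)) x p q = B p q" if "p < m" "q < m" for \<tau> p q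
    proof -
      have "x i * fa (g \<tau>) i p * fb (g \<tau>) i q = x i * fa \<omega> i p * fb \<omega> i q" if i: "i < n" for i
      proof (cases "i \<in> T")
        case True
        then have "x i = 0" using xy[OF i] by (auto simp: T_def)
        then show ?thesis by simp
      next
        case False
        then show ?thesis using i col[OF \<open>p < m\<close>] col[OF \<open>q < m\<close>]
          by (simp add: fa_def fb_def g_def merge_def I_def J_def)
      qed
      then have "(\<Sum>i<n. x i * fa (g \<tau>) i p * fb (g \<tau>) i q) = (\<Sum>i<n. x i * fa \<omega> i p * fb \<omega> i q)"
        by (intro sum.cong refl) simp
      then show ?thesis by (simp add: tensor_def B_def)
    qed
    have xx: "bil n (Mx (g \<tau>)) x x = F" for \<tau>
      unfolding Mx_def bil_gram F_def power2_eq_square by (intro sum.cong refl) (simp add: tens)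
    have xy_eq: "bil n (Mx (g \<tau>)) x y = (\<Sum>i\<in>T. y i / m * (\<Sum>p<m. \<Sum>q<m. B p q * (sqrt d * \<tau> (i, \<alpha> + p)) * (sqrt d * \<tau> (i, \<beta> + q))))" for \<tau>
    proof -
      have "bil n (Mx (g \<tau>)) x y = (\<Sum>p<m. \<Sum>q<m. B p q * tensor n m (fa (g \<tau>)) (fb (g \<tau>)) y p q)"
        unfolding Mx_def bil_gram by (intro sum.cong refl) (simp add: tens)
      also have "\<dots> = (\<Sum>p<m. \<Sum>q<m. \<Sum>i<n. y i / m * (B p q * fa (g \<tau>) i p * fb (g \<tau>) i q))"
        by (simp add: tensor_def sum_distrib_left sum_divide_distrib mult_ac)
      also have "\<dots> = (\<Sum>i<n. \<Sum>p<m. \<Sum>q<m. y i / m * (B p q * fa (g \<tau>) i p * fb (g \<tau>) i q))"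
        by (simp only: sum.swap[where A = "{..<m}" and B = "{..<n}"])
      also have "\<dots> = (\<Sum>i\<in>T. \<Sum>p<m. \<Sum>q<m. y i / m * (B p q * fa (g \<tau>) i p * fb (g \<tau>) i q))"
        by (rule sum.mono_neutral_right) (auto simp: T_def)
      also have "\<dots> = (\<Sum>i\<in>T. \<Sum>p<m. \<Sum>q<m. y i / m * (B p q * (sqrt d * \<tau> (i, \<alpha> + p)) * (sqrt d * \<tau> (i, \<beta> + q))))"
      proof (intro sum.cong refl)
        fix i p q assume "i \<in> T" "p \<in> {..<m}" "q \<in> {..<m}"
        then show "y i / m * (B p q * fa (g \<tau>) i p * fb (g \<tau>) i q)
           = y i / m * (B p q * (sqrt d * \<tau> (i, \<alpha> + p)) * (sqrt d * \<tau> (i, \<beta> + q)))"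
          using col[of p] col[of q] by (simp add: fa_def fb_def g_def merge_def J_def)
      qed
      finally show ?thesis by (simp only: sum_distrib_left)
    qed
    show "(\<integral>\<^sup>+\<tau>. ennreal (exp (l * (bil n (Mx (merge (I - J) J (\<omega>, \<tau>))) x y / sqrt (bil n (Mx (merge (I - J) J (\<omega>, \<tau>))) x x)))) \<partial>PG d J)
       \<le> ennreal (exp (k / 2))"
    \<comment> \<open>If \<open>F\<close> vanishes, division by zero yields 0 and the exponent
      disappears.\<close>
    proof (cases "F = 0")
      case True
      interpret prob_space "PG d J" by (rule prob_space_PG[OF d0])
      show ?thesis unfolding g xx True using k by (simp add: emeasure_space_1)
    next
      case False
      then have F: "F > 0" unfolding F_def by (simp add: less_le sum_nonneg)
      define Z where "Z = (\<lambda>p q. B p q / sqrt F)"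
      have Z: "(\<Sum>p<m. \<Sum>q<m. (Z p q)\<^sup>2) = 1"
        using F by (simp add: Z_def power_divide sum_divide_distrib[symmetric] F_def[symmetric])
      define c where "c = (\<lambda>i. l * y i / m)"
      define f where "f = (\<lambda>i r. ennreal (exp (c i * (\<Sum>p<m. \<Sum>q<m. Z p q * (sqrt d * r (\<alpha> + p)) * (sqrt d * r (\<beta> + q))))))"
      have c2: "(c i)\<^sup>2 = k / 2 * (y i)\<^sup>2" for i
        unfolding c_def power_divide power_mult_distrib l using m0 by simp
      have eq: "ennreal (exp (l * (bil n (Mx (g \<tau>)) x y / sqrt (bil n (Mx (g \<tau>)) x x)))) = (\<Prod>i\<in>T. f i (\<lambda>j\<in>{..<d}. \<tau> (i, j)))" for \<tau>
      proof -
        have "l * (bil n (Mx (g \<tau>)) x y / sqrt F) = (\<Sum>i\<in>T. c i * (\<Sum>p<m. \<Sum>q<m. Z p q * (sqrt d * \<tau> (i, \<alpha> + p)) * (sqrt d * \<tau> (i, \<beta> + q))))"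
          unfolding xy_eq by (simp add: c_def Z_def sum_distrib_left sum_divide_distrib mult_ac)
        also have "\<dots> = (\<Sum>i\<in>T. c i * (\<Sum>p<m. \<Sum>q<m. Z p q * (sqrt d * (\<lambda>j\<in>{..<d}. \<tau> (i, j)) (\<alpha> + p)) * (sqrt d * (\<lambda>j\<in>{..<d}. \<tau> (i, j)) (\<beta> + q))))"
          by (intro sum.cong refl arg_cong2[where f = "(*)"]) (simp_all add: col)
        finally show ?thesis using T(1) unfolding xx f_def by (simp add: exp_sum prod_ennreal)
      qed
      have fm: "f i \<in> borel_measurable (PG d {..<d})" for i
        unfolding f_def
        by (intro meas_exp meas_coord borel_arith) (simp_all add: col)
      have "(\<integral>\<^sup>+\<tau>. (\<Prod>i\<in>T. f i (\<lambda>j\<in>{..<d}. \<tau> (i, j))) \<partial>PG d J) = (\<Prod>i\<in>T. \<integral>\<^sup>+r. f i r \<partial>PG d {..<d})"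
        unfolding J_def by (rule nn_integral_rows[OF prob_space_gm[OF d0] T(1)]) (simp_all add: fm)
      also have "\<dots> \<le> (\<Prod>i\<in>T. ennreal (exp ((c i)\<^sup>2)))"
      proof (rule prod_mono_ennreal)
        fix i assume "i \<in> T"
        then have "k / 2 * (y i)\<^sup>2 \<le> k / 2 * (1 / k)" using y(1)[of i] k T by (intro mult_left_mono) auto
        then have "(c i)\<^sup>2 \<le> 1 / 2" using k by (simp add: c2)
        then show "(\<integral>\<^sup>+r. f i r \<partial>PG d {..<d}) \<le> ennreal (exp ((c i)\<^sup>2))"
          unfolding f_def by (rule bilinear_row_mgf[OF Z])
      qed
      also have "\<dots> = ennreal (exp (\<Sum>i\<in>T. (c i)\<^sup>2))"
        using T(1) by (simp add: prod_ennreal exp_sum)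
      also have "\<dots> \<le> ennreal (exp (k / 2))"
      proof -
        have "(\<Sum>i\<in>T. (y i)\<^sup>2) \<le> sqn n y" unfolding sqn_def using T(2) by (intro sum_mono2) auto
        then have "(\<Sum>i\<in>T. (y i)\<^sup>2) \<le> 1" using y(2) by linarith
        from mult_left_mono[OF this, of "k / 2"] show ?thesis
          using k by (intro ennreal_leI) (simp add: c2 sum_distrib_left)
      qed
      finally show ?thesis unfolding g eq .
    qed
  qed (simp add: I_def)
  then show ?thesis by (simp add: I_def)
qed

lemma pair_tail:
  assumes xy: "\<And>i. i < n \<Longrightarrow> x i = 0 \<or> y i = 0" and y: "\<And>i. i < n \<Longrightarrow> (y i)\<^sup>2 \<le> 1 / k" "sqn n y \<le> 1"
    and k: "k > 0" and e: "e \<ge> 0"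
  shows "measure P {G \<in> space P. \<not> \<bar>bil n (Mx G) x y\<bar> \<le> e * sqrt (bil n (Mx G) x x)}
     \<le> 2 * exp (k / 2) * exp (- (m * sqrt (k / 2) * e))"
proof -
  interpret prob_space P by (rule prob_space_P)
  define l where "l = m * sqrt (k / 2)"
  define X where "X = (\<lambda>G. l * (bil n (Mx G) x y / sqrt (bil n (Mx G) x x)))"
  have l0: "l > 0" using m0 k by (simp add: l_def)
  have l2: "l\<^sup>2 = (real m)\<^sup>2 * (k / 2)" "(- l)\<^sup>2 = (real m)\<^sup>2 * (k / 2)" using k by (simp_all add: l_def power_mult_distrib)
  have X: "X \<in> borel_measurable P"
    unfolding X_def by (intro measurable_compose[OF _ borel_measurable_sqrt] bil_Mx_measurable borel_arith)
  have "{G \<in> space P. \<not> \<bar>bil n (Mx G) x y\<bar> \<le> e * sqrt (bil n (Mx G) x x)} \<subseteq> {G \<in> space P. \<bar>X G\<bar> \<ge> l * e}"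
  proof safe
    fix G assume ne: "\<not> \<bar>bil n (Mx G) x y\<bar> \<le> e * sqrt (bil n (Mx G) x x)"
    define B where "B = tensor n m (fa G) (fb G) x"
    have F: "bil n (Mx G) x x = (\<Sum>p<m. \<Sum>q<m. (B p q)\<^sup>2)"
      by (simp add: Mx_def bil_gram B_def power2_eq_square)
    \<comment> \<open>A vanishing form at \<open>x\<close> forces the tensor of \<open>x\<close>,
      and so the cross term, to vanish; the failure event therefore has a positive
      denominator.\<close>
    have "bil n (Mx G) x x \<noteq> 0"
    proof
      assume 0: "bil n (Mx G) x x = 0"
      then have "\<forall>p<m. \<forall>q<m. B p q = 0" unfolding F by (simp add: sum_nonneg_eq_0_iff sum_nonneg)
      then have "bil n (Mx G) x y = 0" by (simp add: Mx_def bil_gram B_def)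
      with ne 0 show False by simp
    qed
    then have "bil n (Mx G) x x > 0" using F by (simp add: less_le sum_nonneg)
    then have s: "sqrt (bil n (Mx G) x x) > 0" by simp
    have "e \<le> \<bar>bil n (Mx G) x y\<bar> / sqrt (bil n (Mx G) x x)" using ne s by (simp add: pos_le_divide_eq)
    from mult_left_mono[OF this, of l] show "l * e \<le> \<bar>X G\<bar>" using l0 s by (simp add: X_def abs_mult abs_divide)
  qed
  then have "measure P {G \<in> space P. \<not> \<bar>bil n (Mx G) x y\<bar> \<le> e * sqrt (bil n (Mx G) x x)}
      \<le> measure P {G \<in> space P. \<bar>X G\<bar> \<ge> l * e}"
    by (intro finite_measure_mono X borel_arith)
  also have "\<dots> \<le> 2 * exp (k / 2) * exp (- (l * e))"
  proof (rule chernoff_two_sided[OF prob_space_P X])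
    show "(\<integral>\<^sup>+G. ennreal (exp (X G)) \<partial>P) \<le> ennreal (exp (k / 2))"
      unfolding X_def by (rule pair_mgf[OF xy y k l2(1)])
    show "(\<integral>\<^sup>+G. ennreal (exp (- X G)) \<partial>P) \<le> ennreal (exp (k / 2))"
      unfolding X_def using pair_mgf[OF xy y k l2(2)] by simp
  qed simp
  finally show ?thesis by (simp add: l_def)
qed

definition admissible :: "real \<Rightarrow> nat \<Rightarrow> (nat \<Rightarrow> int) \<Rightarrow> (nat \<Rightarrow> int) \<Rightarrow> bool" where
  "admissible N l \<xi> \<eta> \<longleftrightarrow> (\<forall>i<n. \<xi> i = 0 \<or> \<eta> i = 0) \<and> (\<forall>i<n. (lvec N \<eta> i)\<^sup>2 \<le> 1 / 2 ^ l)"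

definition pairs :: "real \<Rightarrow> nat \<Rightarrow> ((nat \<Rightarrow> int) \<times> (nat \<Rightarrow> int)) set" where
  "pairs N l = {(\<xi>, \<eta>) \<in> lsparse n N (2 * 2 ^ l) \<times> lsparse n N (2 * 2 ^ l). admissible N l \<xi> \<eta>}"

definition E2 :: "real \<Rightarrow> nat \<Rightarrow> (nat \<Rightarrow> real) \<Rightarrow> sample set" where
  "E2 N L \<epsilon> = {G \<in> space P. \<forall>l\<in>{..L}. \<forall>xy\<in>pairs N l.
     \<bar>bil n (Mx G) (lvec N (fst xy)) (lvec N (snd xy))\<bar>
       \<le> \<epsilon> l * sqrt (bil n (Mx G) (lvec N (fst xy)) (lvec N (fst xy)))}"

lemma finite_pairs: "N \<ge> 0 \<Longrightarrow> finite (pairs N l)"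
  by (rule finite_subset[of _ "lsparse n N (2 * 2 ^ l) \<times> lsparse n N (2 * 2 ^ l)"])
     (auto simp: pairs_def finite_lsparse)

lemma pair_event_sets:
  "{G \<in> space P. \<bar>bil n (Mx G) x y\<bar> \<le> e * sqrt (bil n (Mx G) x x)} \<in> sets P"
  by (intro measurable_compose[OF _ borel_measurable_sqrt] bil_Mx_measurable borel_arith)

lemma pair_event_compl_sets:
  "{G \<in> space P. \<not> \<bar>bil n (Mx G) x y\<bar> \<le> e * sqrt (bil n (Mx G) x x)} \<in> sets P"
  by (intro sets.sets_Collect_neg pair_event_sets)

lemma E2_sets: "N \<ge> 0 \<Longrightarrow> E2 N L \<epsilon> \<in> sets P"
  unfolding E2_def by (intro sets.sets_Collect_finite_All pair_event_sets finite_pairs) auto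

text \<open>At level \<open>k = 2 ^ l\<close> a deviation of order
  \<open>sqrt k * ln (N / k) / m\<close> would beat the entropy of sparse pairs. The logarithm is
  relaxed to \<open>u = (N / k) powr (1 / 4)\<close>: then \<open>sqrt k * u\<close> is the fourth
  root of \<open>N * k\<close>, which still sums geometrically over dyadic \<open>k\<close> to order
  \<open>sqrt N\<close>.\<close>

lemma E2_prob:
  assumes N: "real n \<le> N" "2 ^ L \<le> N"
    and \<epsilon>: "\<And>l. \<epsilon> l = 200 * (N powr (1 / 4) * (2 ^ l) powr (1 / 4)) / m"
  shows "measure P (space P - E2 N L \<epsilon>) \<le> 2 * (N + 1) * exp (- (90 * N powr (1 / 4)))" (is "_ \<le> _ * ?e")
proof -
  interpret prob_space P by (rule prob_space_P)
  have N1: "N \<ge> 1" using N(2) one_le_power[of "2::real" L] by linarith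
  have \<epsilon>0: "\<epsilon> l \<ge> 0" for l unfolding \<epsilon> by simp
  define B where "B = (\<lambda>l xy. {G \<in> space P. \<not> \<bar>bil n (Mx G) (lvec N (fst xy)) (lvec N (snd xy))\<bar>
       \<le> \<epsilon> l * sqrt (bil n (Mx G) (lvec N (fst xy)) (lvec N (fst xy)))})"
  have Bs: "B l xy \<in> sets P" for l xy unfolding B_def by (rule pair_event_compl_sets)
  have fin: "finite (pairs N l)" for l using N1 by (intro finite_pairs) simp
  have level: "measure P (\<Union>xy\<in>pairs N l. B l xy) \<le> 2 * ?e" if l: "l \<le> L" for l
  proof -
    define k where "k = (2::real) ^ l"
    define u where "u = (N / k) powr (1 / 4)"
    have k1: "k \<ge> 1" by (simp add: k_def)
    have kN: "k \<le> N"
      using power_increasing[OF l, of "2::real"] N(2) unfolding k_def by linarith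
    have u1: "u \<ge> 1" unfolding u_def using k1 kN by (intro ge_one_powr_ge_zero) (auto simp: divide_simps)
    have ln_u: "ln (N / k) = 4 * ln u" unfolding u_def using k1 kN by (simp add: ln_powr)
    have ln_le: "ln u \<le> u - 1" using ln_le_minus_one[of u] u1 by simp
    have Nu: "N powr (1 / 4) = k powr (1 / 4) * u"
      unfolding u_def using k1 kN by (simp add: powr_mult[symmetric])
    have k14: "k powr (1 / 4) * k powr (1 / 4) = sqrt k"
      using k1 by (simp add: powr_add[symmetric] powr_half_sqrt)
    \<comment> \<open>The level \<open>k = 1\<close> is the weakest; this gives all levels a common
      failure bound.\<close>
    have ku: "N powr (1 / 4) \<le> k * u"
    proof -
      have "k powr (1 / 4) \<le> k powr 1" using k1 by (intro powr_mono) auto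
      then show ?thesis unfolding Nu using k1 u1 by (intro mult_right_mono) auto
    qed
    have tail: "measure P (B l xy) \<le> 2 * exp (k / 2) * exp (- (140 * k * u))" if "xy \<in> pairs N l" for xy
    proof -
      have xy: "fst xy \<in> lball n N" "snd xy \<in> lball n N" "admissible N l (fst xy) (snd xy)"
        using that by (auto simp: pairs_def lsparse_def)
      have "measure P (B l xy) \<le> 2 * exp (k / 2) * exp (- (m * sqrt (k / 2) * \<epsilon> l))"
        unfolding B_def
      proof (rule pair_tail)
        show "lvec N (fst xy) i = 0 \<or> lvec N (snd xy) i = 0" if "i < n" for i
          using xy(3) that by (auto simp: admissible_def lvec_def)
        show "(lvec N (snd xy) i)\<^sup>2 \<le> 1 / k" if "i < n" for i
          using xy(3) that by (auto simp: admissible_def k_def)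
        show "sqn n (lvec N (snd xy)) \<le> 1" using N1 xy(2) by (intro sqn_lvec_le_1) auto
      qed (use k1 \<epsilon>0 in auto)
      moreover have "140 * k * u \<le> m * sqrt (k / 2) * \<epsilon> l"
      proof -
        have "m * sqrt (k / 2) * \<epsilon> l = 200 / sqrt 2 * (sqrt k * (k powr (1 / 4) * k powr (1 / 4)) * u)"
          unfolding \<epsilon> using m0 by (simp add: k_def[symmetric] Nu real_sqrt_divide)
        also have "\<dots> = 200 / sqrt 2 * (k * u)" unfolding k14 using k1 by simp
        also have "\<dots> \<ge> 140 * (k * u)"
        proof (rule mult_right_mono)
          have "sqrt 2 \<le> (10 / 7 :: real)" by (rule real_le_lsqrt) (auto simp: power2_eq_square)
          then show "140 \<le> 200 / sqrt (2::real)" by (simp add: pos_le_divide_eq)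
        qed (use k1 u1 in auto)
        finally show ?thesis by simp
      qed
      ultimately show ?thesis
        by (elim order_trans) (auto intro!: mult_left_mono)
    qed
    have card: "real (card (pairs N l)) \<le> exp (40 * k + 32 * k * (u - 1))"
    proof -
      have "card (pairs N l) \<le> card (lsparse n N (2 * 2 ^ l) \<times> lsparse n N (2 * 2 ^ l))"
        using N1 by (intro card_mono finite_cartesian_product finite_lsparse) (auto simp: pairs_def)
      also have "\<dots> = (card (lsparse n N (2 * 2 ^ l)))\<^sup>2" by (simp add: card_cartesian_product power2_eq_square)
      finally have "real (card (pairs N l)) \<le> (real (card (lsparse n N (2 * 2 ^ l))))\<^sup>2"
        by (metis of_nat_le_iff of_nat_power)
      also have "\<dots> \<le> (exp (20 * k + 4 * k * ln (N / k)))\<^sup>2"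
        using card_lsparse[of "2 ^ l" N n] N kN by (intro power_mono) (auto simp: k_def)
      also have "\<dots> = exp (40 * k + 32 * (k * ln u))"
        unfolding ln_u by (simp add: power2_eq_square exp_add[symmetric])
      also have "\<dots> \<le> exp (40 * k + 32 * k * (u - 1))"
        using mult_left_mono[OF ln_le, of k] k1 by simp
      finally show ?thesis .
    qed
    have "measure P (\<Union>xy\<in>pairs N l. B l xy) \<le> (\<Sum>xy\<in>pairs N l. measure P (B l xy))"
      by (intro measure_UNION_le fin Bs)
    also have "\<dots> \<le> (\<Sum>xy\<in>pairs N l. 2 * exp (k / 2) * exp (- (140 * k * u)))"
      by (intro sum_mono tail)
    also have "\<dots> = real (card (pairs N l)) * (2 * exp (k / 2) * exp (- (140 * k * u)))" by simp
    also have "\<dots> \<le> exp (40 * k + 32 * k * (u - 1)) * (2 * exp (k / 2) * exp (- (140 * k * u)))"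
      by (intro mult_right_mono card) simp
    \<comment> \<open>The coefficients are \<open>40 - 32 + 1/2 = 17/2\<close> for \<open>k\<close>
      and \<open>32 - 140 = - 108\<close> for \<open>k * u\<close>.\<close>
    also have "\<dots> = 2 * exp (17 / 2 * k - 108 * (k * u))"
      by (simp add: exp_add[symmetric] exp_diff field_simps)
    also have "\<dots> \<le> 2 * ?e"
    proof -
      have "k * 1 \<le> k * u" using k1 u1 by (intro mult_left_mono) auto
      moreover have "N powr (1 / 4) \<ge> 0" by simp
      ultimately have "17 / 2 * k - 108 * (k * u) \<le> - (90 * N powr (1 / 4))" using ku by linarith
      then show ?thesis by simp
    qed
    finally show ?thesis .
  qed
  have "space P - E2 N L \<epsilon> \<subseteq> (\<Union>l\<in>{..L}. \<Union>xy\<in>pairs N l. B l xy)"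
    unfolding E2_def B_def by blast
  then have "measure P (space P - E2 N L \<epsilon>) \<le> measure P (\<Union>l\<in>{..L}. \<Union>xy\<in>pairs N l. B l xy)"
    by (intro finite_measure_mono sets.finite_UN fin Bs) auto
  also have "\<dots> \<le> (\<Sum>l\<in>{..L}. measure P (\<Union>xy\<in>pairs N l. B l xy))"
    by (intro measure_UNION_le sets.finite_UN fin Bs) auto
  also have "\<dots> \<le> (\<Sum>l\<in>{..L}. 2 * ?e)"
    by (intro sum_mono level) simp
  also have "\<dots> = 2 * (real L + 1) * ?e" by simp
  also have "\<dots> \<le> 2 * (N + 1) * ?e"
  proof -
    have "real L \<le> 2 ^ L" using of_nat_less_two_power[of L, where 'a = real] by simp
    then have "real L \<le> N" using N(2) by linarith
    then show ?thesis by (intro mult_right_mono mult_left_mono) auto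
  qed
  finally show ?thesis .
qed

section \<open>Small entries of the pairings, uniformly over the net\<close>

definition E3 :: "real \<Rightarrow> real \<Rightarrow> sample set" where
  "E3 r e = {G \<in> space P. \<forall>z\<in>lball (2 * m) (2 * m).
     (\<Sum>i<n. if \<bar>wx G z i\<bar> \<le> r then (wx G z i)\<^sup>2 else 0) \<le> e}"

lemma truncated_measurable:
  "i < n \<Longrightarrow> (\<lambda>G. if \<bar>wx G z i\<bar> \<le> r then (wx G z i)\<^sup>2 else 0) \<in> borel_measurable P"
  by (intro measurable_If wx_measurable borel_arith)

lemma truncated_sum_measurable:
  "(\<lambda>G. \<Sum>i<n. if \<bar>wx G z i\<bar> \<le> r then (wx G z i)\<^sup>2 else 0) \<in> borel_measurable P"
  by (intro borel_measurable_sum truncated_measurable) simp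

lemma E3_sets: "E3 r e \<in> sets P"
  unfolding E3_def
  by (intro sets.sets_Collect_finite_All finite_lball truncated_sum_measurable borel_arith) auto

lemma sqn_double: "sqn m (\<lambda>i. z i) + sqn m (\<lambda>i. z (m + i)) = sqn (2 * m) z"
proof -
  have "sqn (2 * m) z = (\<Sum>i\<in>{..<m} \<union> {m..<m + m}. (z i)\<^sup>2)"
    unfolding sqn_def by (intro sum.cong refl) auto
  also have "\<dots> = (\<Sum>i<m. (z i)\<^sup>2) + (\<Sum>i\<in>{m..<m + m}. (z i)\<^sup>2)"
    by (intro sum.union_disjoint) auto
  finally show ?thesis by (simp add: sqn_def sum_shift_interval)
qed

lemma lattice_halves:
  assumes "z \<in> lball (2 * m) (2 * m)"
  shows "sqn m (lvec (2 * m) z) \<le> 1" "sqn m (\<lambda>q. lvec (2 * m) z (m + q)) \<le> 1"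
    and "sqn m (lvec (2 * m) z) + sqn m (\<lambda>q. lvec (2 * m) z (m + q)) \<le> 1"
proof -
  have "sqn (2 * m) (lvec (2 * m) z) \<le> 1"
    using sqn_lvec_le_1[OF _ assms] m0 by simp
  then show *: "sqn m (lvec (2 * m) z) + sqn m (\<lambda>q. lvec (2 * m) z (m + q)) \<le> 1"
    using sqn_double[of "lvec (2 * m) z"] by simp
  show "sqn m (lvec (2 * m) z) \<le> 1"
    using * sqn_nonneg[of m "\<lambda>q. lvec (2 * m) z (m + q)"] by linarith
  show "sqn m (\<lambda>q. lvec (2 * m) z (m + q)) \<le> 1"
    using * sqn_nonneg[of m "lvec (2 * m) z"] by linarith
qed

text \<open>Rows are independent, so the truncated moment bound is raised to the power
  \<open>n\<close>. Its exponent \<open>400 K n / m\<close> is of order \<open>m\<close> when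
  \<open>n\<close> is of order \<open>m^2\<close>, hence comparable to the entropy
  \<open>40 m\<close> of the net, and \<open>K m e\<close> can beat both.\<close>

lemma E3_prob:
  fixes K r e :: real
  assumes K: "K \<ge> 0" "8 * K * r \<le> 1"
  shows "measure P (space P - E3 r e) \<le> exp (40 * m) * (exp (400 * K * n / m) * exp (- (K * m * e)))"
proof -
  interpret prob_space P by (rule prob_space_P)
  let ?Z = "lball (2 * m) (2 * m)"
  define s where "s = (\<lambda>z G. \<Sum>i<n. if \<bar>wx G z i\<bar> \<le> r then (wx G z i)\<^sup>2 else 0)"
  define B where "B = (\<lambda>z. {G \<in> space P. K * m * s z G \<ge> K * m * e})"
  have sm: "s z \<in> borel_measurable P" for z unfolding s_def by (rule truncated_sum_measurable)
  have Xm: "(\<lambda>G. K * m * s z G) \<in> borel_measurable P" for z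
    by (intro sm borel_arith)
  have Bs: "B z \<in> sets P" for z
    unfolding B_def by (intro Xm borel_arith)
  have fin: "finite ?Z" by (rule finite_lball) simp
  have tail: "measure P (B z) \<le> exp (400 * K * n / m) * exp (- (K * m * e))" if z: "z \<in> ?Z" for z
    unfolding B_def
  proof (rule chernoff_bound[OF prob_space_P Xm])
    define u where "u = lvec (2 * m) z"
    define v where "v = (\<lambda>q. lvec (2 * m) z (m + q))"
    \<comment> \<open>The two halves are extended by zero to coefficient vectors on a whole row, the
      setting of the truncated moment bound.\<close>
    define c where "c = (\<lambda>j. if j \<in> {\<alpha>..<\<alpha> + m} then u (j - \<alpha>) else 0)"
    define c' where "c' = (\<lambda>j. if j \<in> {\<beta>..<\<beta> + m} then v (j - \<beta>) else 0)"
    have shift: "(\<Sum>j<d. f (if j \<in> {\<gamma>..<\<gamma> + m} then g (j - \<gamma>) else 0) j) = (\<Sum>p<m. f (g p) (\<gamma> + p))"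
      if \<gamma>: "\<gamma> + m \<le> d" and f0: "\<And>j. f 0 j = 0" for \<gamma> and g :: "nat \<Rightarrow> real" and f :: "real \<Rightarrow> nat \<Rightarrow> real"
    proof -
      have "(\<Sum>j<d. f (if j \<in> {\<gamma>..<\<gamma> + m} then g (j - \<gamma>) else 0) j) = (\<Sum>j\<in>{\<gamma>..<\<gamma> + m}. f (g (j - \<gamma>)) j)"
        using \<gamma> f0 by (intro sum.mono_neutral_cong_right) auto
      then show ?thesis by (simp add: sum_shift_interval)
    qed
    have le: "\<alpha> + m \<le> d" "\<beta> + m \<le> d" using ab bd by auto
    have c: "(\<Sum>j<d. (c j)\<^sup>2) \<le> 1" "(\<Sum>j<d. (c' j)\<^sup>2) \<le> 1"
      unfolding c_def c'_def using lattice_halves(1,2)[OF z] shift[OF le(1), of "\<lambda>x _. x\<^sup>2" u] shift[OF le(2), of "\<lambda>x _. x\<^sup>2" v]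
      by (simp_all add: sqn_def u_def v_def)
    define w where "w = (\<lambda>r :: nat \<Rightarrow> real. (\<Sum>j<d. c j * (sqrt d * r j)) * (\<Sum>j<d. c' j * (sqrt d * r j)) / m)"
    have wx: "wx G z i = w (\<lambda>j\<in>{..<d}. G (i, j))" for G i
    proof -
      have "(\<Sum>j<d. c j * (sqrt d * (\<lambda>j\<in>{..<d}. G (i, j)) j)) = (\<Sum>p<m. u p * fa G i p)"
        using shift[OF le(1), of "\<lambda>x j. x * (sqrt d * G (i, j))" u] by (simp add: c_def fa_def)
      moreover have "(\<Sum>j<d. c' j * (sqrt d * (\<lambda>j\<in>{..<d}. G (i, j)) j)) = (\<Sum>p<m. v p * fb G i p)"
        using shift[OF le(2), of "\<lambda>x j. x * (sqrt d * G (i, j))" v] by (simp add: c'_def fb_def)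
      ultimately show ?thesis by (simp add: w_def wx_def pairing_def u_def v_def)
    qed
    define f where "f = (\<lambda>(i::nat) q. ennreal (exp (K * m * (if \<bar>w q\<bar> \<le> r then (w q)\<^sup>2 else 0))))"
    have wm: "w \<in> borel_measurable (PG d {..<d})"
      unfolding w_def by (intro meas_coord borel_arith) auto
    have fm: "f i \<in> borel_measurable (PG d {..<d})" for i
      unfolding f_def
      by (intro meas_exp measurable_If wm borel_arith)
    have "(\<integral>\<^sup>+G. ennreal (exp (K * m * s z G)) \<partial>P) = (\<integral>\<^sup>+G. (\<Prod>i\<in>{..<n}. f i (\<lambda>j\<in>{..<d}. G (i, j))) \<partial>P)"
      unfolding s_def wx f_def by (simp add: exp_sum sum_distrib_left prod_ennreal)
    also have "\<dots> = (\<Prod>i\<in>{..<n}. \<integral>\<^sup>+q. f i q \<partial>PG d {..<d})"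
      by (rule nn_integral_rows[OF prob_space_gm[OF d0]]) (simp_all add: fm)
    also have "\<dots> \<le> (\<Prod>i\<in>{..<n}. ennreal (exp (400 * K / m)))"
      unfolding f_def w_def using m0 K by (intro prod_mono_ennreal PG_exp_truncated_product[OF d0 _ c]) auto
    also have "\<dots> = ennreal (exp (400 * K * n / m))"
      by (simp add: ennreal_power exp_of_nat_mult[symmetric] mult_ac)
    finally show "(\<integral>\<^sup>+G. ennreal (exp (K * m * s z G)) \<partial>P) \<le> ennreal (exp (400 * K * n / m))" .
  qed simp
  have "space P - E3 r e \<subseteq> (\<Union>z\<in>?Z. B z)"
  proof
    fix G assume "G \<in> space P - E3 r e"
    then obtain z where z: "z \<in> ?Z" "G \<in> space P" "\<not> s z G \<le> e" unfolding E3_def s_def by blast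
    then have "K * m * e \<le> K * m * s z G" using K by (intro mult_left_mono) auto
    with z show "G \<in> (\<Union>z\<in>?Z. B z)" by (auto simp: B_def)
  qed
  then have "measure P (space P - E3 r e) \<le> measure P (\<Union>z\<in>?Z. B z)"
    by (intro finite_measure_mono sets.finite_UN fin Bs)
  also have "\<dots> \<le> (\<Sum>z\<in>?Z. measure P (B z))" by (intro measure_UNION_le fin Bs)
  also have "\<dots> \<le> (\<Sum>z\<in>?Z. exp (400 * K * n / m) * exp (- (K * m * e)))" by (intro sum_mono tail)
  also have "\<dots> = real (card ?Z) * (exp (400 * K * n / m) * exp (- (K * m * e)))" by simp
  also have "\<dots> \<le> exp (40 * m) * (exp (400 * K * n / m) * exp (- (K * m * e)))"
    using card_lball[OF m0] by (intro mult_right_mono) simp_all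
  finally show ?thesis .
qed

end

section \<open>Solving for the coefficients\<close>

text \<open>Moves the inverse from the target to the test vector. The right-hand side is linear in
  \<open>t\<close>, with a coefficient vector that does not involve \<open>t\<close>, as
  conditioning requires.\<close>

lemma solve_adjoint:
  assumes sym: "\<And>i j. M i j = M j i"
    and d: "\<And>i. i < n \<Longrightarrow> (\<Sum>j<n. M i j * \<delta> j) = t i"
    and v: "\<And>i. i < n \<Longrightarrow> (\<Sum>j<n. M i j * v j) = w i"
  shows "(\<Sum>i<n. \<delta> i * w i) = (\<Sum>i<n. t i * (v i :: real))"
proof -
  have "(\<Sum>i<n. \<delta> i * w i) = (\<Sum>i<n. \<delta> i * (\<Sum>j<n. M i j * v j))"
    by (intro sum.cong refl) (simp add: v)
  also have "\<dots> = (\<Sum>i<n. \<Sum>j<n. M j i * \<delta> i * v j)"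
    by (simp add: sum_distrib_left mult_ac) (simp add: sym)
  also have "\<dots> = (\<Sum>j<n. \<Sum>i<n. M j i * \<delta> i * v j)" by (rule sum.swap)
  also have "\<dots> = (\<Sum>j<n. t j * v j)"
    by (intro sum.cong refl) (simp add: sum_distrib_right[symmetric] d)
  finally show ?thesis .
qed

definition near_id :: "nat \<Rightarrow> (nat \<Rightarrow> nat \<Rightarrow> real) \<Rightarrow> bool" where
  "near_id n M \<longleftrightarrow> (\<forall>x y. \<bar>bil n (\<lambda>i j. (if i = j then 1 else 0) - M i j) x y\<bar> \<le> 1 / 2 * sqrt (sqn n x) * sqrt (sqn n y))"

lemma near_id_cong:
  assumes "\<And>i j. i < n \<Longrightarrow> j < n \<Longrightarrow> M i j = M' i j"
  shows "near_id n M \<longleftrightarrow> near_id n M'"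
proof -
  have "bil n (\<lambda>i j. (if i = j then 1 else 0) - M i j) x y = bil n (\<lambda>i j. (if i = j then 1 else 0) - M' i j) x y" for x y
    unfolding bil_def by (intro sum.cong refl) (simp add: assms)
  then show ?thesis by (simp add: near_id_def)
qed

lemma near_id_quad_le:
  assumes "near_id n M"
  shows "bil n M x x \<le> 3 / 2 * sqn n x"
proof -
  have "bil n (\<lambda>i j. (if i = j then 1 else 0) - M i j) x x = sqn n x - bil n M x x"
  proof -
    have "bil n (\<lambda>i j. (if i = j then 1 else 0) - M i j) x x
       = (\<Sum>i<n. \<Sum>j<n. (if i = j then (x i)\<^sup>2 else 0) - x i * M i j * x j)"
      unfolding bil_def by (intro sum.cong refl) (auto simp: power2_eq_square algebra_simps)
    then show ?thesis by (simp add: bil_def sqn_def sum_subtractf)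
  qed
  moreover have "\<bar>bil n (\<lambda>i j. (if i = j then 1 else 0) - M i j) x x\<bar> \<le> 1 / 2 * sqrt (sqn n x) * sqrt (sqn n x)"
    using assms unfolding near_id_def by blast
  ultimately have "\<bar>sqn n x - bil n M x x\<bar> \<le> 1 / 2 * sqn n x" by simp
  then show ?thesis by linarith
qed

lemma near_id_solve:
  assumes "near_id n M"
  shows "i < n \<Longrightarrow> (\<Sum>j<n. M i j * solve n M t j) = t i" and "sqn n (solve n M t) \<le> 4 * sqn n t"
proof -
  have E: "\<bar>bil n (\<lambda>i j. (if i = j then 1 else 0) - M i j) x y\<bar> \<le> 1 / 2 * sqrt (sqn n x) * sqrt (sqn n y)" for x y
    using assms unfolding near_id_def by blast
  show "i < n \<Longrightarrow> (\<Sum>j<n. M i j * solve n M t j) = t i" by (rule solve_correct(1)[OF E])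
  show "sqn n (solve n M t) \<le> 4 * sqn n t" by (rule solve_correct(2)[OF E])
qed

text \<open>\<open>W\<close> is the symmetric dilation of \<open>B\<close> in dimension
  \<open>2 * m\<close>, so the net bound for symmetric forms applies. Its quadratic form is twice
  the bilinear form, whence \<omega> is at most \<open>4 * c\<close>.\<close>

lemma bilinear_net_bound:
  fixes B :: "nat \<Rightarrow> nat \<Rightarrow> real"
  assumes m: "0 < m"
    and net: "\<And>z. z \<in> lball (2 * m) (2 * m) \<Longrightarrow>
      \<bar>\<Sum>p<m. \<Sum>q<m. lvec (2 * m) z p * B p q * lvec (2 * m) z (m + q)\<bar> \<le> c"
  shows "\<bar>\<Sum>p<m. \<Sum>q<m. u p * B p q * v q\<bar> \<le> 2 * c * (sqn m u + sqn m v)" (is "?lhs \<le> _")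
proof -
  define W where "W = (\<lambda>i j. if i < m \<and> m \<le> j then B i (j - m) else if m \<le> i \<and> j < m then B j (i - m) else 0)"
  have Wsym: "W i j = W j i" for i j by (auto simp: W_def)
  have split: "(\<Sum>i<2 * m. f i) = (\<Sum>i<m. f i) + (\<Sum>i<m. f (m + i))" for f :: "nat \<Rightarrow> real"
  proof -
    have "(\<Sum>i<2 * m. f i) = (\<Sum>i\<in>{..<m} \<union> {m..<m + m}. f i)" by (intro sum.cong refl) auto
    also have "\<dots> = (\<Sum>i<m. f i) + (\<Sum>i\<in>{m..<m + m}. f i)" by (intro sum.union_disjoint) auto
    finally show ?thesis by (simp add: sum_shift_interval)
  qed
  have form: "bil (2 * m) W x x = 2 * (\<Sum>p<m. \<Sum>q<m. x p * B p q * x (m + q))" for x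
  proof -
    have "bil (2 * m) W x x = (\<Sum>p<m. \<Sum>q<m. x p * B p q * x (m + q)) + (\<Sum>q<m. \<Sum>p<m. x (m + q) * B p q * x p)"
      unfolding bil_def split by (simp add: W_def)
    also have "(\<Sum>q<m. \<Sum>p<m. x (m + q) * B p q * x p) = (\<Sum>p<m. \<Sum>q<m. x p * B p q * x (m + q))"
      by (subst sum.swap) (simp add: mult_ac)
    finally show ?thesis by simp
  qed
  let ?N = "real (2 * m)"
  have N: "?N > 0" "real (2 * m) \<le> ?N" using m by simp_all
  have fin: "finite (lvec ?N ` lball (2 * m) ?N)" by (intro finite_imageI finite_lball) simp
  have nt: "\<exists>z\<in>lvec ?N ` lball (2 * m) ?N. sqn (2 * m) z \<le> 1 \<and> sqn (2 * m) (\<lambda>i. x i - z i) \<le> 1 / 16"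
    if x: "sqn (2 * m) x \<le> 1" for x
  proof -
    obtain \<zeta> where "\<zeta> \<in> lball (2 * m) ?N" "sqn (2 * m) (\<lambda>i. x i - lvec ?N \<zeta> i) \<le> 1 / 16"
      by (rule lattice_round[OF N x])
    then show ?thesis using sqn_lvec_le_1[OF N(1)] by blast
  qed
  from net_norm[where W = W and n = "2 * m", OF Wsym fin nt]
  obtain \<omega> where \<omega>: "\<And>x. \<bar>bil (2 * m) W x x\<bar> \<le> \<omega> * sqn (2 * m) x"
    and ex: "\<exists>z\<in>lvec ?N ` lball (2 * m) ?N. sqn (2 * m) z \<le> 1 \<and> \<omega> \<le> 2 * \<bar>bil (2 * m) W z z\<bar>"
    by auto
  from ex obtain z where z: "z \<in> lball (2 * m) ?N" "\<omega> \<le> 2 * \<bar>bil (2 * m) W (lvec ?N z) (lvec ?N z)\<bar>"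
    by auto
  have \<omega>4: "\<omega> \<le> 4 * c" using z(2) net[of z] z(1) unfolding form by (simp add: abs_mult)
  define x where "x = (\<lambda>i. if i < m then u i else v (i - m))"
  have sx: "sqn (2 * m) x = sqn m u + sqn m v" unfolding sqn_def split by (simp add: x_def)
  have "2 * ?lhs = \<bar>bil (2 * m) W x x\<bar>"
    unfolding form by (simp add: x_def abs_mult)
  also have "\<dots> \<le> \<omega> * (sqn m u + sqn m v)" using \<omega>[of x] sx by simp
  also have "\<dots> \<le> 4 * c * (sqn m u + sqn m v)" using \<omega>4 by (intro mult_right_mono) auto
  finally show ?thesis by simp
qed

text \<open>\<open>U\<close> holds the coordinates whose deviation this block corrects. Its
  disjointness from both feature groups is the source of the independence of \<open>tx\<close> and
  \<open>Mx\<close>.\<close>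

locale target_block = feature_block +
  fixes U :: "nat set"
  assumes U: "U \<subseteq> {..<d}" "U \<inter> {\<alpha>..<\<alpha> + m} = {}" "U \<inter> {\<beta>..<\<beta> + m} = {}"
begin

text \<open>The factor \<open>1/2\<close> appears since an off-diagonal block enters the quadratic form twice.\<close>

definition tx :: "sample \<Rightarrow> nat \<Rightarrow> real" where
  "tx G i = - (1 / (2 * d)) * (\<Sum>j\<in>U. (sqrt d * G (i, j))\<^sup>2 - 1)"

definition dx :: "sample \<Rightarrow> nat \<Rightarrow> real" where
  "dx G = solve n (Mx G) (tx G)"

definition small :: "real \<Rightarrow> sample \<Rightarrow> (nat \<Rightarrow> int) \<Rightarrow> nat \<Rightarrow> real" where
  "small r G z i = (if \<bar>wx G z i\<bar> \<le> r then wx G z i else 0)"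

definition E4 :: "real \<Rightarrow> real \<Rightarrow> sample set" where
  "E4 r \<theta> = {G \<in> space P. (\<forall>i\<in>{..<n}. \<bar>dx G i\<bar> \<le> \<theta>) \<and>
     (\<forall>z\<in>lball (2 * m) (2 * m). \<bar>\<Sum>i<n. dx G i * small r G z i\<bar> \<le> 1 / 40)}"

lemma finite_U: "finite U" using U(1) by (rule finite_subset) simp

lemma tx_measurable:
  assumes "i < n" "U \<subseteq> V"
  shows "(\<lambda>G. tx G i) \<in> borel_measurable (PG d ({..<n} \<times> V))"
  unfolding tx_def using assms
  by (intro meas_coord borel_arith) auto

lemma dx_measurable:
  assumes i: "i < n"
  shows "(\<lambda>G. dx G i) \<in> borel_measurable P"
proof -
  have "(\<lambda>G. neumann n (Mx G) (tx G) N i) \<in> borel_measurable P" if "i < n" for N i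
    using that
  proof (induction N arbitrary: i)
    case (Suc N)
    show ?case unfolding neumann.simps
      using Suc.prems U(1)
      by (intro Suc.IH Mx_measurable tx_measurable borel_arith) simp_all
  qed simp
  then show ?thesis unfolding dx_def solve_def using i by (intro borel_measurable_lim_metric)
qed

lemma small_measurable: "i < n \<Longrightarrow> (\<lambda>G. small r G z i) \<in> borel_measurable P"
  unfolding small_def
  by (intro measurable_If wx_measurable borel_arith)

lemma E4_sets: "E4 r \<theta> \<in> sets P"
  unfolding E4_def
proof -
  have sm: "(\<lambda>G. \<Sum>i<n. dx G i * small r G z i) \<in> borel_measurable P" for z
    by (intro dx_measurable small_measurable borel_arith) simp_all
  show "{G \<in> space P. (\<forall>i\<in>{..<n}. \<bar>dx G i\<bar> \<le> \<theta>) \<and>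
     (\<forall>z\<in>lball (2 * m) (2 * m). \<bar>\<Sum>i<n. dx G i * small r G z i\<bar> \<le> 1 / 40)} \<in> sets P"
    by (intro sets.sets_Collect_conj sets.sets_Collect_finite_All finite_lball dx_measurable sm borel_arith) simp_all
qed

text \<open>For fixed \<open>v\<close> the sum combines independent centred chi-squares with
  coefficients of size \<open>l * |v i| / (2 * d)\<close>. The assumption on \<open>l\<close> keeps
  them within 1/4, and \<open>U\<close> having at most \<open>d\<close> elements bounds the sum of
  their squares.\<close>

lemma target_tail:
  fixes v :: "nat \<Rightarrow> real" and l c :: real
  assumes l: "0 < l" and v: "\<And>i. i < n \<Longrightarrow> l * \<bar>v i\<bar> \<le> d / 2"
  defines "J \<equiv> {..<n} \<times> U"
  shows "(\<lambda>\<tau>. \<Sum>i<n. tx \<tau> i * v i) \<in> borel_measurable (PG d J)"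
    and "measure (PG d J) {\<tau> \<in> space (PG d J). \<bar>\<Sum>i<n. tx \<tau> i * v i\<bar> \<ge> c} \<le> 2 * exp (l\<^sup>2 * sqn n v / d) * exp (- (l * c))"
proof -
  show X: "(\<lambda>\<tau>. \<Sum>i<n. tx \<tau> i * v i) \<in> borel_measurable (PG d J)"
    unfolding J_def by (intro tx_measurable borel_arith) auto
  have finJ: "finite J" unfolding J_def using finite_U by simp
  have int: "(\<integral>\<^sup>+\<tau>. ennreal (exp (s * (\<Sum>i<n. tx \<tau> i * v i))) \<partial>PG d J) \<le> ennreal (exp (l\<^sup>2 * sqn n v / d))"
    if s: "\<bar>s\<bar> = l" for s
  proof -
    define y where "y = (\<lambda>j :: nat \<times> nat. - (s * v (fst j) / (2 * d)))"
    have eq: "s * (\<Sum>i<n. tx \<tau> i * v i) = (\<Sum>j\<in>J. y j * ((sqrt d * \<tau> j)\<^sup>2 - 1))" for \<tau>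
    proof -
      have "s * (\<Sum>i<n. tx \<tau> i * v i) = (\<Sum>i<n. \<Sum>j\<in>U. y (i, j) * ((sqrt d * \<tau> (i, j))\<^sup>2 - 1))"
        unfolding sum_distrib_left[of s]
      proof (intro sum.cong refl)
        fix i
        have "(\<Sum>j\<in>U. y (i, j) * ((sqrt d * \<tau> (i, j))\<^sup>2 - 1)) = - (s * v i / (2 * d)) * (\<Sum>j\<in>U. (sqrt d * \<tau> (i, j))\<^sup>2 - 1)"
          by (simp only: y_def fst_conv sum_distrib_left)
        then show "s * (tx \<tau> i * v i) = (\<Sum>j\<in>U. y (i, j) * ((sqrt d * \<tau> (i, j))\<^sup>2 - 1))"
          by (simp add: tx_def)
      qed
      then show ?thesis unfolding J_def by (simp add: sum.cartesian_product case_prod_unfold)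
    qed
    have y: "\<bar>y j\<bar> \<le> 1 / 4" if "j \<in> J" for j
    proof -
      have "\<bar>s\<bar> * \<bar>v (fst j)\<bar> \<le> d / 2" using v[of "fst j"] that s by (auto simp: J_def)
      then show ?thesis using d0 by (simp add: y_def abs_mult divide_simps)
    qed
    have "(\<Sum>j\<in>J. (y j)\<^sup>2) = (\<Sum>i<n. \<Sum>j\<in>U. (y (i, j))\<^sup>2)"
      unfolding J_def sum.cartesian_product by (simp add: case_prod_unfold)
    then have "4 * (\<Sum>j\<in>J. (y j)\<^sup>2) = 4 * (\<Sum>i<n. \<Sum>j\<in>U. (s * v i / (2 * d))\<^sup>2)"
      by (simp add: y_def)
    also have "\<dots> = (\<Sum>i<n. real (card U) * (l\<^sup>2 * (v i)\<^sup>2 / (real d)\<^sup>2))"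
      unfolding s[symmetric] by (simp add: power_divide power_mult_distrib sum_distrib_left)
    also have "\<dots> \<le> (\<Sum>i<n. real d * (l\<^sup>2 * (v i)\<^sup>2 / (real d)\<^sup>2))"
      using card_mono[OF _ U(1)] by (intro sum_mono mult_right_mono) auto
    also have "\<dots> = l\<^sup>2 * sqn n v / d"
      using d0 by (simp add: sqn_def sum_distrib_left sum_divide_distrib power2_eq_square)
    finally have "4 * (\<Sum>j\<in>J. (y j)\<^sup>2) \<le> l\<^sup>2 * sqn n v / d" .
    then show ?thesis unfolding eq
      by (intro order_trans[OF PG_exp_centered_squares[OF d0 finJ y]] ennreal_leI) auto
  qed
  have "{\<tau> \<in> space (PG d J). \<bar>\<Sum>i<n. tx \<tau> i * v i\<bar> \<ge> c} = {\<tau> \<in> space (PG d J). \<bar>l * (\<Sum>i<n. tx \<tau> i * v i)\<bar> \<ge> l * c}"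
    using l by (auto simp: abs_mult)
  also have "measure (PG d J) \<dots> \<le> 2 * exp (l\<^sup>2 * sqn n v / d) * exp (- (l * c))"
    using int[of l] int[of "- l"] l
    by (intro chernoff_two_sided prob_space_PG d0 X borel_arith) auto
  finally show "measure (PG d J) {\<tau> \<in> space (PG d J). \<bar>\<Sum>i<n. tx \<tau> i * v i\<bar> \<ge> c} \<le> 2 * exp (l\<^sup>2 * sqn n v / d) * exp (- (l * c))" .
qed

lemma good_near_id:
  assumes G: "G \<in> E1" "G \<in> E2 N L \<epsilon>"
    and N: "real n \<le> N" "2 ^ L \<le> N" "N < 2 ^ Suc L" and \<epsilon>: "\<And>l. \<epsilon> l \<ge> 0" "(\<Sum>l\<le>L. \<epsilon> l) \<le> 1 / 100"
  shows "near_id n (Mx G)"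
  unfolding near_id_def
proof (intro allI near_identity[where L = L and N = N and \<epsilon> = \<epsilon>])
  show "Mx G i j = Mx G j i" for i j unfolding Mx_def by (rule gram_sym)
  fix l \<xi> \<eta> assume "l \<le> L" "\<xi> \<in> lsparse n N (2 * 2 ^ l)" "\<eta> \<in> lsparse n N (2 * 2 ^ l)"
    "\<And>i. i < n \<Longrightarrow> \<xi> i = 0 \<or> \<eta> i = 0" "\<And>i. i < n \<Longrightarrow> (lvec N \<eta> i)\<^sup>2 \<le> 1 / 2 ^ l"
  then have "l \<in> {..L}" "(\<xi>, \<eta>) \<in> pairs N l" by (auto simp: pairs_def admissible_def)
  then show "\<bar>bil n (Mx G) (lvec N \<xi>) (lvec N \<eta>)\<bar> \<le> \<epsilon> l * sqrt (bil n (Mx G) (lvec N \<xi>) (lvec N \<xi>))"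
    using G(2) unfolding E2_def by fastforce
next
  fix i assume i: "i < n"
  define A where "A = sqn m (fa G i) / m - 1"
  define B where "B = sqn m (fb G i) / m - 1"
  have AB: "\<bar>A\<bar> \<le> 1 / 10" "\<bar>B\<bar> \<le> 1 / 10" using G(1) i by (auto simp: E1_def A_def B_def)
  have "Mx G i i = (A + 1) * (B + 1)"
    by (simp add: Mx_def gram_def A_def B_def sqn_def power2_eq_square)
  \<comment> \<open>Two relative errors of 1/10 multiply to an error of at most 0.21.\<close>
  then have "Mx G i i - 1 = A * B + A + B" by (simp add: algebra_simps)
  moreover have "\<bar>A * B\<bar> \<le> 1 / 10 * (1 / 10)" unfolding abs_mult using AB by (intro mult_mono) auto
  ultimately show "\<bar>Mx G i i - 1\<bar> \<le> 1 / 4" using AB by linarith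
qed (use N \<epsilon> in auto)

lemma fit_exists:
  assumes near: "near_id n (Mx G)" and E4: "G \<in> E4 r (r / 60)" and r: "r > 0"
  obtains B where "\<And>i. i < n \<Longrightarrow> (\<Sum>p<m. \<Sum>q<m. fa G i p * B p q * fb G i q) / m = tx G i"
    and "\<And>u v. \<bar>\<Sum>p<m. \<Sum>q<m. u p * B p q * v q\<bar> \<le> 1 / 10 * (sqn m u + sqn m v)"
proof -
  define B where "B = tensor n m (fa G) (fb G) (dx G)"
  have sol: "(\<Sum>j<n. Mx G i j * dx G j) = tx G i" if "i < n" for i
    unfolding dx_def by (rule near_id_solve(1)[OF near that])
  have fit: "(\<Sum>p<m. \<Sum>q<m. fa G i p * B p q * fb G i q) / m = tx G i" if "i < n" for i
  proof -
    have "(\<Sum>p<m. \<Sum>q<m. fa G i p * B p q * fb G i q) = (\<Sum>j<n. dx G j * (m * Mx G i j))"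
      unfolding B_def tensor_pairing pairing_gram Mx_def ..
    also have "\<dots> = m * (\<Sum>j<n. Mx G i j * dx G j)" by (simp add: sum_distrib_left mult_ac)
    finally show ?thesis using m0 sol[OF that] by simp
  qed
  have net: "\<bar>\<Sum>p<m. \<Sum>q<m. lvec (2 * m) z p * B p q * lvec (2 * m) z (m + q)\<bar> \<le> 1 / 20"
    if z: "z \<in> lball (2 * m) (2 * m)" for z
  proof -
    have "(\<Sum>p<m. \<Sum>q<m. lvec (2 * m) z p * B p q * lvec (2 * m) z (m + q)) = (\<Sum>i<n. dx G i * wx G z i)"
      unfolding B_def tensor_pairing wx_def ..
    \<comment> \<open>The second summand is 1/40 as well, which is where the sup norm bound
      \<open>r / 60\<close> comes from.\<close>
    also have "\<bar>\<dots>\<bar> \<le> 1 / 40 + r / 60 * 3 / (2 * r)"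
    proof (rule pairing_split_bound[OF _ r])
      show "sqn n (wx G z) \<le> 3 / 2"
        unfolding wx_def using near_id_quad_le[OF near] lattice_halves[OF z] by (intro sqn_pairing_le) (auto simp: Mx_def)
      show "\<bar>dx G i\<bar> \<le> r / 60" if "i < n" for i using E4 that by (auto simp: E4_def)
      show "\<bar>\<Sum>i<n. dx G i * (if \<bar>wx G z i\<bar> \<le> r then wx G z i else 0)\<bar> \<le> 1 / 40"
        using E4 z by (auto simp: E4_def small_def)
    qed (use r in auto)
    finally show ?thesis using r by simp
  qed
  have bound: "\<bar>\<Sum>p<m. \<Sum>q<m. u p * B p q * v q\<bar> \<le> 1 / 10 * (sqn m u + sqn m v)" for u v
    using bilinear_net_bound[OF m0 net, of u v] by simp
  show ?thesis by (rule that[OF fit bound])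
qed

end

section \<open>Independence of the targets and conclusion\<close>

context target_block
begin

text \<open>Once all coordinates outside \<open>U\<close> are frozen, \<open>M\<close>, the pairings
  and the truncation are constants and only the target is random. Each requirement of
  \<open>E4\<close> becomes a tail event for \<open><t, v>\<close> with a fixed \<open>v\<close>,
  and these are summed over the indices and over the net.\<close>

lemma E4_prob:
  fixes e r \<theta> :: real
  assumes N: "real n \<le> N" "2 ^ L \<le> N" "N < 2 ^ Suc L" and \<epsilon>: "\<And>l. \<epsilon> l \<ge> 0" "(\<Sum>l\<le>L. \<epsilon> l) \<le> 1 / 100"
    and e: "e = 1 / 16000000" and d16: "16 \<le> d" and md: "4 * m \<le> d"
  shows "measure P (E1 \<inter> E2 N L \<epsilon> \<inter> E3 r e - E4 r \<theta>) \<le> 2 * n * exp (4 - sqrt d * \<theta>) + 2 * exp (- 14 * d)"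
proof -
  define K where "K = 2 * n * exp (4 - sqrt d * \<theta>) + 2 * exp (- 14 * real d)"
  define E where "E = E1 \<inter> E2 N L \<epsilon> \<inter> E3 r e - E4 r \<theta>"
  define I where "I = {..<n} \<times> {..<d}"
  define J where "J = {..<n} \<times> U"
  let ?Z = "lball (2 * m) (2 * m)"
  have K0: "K \<ge> 0" by (simp add: K_def)
  have N0: "N \<ge> 0" using N(1) by (meson of_nat_0_le_iff order_trans)
  have Es: "E \<in> sets P" unfolding E_def by (intro sets.Diff sets.Int E1_sets E2_sets E3_sets E4_sets N0)
  have JI: "J \<subseteq> I" using U(1) by (auto simp: I_def J_def)
  have finZ: "finite ?Z" by (rule finite_lball) simp
  have dpos: "real d > 0" using d0 by simp
  have "(\<integral>\<^sup>+G. indicator E G \<partial>PG d I) \<le> ennreal K"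
  proof (rule nn_integral_slice_le[OF prob_space_gm[OF d0] _ JI])
    show "finite I" by (simp add: I_def)
    show "(indicator E :: _ \<Rightarrow> ennreal) \<in> borel_measurable (PG d I)" using Es by (simp add: I_def)
    fix \<omega> :: sample
    define g where "g = (\<lambda>\<tau>. merge (I - J) J (\<omega>, \<tau>))"
    have g: "merge (I - J) J (\<omega>, \<tau>) = g \<tau>" for \<tau> by (simp add: g_def)
    have fa_g: "fa (g \<tau>) i p = fa \<omega> i p" and fb_g: "fb (g \<tau>) i p = fb \<omega> i p" if "i < n" "p < m" for \<tau> i p
    proof -
      have "\<alpha> + p \<notin> U" "\<beta> + p \<notin> U" "\<alpha> + p < d" "\<beta> + p < d" using U that ab bd by auto
      then have "(i, \<alpha> + p) \<in> I - J" "(i, \<beta> + p) \<in> I - J" using that by (auto simp: I_def J_def)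
      then show "fa (g \<tau>) i p = fa \<omega> i p" "fb (g \<tau>) i p = fb \<omega> i p" by (simp_all add: fa_def fb_def g_def merge_def)
    qed
    have Mx_g: "Mx (g \<tau>) i j = Mx \<omega> i j" if "i < n" "j < n" for \<tau> i j
      using that by (simp add: Mx_def gram_def fa_g fb_g)
    have wx_g: "wx (g \<tau>) z i = wx \<omega> z i" if "i < n" for \<tau> z i
      using that by (simp add: wx_def pairing_def fa_g fb_g)
    have small_g: "small r (g \<tau>) z i = small r \<omega> z i" if "i < n" for \<tau> z i
      using that by (simp add: small_def wx_g)
    have tx_g: "tx (g \<tau>) i = tx \<tau> i" if "i < n" for \<tau> i
    proof -
      have "g \<tau> (i, j) = \<tau> (i, j)" if "j \<in> U" for j
        using that \<open>i < n\<close> by (simp add: g_def merge_def J_def)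
      then show ?thesis by (simp add: tx_def)
    qed
    define good where "good \<longleftrightarrow> near_id n (Mx \<omega>) \<and> (\<forall>z\<in>?Z. sqn n (small r \<omega> z) \<le> e)"
    have E_good: good if "g \<tau> \<in> E" for \<tau>
    proof -
      have "near_id n (Mx (g \<tau>))" using that by (intro good_near_id[OF _ _ N \<epsilon>]) (auto simp: E_def)
      then have "near_id n (Mx \<omega>)" using near_id_cong[of n "Mx (g \<tau>)" "Mx \<omega>"] Mx_g by blast
      moreover have "sqn n (small r \<omega> z) \<le> e" if "z \<in> ?Z" for z
      proof -
        have "sqn n (small r \<omega> z) = (\<Sum>i<n. if \<bar>wx (g \<tau>) z i\<bar> \<le> r then (wx (g \<tau>) z i)\<^sup>2 else 0)"
          unfolding sqn_def by (intro sum.cong refl) (simp add: small_def wx_g)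
        also have "\<dots> \<le> e" using \<open>g \<tau> \<in> E\<close> that by (auto simp: E_def E3_def)
        finally show ?thesis .
      qed
      ultimately show ?thesis by (simp add: good_def)
    qed
    show "(\<integral>\<^sup>+\<tau>. indicator E (merge (I - J) J (\<omega>, \<tau>)) \<partial>PG d J) \<le> ennreal K"
    proof (cases good)
      case False
      then have "indicator E (g \<tau>) = (0 :: ennreal)" for \<tau> using E_good by (auto simp: indicator_def)
      then show ?thesis unfolding g by simp
    next
      case True
      interpret Q: prob_space "PG d J" by (rule prob_space_PG[OF d0])
      have near: "near_id n (Mx \<omega>)" and sm: "\<And>z. z \<in> ?Z \<Longrightarrow> sqn n (small r \<omega> z) \<le> e"
        using True by (auto simp: good_def)
      \<comment> \<open>Testing against a unit vector expresses one entry of \<open>dx\<close> as a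
        linear functional of the target.\<close>
      define unit where "unit = (\<lambda>i k :: nat. if k = i then 1 else 0 :: real)"
      define v where "v = (\<lambda>i. solve n (Mx \<omega>) (unit i))"
      define vz where "vz = (\<lambda>z. solve n (Mx \<omega>) (small r \<omega> z))"
      define B where "B = (\<lambda>i. {\<tau> \<in> space (PG d J). \<bar>\<Sum>k<n. tx \<tau> k * v i k\<bar> \<ge> \<theta>})"
      define Bz where "Bz = (\<lambda>z. {\<tau> \<in> space (PG d J). \<bar>\<Sum>k<n. tx \<tau> k * vz z k\<bar> \<ge> 1 / 40})"
      have sqv: "sqn n (v i) \<le> 4" if "i < n" for i
      proof -
        have "sqn n (v i) \<le> 4 * sqn n (unit i)" unfolding v_def by (rule near_id_solve(2)[OF near])
        also have "sqn n (unit i) = (\<Sum>k<n. if k = i then 1 else 0)" unfolding sqn_def unit_def by (intro sum.cong) auto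
        finally show ?thesis using that by simp
      qed
      have sqvz: "sqn n (vz z) \<le> 4 * e" if "z \<in> ?Z" for z
        using near_id_solve(2)[OF near, of "small r \<omega> z"] sm[OF that] by (simp add: vz_def)
      have comp: "\<bar>x k\<bar> \<le> c" if "sqn n x \<le> c\<^sup>2" "k < n" "c \<ge> 0" for x k c
      proof -
        have "(x k)\<^sup>2 \<le> c\<^sup>2" using component_le_sqn[OF that(2), of x] that(1) by linarith
        then show ?thesis using that(3) abs_le_square_iff[of "x k" c] by simp
      qed
      have B: "B i \<in> sets (PG d J)" "Q.prob (B i) \<le> 2 * exp (4 - sqrt d * \<theta>)" if i: "i < n" for i
      proof -
        \<comment> \<open>The entries of \<open>v i\<close> are at most 2, so the tail bound with
          parameter \<open>sqrt d\<close> needs \<open>2 * sqrt d <= d / 2\<close>, that is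
          \<open>d >= 16\<close>.\<close>
        have "sqrt (real d) * 4 \<le> sqrt d * sqrt d"
          using d16 by (intro mult_left_mono real_le_rsqrt) auto
        then have sd: "sqrt (real d) * 2 \<le> d / 2" by simp
        have l: "sqrt (real d) * \<bar>v i k\<bar> \<le> d / 2" if "k < n" for k
        proof -
          have "\<bar>v i k\<bar> \<le> 2" using sqv[OF i] that by (intro comp) auto
          then have "sqrt (real d) * \<bar>v i k\<bar> \<le> sqrt d * 2" by (intro mult_left_mono) auto
          then show ?thesis using sd by linarith
        qed
        note tt = target_tail[of "sqrt d" "v i", folded J_def, OF _ l]
        show "B i \<in> sets (PG d J)" unfolding B_def
          using dpos by (intro tt(1) borel_arith) auto
        have "Q.prob (B i) \<le> 2 * exp ((sqrt d)\<^sup>2 * sqn n (v i) / d) * exp (- (sqrt d * \<theta>))"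
          unfolding B_def using dpos by (intro tt(2)) auto
        also have "\<dots> = 2 * exp (sqn n (v i) - sqrt d * \<theta>)"
          using dpos by (simp add: exp_diff exp_minus field_simps)
        also have "\<dots> \<le> 2 * exp (4 - sqrt d * \<theta>)" using sqv[OF i] by simp
        finally show "Q.prob (B i) \<le> 2 * exp (4 - sqrt d * \<theta>)" .
      qed
      have Bz: "Bz z \<in> sets (PG d J)" "Q.prob (Bz z) \<le> 2 * exp (- (99 / 4 * d))" if z: "z \<in> ?Z" for z
      proof -
        \<comment> \<open>At threshold 1/40 the parameter \<open>1000 * d\<close> gains
          \<open>25 * d\<close> and pays \<open>d / 4\<close>, which beats the
          \<open>exp (10 * d)\<close> net points. Since \<open>4 * e\<close> is the square of
          1/2000, it is also the largest parameter that the entry bound permits.\<close>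
        have l: "1000 * real d * \<bar>vz z k\<bar> \<le> d / 2" if "k < n" for k
        proof -
          have "\<bar>vz z k\<bar> \<le> 1 / 2000" using sqvz[OF z] that by (intro comp) (auto simp: e power2_eq_square)
          then have "1000 * real d * \<bar>vz z k\<bar> \<le> 1000 * real d * (1 / 2000)" by (intro mult_left_mono) auto
          then show ?thesis by simp
        qed
        note tt = target_tail[of "1000 * real d" "vz z", folded J_def, OF _ l]
        show "Bz z \<in> sets (PG d J)" unfolding Bz_def
          using dpos by (intro tt(1) borel_arith) auto
        have "Q.prob (Bz z) \<le> 2 * exp ((1000 * real d)\<^sup>2 * sqn n (vz z) / d) * exp (- (1000 * real d * (1 / 40)))"
          unfolding Bz_def using dpos by (intro tt(2)) auto
        also have "\<dots> \<le> 2 * exp (d / 4) * exp (- (1000 * real d * (1 / 40)))"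
        proof -
          have "(1000 * real d)\<^sup>2 * sqn n (vz z) / d = 1000000 * d * sqn n (vz z)"
            using dpos by (simp add: power2_eq_square)
          also have "\<dots> \<le> 1000000 * d * (4 * e)" using sqvz[OF z] by (intro mult_left_mono) auto
          finally show ?thesis by (simp add: e)
        qed
        also have "\<dots> = 2 * exp (- (99 / 4 * d))" by (simp add: exp_add[symmetric])
        finally show "Q.prob (Bz z) \<le> 2 * exp (- (99 / 4 * d))" .
      qed
      define Bad where "Bad = (\<Union>i\<in>{..<n}. B i) \<union> (\<Union>z\<in>?Z. Bz z)"
      have Bads: "(\<Union>i\<in>{..<n}. B i) \<in> sets (PG d J)" "(\<Union>z\<in>?Z. Bz z) \<in> sets (PG d J)"
        using B(1) Bz(1) finZ by (auto intro!: sets.finite_UN)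
      have "Q.prob Bad \<le> Q.prob (\<Union>i\<in>{..<n}. B i) + Q.prob (\<Union>z\<in>?Z. Bz z)"
        unfolding Bad_def by (rule measure_Un_le) (rule Bads)+
      also have "\<dots> \<le> (\<Sum>i<n. Q.prob (B i)) + (\<Sum>z\<in>?Z. Q.prob (Bz z))"
        using B(1) Bz(1) finZ by (intro add_mono measure_UNION_le) auto
      also have "\<dots> \<le> (\<Sum>i<n. 2 * exp (4 - sqrt d * \<theta>)) + (\<Sum>z\<in>?Z. 2 * exp (- (99 / 4 * d)))"
        using B(2) Bz(2) by (intro add_mono sum_mono) auto
      also have "\<dots> = 2 * n * exp (4 - sqrt d * \<theta>) + real (card ?Z) * (2 * exp (- (99 / 4 * d)))" by simp
      also have "\<dots> \<le> K"
      proof -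
        have "real (card ?Z) \<le> exp (40 * m)" using card_lball[OF m0] by simp
        also have "\<dots> \<le> exp (10 * d)" using md by simp
        finally have "real (card ?Z) * (2 * exp (- (99 / 4 * d))) \<le> exp (10 * d) * (2 * exp (- (99 / 4 * d)))"
          by (intro mult_right_mono) auto
        also have "\<dots> = 2 * (exp (10 * d) * exp (- (99 / 4 * d)))" by simp
        also have "\<dots> = 2 * exp (10 * d + - (99 / 4 * d))" by (simp only: exp_add)
        also have "\<dots> \<le> 2 * exp (- 14 * real d)" by simp
        finally show ?thesis by (simp add: K_def)
      qed
      finally have mBad: "Q.prob Bad \<le> K" .
      have sub: "\<tau> \<in> Bad" if "g \<tau> \<in> E" "\<tau> \<in> space (PG d J)" for \<tau>
      proof -
        have near': "near_id n (Mx (g \<tau>))" using near near_id_cong[of n "Mx (g \<tau>)" "Mx \<omega>"] Mx_g by blast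
        have adj: "(\<Sum>k<n. dx (g \<tau>) k * w k) = (\<Sum>k<n. tx \<tau> k * solve n (Mx \<omega>) w k)" for w
        proof -
          have "(\<Sum>k<n. dx (g \<tau>) k * w k) = (\<Sum>k<n. tx (g \<tau>) k * solve n (Mx \<omega>) w k)"
          proof (rule solve_adjoint[where M = "Mx (g \<tau>)"])
            show "Mx (g \<tau>) i j = Mx (g \<tau>) j i" for i j unfolding Mx_def by (rule gram_sym)
            show "(\<Sum>j<n. Mx (g \<tau>) i j * dx (g \<tau>) j) = tx (g \<tau>) i" if "i < n" for i
              unfolding dx_def by (rule near_id_solve(1)[OF near' that])
            show "(\<Sum>j<n. Mx (g \<tau>) i j * solve n (Mx \<omega>) w j) = w i" if "i < n" for i
              using near_id_solve(1)[OF near that, of w] Mx_g that by simp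
          qed
          then show ?thesis by (simp add: tx_g)
        qed
        have "g \<tau> \<in> space P" "g \<tau> \<notin> E4 r \<theta>" using that(1) by (auto simp: E_def E1_def)
        then consider i where "i < n" "\<not> \<bar>dx (g \<tau>) i\<bar> \<le> \<theta>"
          | z where "z \<in> ?Z" "\<not> \<bar>\<Sum>i<n. dx (g \<tau>) i * small r (g \<tau>) z i\<bar> \<le> 1 / 40"
          unfolding E4_def by blast
        then show ?thesis
        proof cases
          case 1
          have "(\<Sum>k<n. dx (g \<tau>) k * unit i k) = dx (g \<tau>) i"
            using 1(1) by (simp add: unit_def if_distrib[of "\<lambda>x. _ * x"] cong: if_cong)
          then have "dx (g \<tau>) i = (\<Sum>k<n. tx \<tau> k * v i k)" using adj[of "unit i"] by (simp add: v_def)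
          then have "\<tau> \<in> B i" using 1 that(2) by (simp add: B_def)
          then show ?thesis using 1 by (auto simp: Bad_def)
        next
          case 2
          have "(\<Sum>i<n. dx (g \<tau>) i * small r (g \<tau>) z i) = (\<Sum>k<n. tx \<tau> k * vz z k)"
            using adj[of "small r \<omega> z"] by (simp add: small_g vz_def)
          then have "\<tau> \<in> Bz z" using 2 that(2) by (simp add: Bz_def)
          then show ?thesis using 2 by (auto simp: Bad_def)
        qed
      qed
      have "(\<integral>\<^sup>+\<tau>. indicator E (g \<tau>) \<partial>PG d J) \<le> (\<integral>\<^sup>+\<tau>. indicator Bad \<tau> \<partial>PG d J)"
        by (intro nn_integral_mono) (use sub in \<open>auto simp: indicator_def\<close>)
      also have "\<dots> = emeasure (PG d J) Bad"
        unfolding Bad_def by (intro nn_integral_indicator sets.Un Bads)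
      also have "\<dots> \<le> ennreal K" unfolding Q.emeasure_eq_measure by (intro ennreal_leI mBad)
      finally show ?thesis unfolding g .
    qed
  qed
  then have "emeasure P E \<le> ennreal K" using Es by (simp add: I_def)
  then have "measure P E \<le> K"
    using finite_measure.emeasure_eq_measure[OF prob_space.finite_measure[OF prob_space_P], of E] K0 by simp
  then show ?thesis by (simp add: E_def K_def)
qed

end

section \<open>Choice of the parameters\<close>

lemma sum_powr_quarter_le: "(\<Sum>l\<le>L. (2 ^ l) powr (1 / 4)) \<le> 7 * (2 ^ L :: real) powr (1 / 4)"
proof (induction L)
  case (Suc L)
  define \<rho> where "\<rho> = (2::real) powr (1 / 4)"
  \<comment> \<open>The fourth power of 7/6 is below 2, and a geometric sum with ratio at least 7/6
    is at most 7 times its last term.\<close>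
  have "(7 / 6 :: real) = ((7 / 6) powr 4) powr (1 / 4)" by (simp only: powr_powr) simp
  also have "(7 / 6 :: real) powr 4 = (7 / 6) ^ 4" by simp
  also have "((7 / 6 :: real) ^ 4) powr (1 / 4) \<le> 2 powr (1 / 4)"
    by (intro powr_mono2) (auto simp: power_divide)
  finally have \<rho>: "\<rho> \<ge> 7 / 6" by (simp add: \<rho>_def)
  have eq: "(2 ^ Suc L :: real) powr (1 / 4) = \<rho> * (2 ^ L) powr (1 / 4)"
    by (simp add: \<rho>_def powr_mult)
  have "7 * (2 ^ L :: real) powr (1 / 4) \<le> 6 * (\<rho> * (2 ^ L) powr (1 / 4))"
    using mult_right_mono[OF \<rho>, of "(2 ^ L) powr (1 / 4)"] by simp
  then show ?case using Suc unfolding sum.atMost_Suc eq by linarith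
qed simp

lemma ex_dyadic_bracket:
  assumes "N \<ge> (1::real)"
  obtains L :: nat where "2 ^ L \<le> N" "N < 2 ^ Suc L"
proof -
  have "1 \<le> nat \<lfloor>N\<rfloor>" using assms by (simp add: le_nat_iff le_floor_iff)
  then obtain L where L: "2 ^ L \<le> nat \<lfloor>N\<rfloor>" "nat \<lfloor>N\<rfloor> < 2 ^ (L + 1)"
    using ex_power_ivl1[of 2 "nat \<lfloor>N\<rfloor>"] by auto
  have fl: "real (nat \<lfloor>N\<rfloor>) \<le> N" "N < real (nat \<lfloor>N\<rfloor>) + 1" using assms by linarith+
  have le: "real (2 ^ L) \<le> real (nat \<lfloor>N\<rfloor>)" "real (nat \<lfloor>N\<rfloor> + 1) \<le> real (2 ^ (L + 1))"
    using L by (simp_all only: of_nat_le_iff)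
  have eq: "real (2 ^ L) = 2 ^ L" "real (2 ^ (L + 1)) = 2 ^ (L + 1)" "real (nat \<lfloor>N\<rfloor> + 1) = real (nat \<lfloor>N\<rfloor>) + 1"
    by simp_all
  have "2 ^ L \<le> N" using le(1) eq(1) fl(1) by linarith
  moreover have "N < 2 ^ (L + 1)" using le(2) eq(2,3) fl(2) by linarith
  ultimately show ?thesis by (intro that[of L]) simp_all
qed

text \<open>The summands bound, in turn, the failures of \<open>E1\<close>, \<open>E2\<close>,
  \<open>E3\<close> and, on their intersection, of \<open>E4\<close>. Only \<open>d\<close> enters,
  which gives uniformity in \<open>n\<close>.\<close>

definition failure :: "nat \<Rightarrow> real" where
  "failure d = 4 * (real d)\<^sup>2 * exp (- (d / 8000))
     + 2 * ((real d)\<^sup>2 / 10 ^ 13 + 1) * exp (- (90 * ((real d)\<^sup>2 / 10 ^ 13) powr (1 / 4)))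
     + exp (- 2 * real d)
     + (2 * (real d)\<^sup>2 * exp (4 - sqrt d * (1 / 768000000000)) + 2 * exp (- 14 * real d))"

lemma failure_tendsto_0: "failure \<longlonglongrightarrow> 0"
proof -
  have 1: "(\<lambda>d::nat. 4 * (real d)\<^sup>2 * exp (- (d / 8000))) \<longlonglongrightarrow> 0" by real_asymp
  have 2: "(\<lambda>d::nat. 2 * ((real d)\<^sup>2 / 10 ^ 13 + 1) * exp (- (90 * ((real d)\<^sup>2 / 10 ^ 13) powr (1 / 4)))) \<longlonglongrightarrow> 0" by real_asymp
  have 3: "(\<lambda>d::nat. exp (- 2 * real d)) \<longlonglongrightarrow> 0" by real_asymp
  have 4: "(\<lambda>d::nat. 2 * (real d)\<^sup>2 * exp (4 - sqrt d * (1 / 768000000000))) \<longlonglongrightarrow> 0" by real_asymp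
  have 5: "(\<lambda>d::nat. 2 * exp (- 14 * real d)) \<longlonglongrightarrow> 0" by real_asymp
  show ?thesis unfolding failure_def
    using tendsto_add[OF tendsto_add[OF tendsto_add[OF 1 2] 3] tendsto_add[OF 4 5]] by simp
qed

lemma (in target_block) block_success:
  assumes n: "real n \<le> (real d)\<^sup>2 / 10 ^ 13" and d: "1 \<le> (real d)\<^sup>2 / 10 ^ 13" and m: "m = d div 4"
  obtains A where "A \<in> sets P" "measure P (space P - A) \<le> failure d"
    "\<And>G. G \<in> A \<Longrightarrow> near_id n (Mx G)" "\<And>G. G \<in> A \<Longrightarrow> G \<in> E4 (1 / 12800000000) (1 / 12800000000 / 60)"
proof -
  interpret prob_space P by (rule prob_space_P)
  define N where "N = (real d)\<^sup>2 / 10 ^ 13"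
  have N1: "N \<ge> 1" and nN: "real n \<le> N" using d n by (simp_all add: N_def)
  obtain L where L: "2 ^ L \<le> N" "N < 2 ^ Suc L" using ex_dyadic_bracket[OF N1] .
  have d20: "20 \<le> d"
  proof (rule ccontr)
    assume "\<not> 20 \<le> d"
    then have "(real d)\<^sup>2 \<le> 20\<^sup>2" by (intro power_mono) auto
    then show False using d by simp
  qed
  then have "5 * m \<ge> d" "4 * m \<le> d" unfolding m by auto
  then have md: "real d / 5 \<le> m" "4 * m \<le> d" by auto
  have m0': "real m > 0" using m0 by simp
  define \<epsilon> where "\<epsilon> = (\<lambda>l. 200 * (N powr (1 / 4) * (2 ^ l) powr (1 / 4)) / m)"
  have \<epsilon>0: "\<epsilon> l \<ge> 0" for l unfolding \<epsilon>_def by simp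
  have \<epsilon>1: "(\<Sum>l\<le>L. \<epsilon> l) \<le> 1 / 100"
  proof -
    have "(\<Sum>l\<le>L. \<epsilon> l) = 200 * N powr (1 / 4) / m * (\<Sum>l\<le>L. (2 ^ l) powr (1 / 4))"
      unfolding \<epsilon>_def sum_distrib_left by (intro sum.cong refl) simp
    also have "\<dots> \<le> 200 * N powr (1 / 4) / m * (7 * (2 ^ L) powr (1 / 4))"
      by (intro mult_left_mono sum_powr_quarter_le) simp
    also have "\<dots> \<le> 200 * N powr (1 / 4) / m * (7 * N powr (1 / 4))"
      using L(1) by (intro mult_left_mono powr_mono2) auto
    also have "\<dots> = 1400 * (N powr (1 / 4) * N powr (1 / 4)) / m" by simp
    also have "N powr (1 / 4) * N powr (1 / 4) = sqrt N"
      using N1 by (simp add: powr_add[symmetric] powr_half_sqrt)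
    \<comment> \<open>The square root of \<open>10 ^ 13\<close> exceeds 3000000, and
      \<open>m >= d / 5\<close> then leaves 7/3000, well below 1/100.\<close>
    also have "1400 * sqrt N / m \<le> 1400 * (real d / 3000000) / m"
    proof (intro divide_right_mono mult_left_mono real_le_lsqrt)
      show "N \<le> (real d / 3000000)\<^sup>2" by (simp add: N_def power_divide divide_simps)
    qed auto
    also have "\<dots> \<le> 1 / 100" using md(1) m0' by (simp add: pos_divide_le_eq)
    finally show ?thesis .
  qed
  define r where "r = (1 / 12800000000 :: real)"
  define e where "e = (1 / 16000000 :: real)"
  let ?H = "E1 \<inter> E2 N L \<epsilon> \<inter> E3 r e"
  define A where "A = ?H \<inter> E4 r (r / 60)"
  have sets: "E1 \<in> sets P" "E2 N L \<epsilon> \<in> sets P" "E3 r e \<in> sets P" "E4 r (r / 60) \<in> sets P"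
    using N1 by (auto intro: E1_sets E2_sets E3_sets E4_sets)
  have "(real d)\<^sup>2 / 10 ^ 13 \<le> (real d)\<^sup>2 / 1" by (intro divide_left_mono) auto
  then have nd: "real n \<le> (real d)\<^sup>2" using n by linarith
  have p1: "measure P (space P - E1) \<le> 4 * (real d)\<^sup>2 * exp (- (d / 8000))"
  proof -
    have "4 * real n * exp (- (m / 1600)) \<le> 4 * (real d)\<^sup>2 * exp (- (d / 8000))"
      using nd md(1) by (intro mult_mono) auto
    then show ?thesis using E1_prob by linarith
  qed
  have p2: "measure P (space P - E2 N L \<epsilon>) \<le> 2 * (N + 1) * exp (- (90 * N powr (1 / 4)))"
    by (rule E2_prob[OF nN L(1), of \<epsilon>]) (simp add: \<epsilon>_def)
  have p3: "measure P (space P - E3 r e) \<le> exp (- 2 * real d)"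
  proof -
    \<comment> \<open>With \<open>K = 1600000000\<close> one has \<open>8 * K * r = 1\<close> and
      \<open>K * m * e = 100 * m\<close>. Of this, \<open>40 * m\<close> pays for the net and at
      most \<open>50 * m\<close> for the moments; the remaining \<open>10 * m\<close> is at least
      \<open>2 * d\<close>.\<close>
    have "measure P (space P - E3 r e) \<le> exp (40 * m) * (exp (400 * 1600000000 * n / m) * exp (- (1600000000 * m * e)))"
      using E3_prob[of 1600000000 r e] by (simp add: r_def)
    also have "\<dots> = exp (40 * m + 400 * 1600000000 * n / m - 100 * m)"
    proof -
      have "exp a * (exp b * exp (- c)) = exp (a + b - c)" for a b c :: real
        by (simp only: exp_add[symmetric] diff_conv_add_uminus add.assoc)
      from this[of "40 * m" "400 * 1600000000 * n / m" "100 * m"] show ?thesis by (simp add: e_def)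
    qed
    also have "\<dots> \<le> exp (- 2 * real d)"
    proof -
      have "(real d)\<^sup>2 \<le> (5 * real m)\<^sup>2" using md(1) by (intro power_mono) auto
      then have "400 * 1600000000 * real n \<le> 50 * real m * real m"
        using n by (simp add: power2_eq_square)
      then have "400 * 1600000000 * n / m \<le> 50 * m" using m0' by (simp add: pos_divide_le_eq)
      then show ?thesis using md(1) by simp
    qed
    finally show ?thesis .
  qed
  have p4: "measure P (?H - E4 r (r / 60))
      \<le> 2 * (real d)\<^sup>2 * exp (4 - sqrt d * (1 / 768000000000)) + 2 * exp (- 14 * real d)"
  proof -
    have "measure P (?H - E4 r (r / 60)) \<le> 2 * n * exp (4 - sqrt d * (r / 60)) + 2 * exp (- 14 * real d)"
      using E4_prob[OF nN L \<epsilon>0 \<epsilon>1 e_def, of r "r / 60"] d20 md(2) by simp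
    also have "\<dots> \<le> 2 * (real d)\<^sup>2 * exp (4 - sqrt d * (r / 60)) + 2 * exp (- 14 * real d)"
      using nd by (intro add_right_mono mult_right_mono) auto
    finally show ?thesis by (simp add: r_def)
  qed
  let ?W = "(space P - E1) \<union> (space P - E2 N L \<epsilon>) \<union> (space P - E3 r e) \<union> (?H - E4 r (r / 60))"
  have "space P - A \<subseteq> ?W"
    by (auto simp: A_def)
  then have "measure P (space P - A) \<le> measure P ?W"
    using sets by (intro finite_measure_mono) auto
  also have "\<dots> \<le> measure P (space P - E1) + measure P (space P - E2 N L \<epsilon>) + measure P (space P - E3 r e)
      + measure P (?H - E4 r (r / 60))"
    using sets by (intro order_trans[OF measure_Un_le] add_mono measure_Un_le sets.Un order_refl) auto
  also have "\<dots> \<le> failure d" using p1 p2 p3 p4 unfolding failure_def N_def by linarith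
  finally have meas: "measure P (space P - A) \<le> failure d" .
  have "A \<in> sets P" using sets by (simp add: A_def)
  moreover note meas
  moreover have "near_id n (Mx G)" if "G \<in> A" for G
    using that by (intro good_near_id[OF _ _ nN L \<epsilon>0 \<epsilon>1]) (auto simp: A_def)
  moreover have "G \<in> E4 (1 / 12800000000) (1 / 12800000000 / 60)" if "G \<in> A" for G
    using that by (simp add: A_def r_def)
  ultimately show ?thesis by (rule that)
qed

section \<open>Assembling the matrix and fitting the ellipsoid\<close>

definition block_mat :: "nat \<Rightarrow> nat \<Rightarrow> nat \<Rightarrow> (nat \<Rightarrow> nat \<Rightarrow> real) \<Rightarrow> nat \<Rightarrow> nat \<Rightarrow> real" where
  "block_mat m \<alpha> \<beta> B j k =
     (if j \<in> {\<alpha>..<\<alpha> + m} \<and> k \<in> {\<beta>..<\<beta> + m} then B (j - \<alpha>) (k - \<beta>) else 0)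
   + (if k \<in> {\<alpha>..<\<alpha> + m} \<and> j \<in> {\<beta>..<\<beta> + m} then B (k - \<alpha>) (j - \<beta>) else 0)"

lemma block_mat_sym: "block_mat m \<alpha> \<beta> B j k = block_mat m \<alpha> \<beta> B k j"
  by (simp add: block_mat_def)

lemma quad_form_block_mat:
  assumes "\<alpha> + m \<le> d" "\<beta> + m \<le> d"
  shows "quad_form d (block_mat m \<alpha> \<beta> B) x = 2 * (\<Sum>p<m. \<Sum>q<m. x (\<alpha> + p) * B p q * x (\<beta> + q))" (is "?lhs = _")
proof -
  define f where "f = (\<lambda>j k. if j \<in> {\<alpha>..<\<alpha> + m} \<and> k \<in> {\<beta>..<\<beta> + m} then x j * B (j - \<alpha>) (k - \<beta>) * x k else 0)"
  have "?lhs = (\<Sum>j<d. \<Sum>k<d. f j k + f k j)"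
    unfolding quad_form_def block_mat_def f_def by (intro sum.cong refl) (simp add: algebra_simps)
  also have "\<dots> = (\<Sum>j<d. \<Sum>k<d. f j k) + (\<Sum>j<d. \<Sum>k<d. f k j)" by (simp add: sum.distrib)
  also have "(\<Sum>j<d. \<Sum>k<d. f k j) = (\<Sum>j<d. \<Sum>k<d. f j k)" by (rule sum.swap)
  also have "(\<Sum>j<d. \<Sum>k<d. f j k) = (\<Sum>j\<in>{\<alpha>..<\<alpha> + m}. \<Sum>k<d. f j k)"
    using assms by (intro sum.mono_neutral_right) (auto simp: f_def)
  also have "\<dots> = (\<Sum>j\<in>{\<alpha>..<\<alpha> + m}. \<Sum>k\<in>{\<beta>..<\<beta> + m}. f j k)"
    using assms by (intro sum.cong refl sum.mono_neutral_right) (auto simp: f_def)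
  also have "\<dots> = (\<Sum>p<m. \<Sum>q<m. x (\<alpha> + p) * B p q * x (\<beta> + q))"
    by (simp add: sum_shift_interval f_def)
  finally show ?thesis by simp
qed

lemma quad_form_add: "quad_form d (\<lambda>j k. A j k + B j k) x = quad_form d A x + quad_form d B x"
  by (simp add: quad_form_def algebra_simps sum.distrib)

lemma quad_form_scale: "quad_form d (\<lambda>j k. c * A j k) x = c * quad_form d A x"
  by (simp add: quad_form_def sum_distrib_left mult_ac)

lemma quad_form_id: "quad_form d (\<lambda>j k. if j = k then 1 else 0) x = sqn d x"
proof -
  have "quad_form d (\<lambda>j k. if j = k then 1 else 0) x = (\<Sum>j<d. \<Sum>k<d. if j = k then (x j)\<^sup>2 else 0)"
    unfolding quad_form_def by (intro sum.cong refl) (auto simp: power2_eq_square)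
  then show ?thesis by (simp add: sqn_def)
qed

lemma sqn_blocks:
  assumes "4 * m \<le> d"
  shows "sqn m x + sqn m (\<lambda>p. x (m + p)) + (sqn m (\<lambda>p. x (2 * m + p)) + sqn m (\<lambda>p. x (3 * m + p))) \<le> sqn d x" (is "?lhs \<le> _")
proof -
  have "?lhs
     = (\<Sum>j\<in>{0..<0 + m}. (x j)\<^sup>2) + (\<Sum>j\<in>{m..<m + m}. (x j)\<^sup>2) + ((\<Sum>j\<in>{2 * m..<2 * m + m}. (x j)\<^sup>2) + (\<Sum>j\<in>{3 * m..<3 * m + m}. (x j)\<^sup>2))"
    unfolding sum_shift_interval by (simp add: sqn_def)
  also have "\<dots> = (\<Sum>j\<in>{0..<4 * m}. (x j)\<^sup>2)"
    using sum.atLeastLessThan_concat[of 0 m "2 * m" "\<lambda>j. (x j)\<^sup>2"]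
      sum.atLeastLessThan_concat[of "2 * m" "3 * m" "4 * m" "\<lambda>j. (x j)\<^sup>2"]
      sum.atLeastLessThan_concat[of 0 "2 * m" "4 * m" "\<lambda>j. (x j)\<^sup>2"]
    by (simp add: mult_2[symmetric] algebra_simps)
  also have "\<dots> \<le> sqn d x" unfolding sqn_def using assms by (intro sum_mono2) auto
  finally show ?thesis .
qed

theorem theorem2p1:
  shows "\<exists>C::real. C > 4 \<and>
    (\<forall>\<epsilon>>0. \<exists>D::nat. \<forall>d\<ge>D. \<forall>n::nat. d \<ge> 1 \<longrightarrow> real n \<le> (real d)\<^sup>2 / C \<longrightarrow>
       (\<exists>A \<in> sets (gauss_samples d n). A \<subseteq> ellipsoid_fit d n \<and>
           measure (gauss_samples d n) A \<ge> 1 - \<epsilon>))"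
proof (intro exI[of _ "10 ^ 13 :: real"] conjI allI impI)
  fix \<epsilon> :: real assume \<epsilon>: "\<epsilon> > 0"
  have "eventually (\<lambda>d. failure d < \<epsilon> / 2) sequentially"
    using \<epsilon> by (intro order_tendstoD(2)[OF failure_tendsto_0]) simp
  then obtain D0 where D0: "\<And>d. d \<ge> D0 \<Longrightarrow> failure d < \<epsilon> / 2" unfolding eventually_sequentially by blast
  show "\<exists>D::nat. \<forall>d\<ge>D. \<forall>n::nat. d \<ge> 1 \<longrightarrow> real n \<le> (real d)\<^sup>2 / 10 ^ 13 \<longrightarrow>
       (\<exists>A \<in> sets (gauss_samples d n). A \<subseteq> ellipsoid_fit d n \<and> measure (gauss_samples d n) A \<ge> 1 - \<epsilon>)"
  \<comment> \<open>The square of 10000000 exceeds \<open>10 ^ 13\<close>, which makes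
    \<open>N >= 1\<close>, so that a dyadic level exists.\<close>
  proof (intro exI[of _ "max D0 10000000"] allI impI)
    fix d n :: nat assume d: "max D0 10000000 \<le> d" and n: "real n \<le> (real d)\<^sup>2 / 10 ^ 13"
    define m where "m = d div 4"
    have m: "0 < m" "4 * m \<le> d" "d \<le> 5 * m" using d by (auto simp: m_def)
    have d2: "1 \<le> (real d)\<^sup>2 / 10 ^ 13"
    proof -
      have "(10000000::real)\<^sup>2 \<le> (real d)\<^sup>2" using d by (intro power_mono) auto
      then show ?thesis by simp
    qed
    \<comment> \<open>The features of each block are targets of the other. The at most three
      coordinates from \<open>4 * m\<close> on join the first target, so the two targets partition
      all coordinates.\<close>
    interpret X: target_block d n m 0 m "{2 * m..<d}"
      by unfold_locales (use m in auto)
    interpret Y: target_block d n m "2 * m" "3 * m" "{..<2 * m}"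
      by unfold_locales (use m in auto)
    interpret prob_space X.P by (rule X.prob_space_P)
    have gs: "gauss_samples d n = X.P" by (simp add: gauss_samples_def gm_def)
    obtain A where A: "A \<in> sets X.P" "measure X.P (space X.P - A) \<le> failure d"
      "\<And>G. G \<in> A \<Longrightarrow> near_id n (X.Mx G)" "\<And>G. G \<in> A \<Longrightarrow> G \<in> X.E4 (1 / 12800000000) (1 / 12800000000 / 60)"
      by (rule X.block_success[OF n d2 m_def]) blast
    obtain A' where A': "A' \<in> sets X.P" "measure X.P (space X.P - A') \<le> failure d"
      "\<And>G. G \<in> A' \<Longrightarrow> near_id n (Y.Mx G)" "\<And>G. G \<in> A' \<Longrightarrow> G \<in> Y.E4 (1 / 12800000000) (1 / 12800000000 / 60)"
      by (rule Y.block_success[OF n d2 m_def]) blast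
    have "A \<inter> A' \<subseteq> ellipsoid_fit d n"
    proof
      fix G assume "G \<in> A \<inter> A'"
      then have GA: "G \<in> A" and GA': "G \<in> A'" by auto
      have rpos: "(0::real) < 1 / 12800000000" by simp
      have "\<exists>B. (\<forall>i<n. (\<Sum>p<m. \<Sum>q<m. X.fa G i p * B p q * X.fb G i q) / m = X.tx G i) \<and>
          (\<forall>u v. \<bar>\<Sum>p<m. \<Sum>q<m. u p * B p q * v q\<bar> \<le> 1 / 10 * (sqn m u + sqn m v))"
        by (rule X.fit_exists[OF A(3)[OF GA] A(4)[OF GA] rpos]) blast
      then obtain B where B: "\<And>i. i < n \<Longrightarrow> (\<Sum>p<m. \<Sum>q<m. X.fa G i p * B p q * X.fb G i q) / m = X.tx G i"
        "\<And>u v. \<bar>\<Sum>p<m. \<Sum>q<m. u p * B p q * v q\<bar> \<le> 1 / 10 * (sqn m u + sqn m v)"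
        by auto
      have "\<exists>B. (\<forall>i<n. (\<Sum>p<m. \<Sum>q<m. Y.fa G i p * B p q * Y.fb G i q) / m = Y.tx G i) \<and>
          (\<forall>u v. \<bar>\<Sum>p<m. \<Sum>q<m. u p * B p q * v q\<bar> \<le> 1 / 10 * (sqn m u + sqn m v))"
        by (rule Y.fit_exists[OF A'(3)[OF GA'] A'(4)[OF GA'] rpos]) blast
      then obtain B' where B': "\<And>i. i < n \<Longrightarrow> (\<Sum>p<m. \<Sum>q<m. Y.fa G i p * B' p q * Y.fb G i q) / m = Y.tx G i"
        "\<And>u v. \<bar>\<Sum>p<m. \<Sum>q<m. u p * B' p q * v q\<bar> \<le> 1 / 10 * (sqn m u + sqn m v)"
        by auto
      \<comment> \<open>Features carry the factor \<open>sqrt d\<close> each and the fit is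
        normalized by \<open>m\<close>; this weight converts the fit back to the unscaled
        samples.\<close>
      define c where "c = real d / m"
      have c: "0 \<le> c" "c \<le> 5" using m by (auto simp: c_def pos_divide_le_eq)
      define Q where "Q = (\<lambda>j k. (if j = k then 1 else 0) + c * (block_mat m 0 m B j k + block_mat m (2 * m) (3 * m) B' j k))"
      have Q: "quad_form d Q x = sqn d x + c * (2 * (\<Sum>p<m. \<Sum>q<m. x p * B p q * x (m + q))
          + 2 * (\<Sum>p<m. \<Sum>q<m. x (2 * m + p) * B' p q * x (3 * m + q)))" for x
        unfolding Q_def quad_form_add quad_form_scale quad_form_id using m
        by (simp add: quad_form_block_mat)
      have "psd_mat d Q"
        unfolding psd_mat_def
      proof (intro conjI allI impI)
        show "Q j k = Q k j" for j k
          using block_mat_sym[of m 0 m B j k] block_mat_sym[of m "2 * m" "3 * m" B' j k] by (simp add: Q_def)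
        fix x
        define s1 where "s1 = sqn m x + sqn m (\<lambda>p. x (m + p))"
        define s2 where "s2 = sqn m (\<lambda>p. x (2 * m + p)) + sqn m (\<lambda>p. x (3 * m + p))"
        define t1 where "t1 = (\<Sum>p<m. \<Sum>q<m. x p * B p q * x (m + q))"
        define t2 where "t2 = (\<Sum>p<m. \<Sum>q<m. x (2 * m + p) * B' p q * x (3 * m + q))"
        define s where "s = s1 + s2"
        define t where "t = 2 * t1 + 2 * t2"
        have "\<bar>t1\<bar> \<le> 1 / 10 * s1" unfolding t1_def s1_def by (rule B(2))
        moreover have "\<bar>t2\<bar> \<le> 1 / 10 * s2" unfolding t2_def s2_def by (rule B'(2))
        moreover have "\<bar>t\<bar> \<le> 2 * \<bar>t1\<bar> + 2 * \<bar>t2\<bar>"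
          unfolding t_def using abs_triangle_ineq[of "2 * t1" "2 * t2"] by (simp add: abs_mult)
        ultimately have "\<bar>t\<bar> \<le> 1 / 5 * s" by (simp add: s_def)
        \<comment> \<open>The budget closes exactly: twice 1/10, times a weight of at most 5, is 1,
          which the identity part of \<open>Q\<close> dominates.\<close>
        then have "c * \<bar>t\<bar> \<le> 5 * (1 / 5 * s)" using c by (intro mult_mono) auto
        then have "\<bar>c * t\<bar> \<le> s" using c by (simp add: abs_mult)
        moreover have "s \<le> sqn d x" unfolding s_def s1_def s2_def by (rule sqn_blocks[OF m(2)])
        ultimately show "0 \<le> quad_form d Q x" unfolding Q t1_def[symmetric] t2_def[symmetric] t_def[symmetric] by linarith
      qed
      moreover have "quad_form d Q (\<lambda>j. G (i, j)) = 1" if i: "i < n" for i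
      proof -
        have raw: "c * (\<Sum>p<m. \<Sum>q<m. G (i, \<alpha> + p) * W p q * G (i, \<beta> + q))
           = (\<Sum>p<m. \<Sum>q<m. (sqrt d * G (i, \<alpha> + p)) * W p q * (sqrt d * G (i, \<beta> + q))) / m" for \<alpha> \<beta> W
        proof -
          have pw: "(sqrt d * a) * w * (sqrt d * b) = d * (a * w * b)" for a w b :: real
          proof -
            have "(sqrt d * a) * w * (sqrt d * b) = (sqrt d * sqrt d) * (a * w * b)" by (simp only: mult_ac)
            then show ?thesis by simp
          qed
          have "(\<Sum>p<m. \<Sum>q<m. (sqrt d * G (i, \<alpha> + p)) * W p q * (sqrt d * G (i, \<beta> + q)))
             = d * (\<Sum>p<m. \<Sum>q<m. G (i, \<alpha> + p) * W p q * G (i, \<beta> + q))"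
            by (simp only: pw sum_distrib_left)
          then show ?thesis by (simp add: c_def)
        qed
        have X1: "c * (\<Sum>p<m. \<Sum>q<m. G (i, p) * B p q * G (i, m + q)) = X.tx G i"
          using raw[of 0 B m] B(1)[OF i] by (simp add: X.fa_def X.fb_def)
        have Y1: "c * (\<Sum>p<m. \<Sum>q<m. G (i, 2 * m + p) * B' p q * G (i, 3 * m + q)) = Y.tx G i"
          using raw[of "2 * m" B' "3 * m"] B'(1)[OF i] by (simp add: Y.fa_def Y.fb_def)
        have d0: "real d > 0" using m by simp
        define h where "h = (\<lambda>j. (sqrt d * G (i, j))\<^sup>2 - 1)"
        define S where "S = (\<Sum>j\<in>{2 * m..<d}. h j)"
        define S' where "S' = (\<Sum>j\<in>{..<2 * m}. h j)"
        have XY: "X.tx G i = - (1 / (2 * d)) * S" "Y.tx G i = - (1 / (2 * d)) * S'"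
          unfolding X.tx_def Y.tx_def S_def S'_def h_def by (rule refl)+
        have "2 * X.tx G i + 2 * Y.tx G i = - (1 / d) * ((\<Sum>j\<in>{..<2 * m}. h j) + (\<Sum>j\<in>{2 * m..<d}. h j))"
          unfolding XY S_def[symmetric] S'_def[symmetric] by (simp add: distrib_left add_divide_distrib)
        also have "(\<Sum>j\<in>{..<2 * m}. h j) + (\<Sum>j\<in>{2 * m..<d}. h j) = (\<Sum>j<d. h j)"
          unfolding lessThan_atLeast0 using m by (intro sum.atLeastLessThan_concat) auto
        also have "(\<Sum>j<d. h j) = d * (sqn d (\<lambda>j. G (i, j)) - 1)"
          by (simp add: h_def sum_subtractf power_mult_distrib sum_distrib_left[symmetric] sqn_def right_diff_distrib)
        finally have "2 * X.tx G i + 2 * Y.tx G i = 1 - sqn d (\<lambda>j. G (i, j))" using d0 by simp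
        then show ?thesis unfolding Q using X1 Y1 by (simp add: algebra_simps)
      qed
      ultimately show "G \<in> ellipsoid_fit d n" by (auto simp: ellipsoid_fit_def)
    qed
    moreover have "measure X.P (A \<inter> A') \<ge> 1 - \<epsilon>"
    proof -
      have "measure X.P (space X.P - (A \<inter> A')) \<le> measure X.P (space X.P - A) + measure X.P (space X.P - A')"
        using A(1) A'(1) measure_Un_le[of "space X.P - A" X.P "space X.P - A'"] by (simp add: Diff_Int)
      also have "\<dots> \<le> \<epsilon>" using A(2) A'(2) D0[of d] d by simp
      finally show ?thesis using prob_compl[of "A \<inter> A'"] A(1) A'(1) by simp
    qed
    ultimately show "\<exists>A \<in> sets (gauss_samples d n). A \<subseteq> ellipsoid_fit d n \<and> measure (gauss_samples d n) A \<ge> 1 - \<epsilon>"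
      unfolding gs using A(1) A'(1) by blast
  qed
qed simp

end
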